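(* Let $X$ be an integer-valued random variable with $\mathbb{E}[X]=0$, $\mathbb{P}(X<-1)=0$ and $\mathbb{P}(X=x)\sim L(x)/x^2$ as $x\to\infty$ (along integers), where $L$ is slowly varying at $\infty$. Let $W_0=0$, $W_n=X_1+\cdots+X_n$ with $(X_i)_{i\ge1}$ i.i.d. copies of $X$, and $\zeta=\inf\{i\ge1:W_i<0\}$. For $n$ large, let $(W^{(n)}_i:i\ge0)$ have the law of $(W_i:i\ge0)$ under $\mathbb{P}(\,\cdot\mid\zeta=n)$, and set $W^{(n)}_k=0$ for $k<0$. Then $$\left(\frac{W^{(n)}_{\lfloor nt\rfloor}}{|b_n|}:-1\le t\le1\right)\ \longrightarrow\ \left((1-t)\mathbf{1}_{t\ge0}:-1\le t\le1\right)$$ in distribution in $\mathbb{D}([-1,1],\mathbb{R})$ as $n\to\infty$.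
   Context: $(a_n)_{n\ge1}$ and $(b_n)_{n\ge1}$ are sequences such that $n\,\mathbb{P}(X\ge a_n)\to 1$ and $b_n=n\,\mathbb{E}[X\mathbf{1}_{|X|\le a_n}]$ (one has $b_n\to-\infty$). $\mathbb{D}(I,\mathbb{R})$ is the space of real-valued càdlàg functions on the interval $I$ equipped with the Skorokhod $J_1$ topology. *)

theory Defs
  imports
    "HOL-Probability.Probability"
    "HOL-Library.Landau_Symbols"
    "HOL-Library.Extended_Nat"
begin

section \<open>The Skorokhod space over a compact interval\<close>

text \<open>
  Elements of \<open>\<D>([a,b], \<real>)\<close> are functions on the whole real line that are
  \<open>undefined\<close> outside \<open>[a,b]\<close>, so that equality of elements is equality on \<open>[a,b]\<close>.
\<close>

definition skorokhod_space :: "real \<Rightarrow> real \<Rightarrow> (real \<Rightarrow> real) set" where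
  "skorokhod_space a b = {f \<in> extensional {a..b}.
     (\<forall>t\<in>{a..<b}. (f \<longlongrightarrow> f t) (at_right t)) \<and>
     (\<forall>t\<in>{a<..b}. \<exists>l. (f \<longlongrightarrow> l) (at_left t))}"

definition time_changes :: "real \<Rightarrow> real \<Rightarrow> (real \<Rightarrow> real) set" where
  "time_changes a b = {\<mu>. strict_mono_on {a..b} \<mu> \<and> continuous_on {a..b} \<mu> \<and> \<mu> ` {a..b} = {a..b}}"

definition skorokhod_close :: "real \<Rightarrow> real \<Rightarrow> (real \<Rightarrow> real) \<Rightarrow> (real \<Rightarrow> real) \<Rightarrow> real \<Rightarrow> bool" where
  "skorokhod_close a b f g e \<longleftrightarrow> (\<exists>\<mu>\<in>time_changes a b. \<forall>t\<in>{a..b}.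
      \<bar>\<mu> t - t\<bar> \<le> e \<and> \<bar>f t - g (\<mu> t)\<bar> \<le> e)"

text \<open>
  Skorokhod's (incomplete) metric, which induces the \<open>J\<^sub>1\<close> topology. The value \<open>0\<close> outside
  the space is irrelevant; it is there because \<open>Metric_space\<close> asks for non-negativity everywhere.
\<close>

definition skorokhod_dist :: "real \<Rightarrow> real \<Rightarrow> (real \<Rightarrow> real) \<Rightarrow> (real \<Rightarrow> real) \<Rightarrow> real" where
  "skorokhod_dist a b f g =
     (if f \<in> skorokhod_space a b \<and> g \<in> skorokhod_space a b
      then Inf {e. e > 0 \<and> skorokhod_close a b f g e} else 0)"

definition J1_topology :: "real \<Rightarrow> real \<Rightarrow> (real \<Rightarrow> real) topology" where
  "J1_topology a b = Metric_space.mtopology (skorokhod_space a b) (skorokhod_dist a b)"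

lemma skorokhod_bounded:
  assumes f: "f \<in> skorokhod_space a b"
  shows "\<exists>B. \<forall>t\<in>{a..b}. \<bar>f t\<bar> \<le> B"
proof -
  have "\<exists>d>0. \<exists>B. \<forall>s\<in>ball t d \<inter> {a..b}. \<bar>f s\<bar> \<le> B" if t: "t \<in> {a..b}" for t
  proof -
    have "\<exists>d>0. \<exists>B. \<forall>s. s \<in> {a..b} \<longrightarrow> t < s \<longrightarrow> s < t + d \<longrightarrow> \<bar>f s\<bar> \<le> B"
    proof (cases "t < b")
      case True
      then have "(f \<longlongrightarrow> f t) (at_right t)"
        using f t by (auto simp: skorokhod_space_def)
      then have "\<forall>\<^sub>F s in at_right t. dist (f s) (f t) < 1"
        by (rule tendstoD) simp
      then obtain c where c: "c > t" "\<And>s. t < s \<Longrightarrow> s < c \<Longrightarrow> dist (f s) (f t) < 1"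
        by (auto simp: eventually_at_right_field)
      have "\<bar>f s\<bar> \<le> \<bar>f t\<bar> + 1" if "t < s" "s < c" for s
        using c(2)[OF that] by (auto simp: dist_real_def)
      then show ?thesis
        using c(1) by (intro exI[of _ "c - t"] conjI exI[of _ "\<bar>f t\<bar> + 1"]) auto
    next
      case False
      then show ?thesis by (intro exI[of _ 1]) auto
    qed
    then obtain d1 B1 where 1: "d1 > 0"
        "\<And>s. s \<in> {a..b} \<Longrightarrow> t < s \<Longrightarrow> s < t + d1 \<Longrightarrow> \<bar>f s\<bar> \<le> B1" by blast
    have "\<exists>d>0. \<exists>B. \<forall>s. s \<in> {a..b} \<longrightarrow> s < t \<longrightarrow> t - d < s \<longrightarrow> \<bar>f s\<bar> \<le> B"
    proof (cases "a < t")
      case True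
      then have "t \<in> {a<..b}" using t by auto
      then obtain l where "(f \<longlongrightarrow> l) (at_left t)"
        using f unfolding skorokhod_space_def by blast
      then have "\<forall>\<^sub>F s in at_left t. dist (f s) l < 1"
        by (rule tendstoD) simp
      then obtain c where c: "c < t" "\<And>s. c < s \<Longrightarrow> s < t \<Longrightarrow> dist (f s) l < 1"
        by (auto simp: eventually_at_left_field)
      have "\<bar>f s\<bar> \<le> \<bar>l\<bar> + 1" if "c < s" "s < t" for s
        using c(2)[OF that] by (auto simp: dist_real_def)
      then show ?thesis
        using c(1) by (intro exI[of _ "t - c"] conjI exI[of _ "\<bar>l\<bar> + 1"]) auto
    next
      case False
      then show ?thesis by (intro exI[of _ 1]) auto
    qed
    then obtain d2 B2 where 2: "d2 > 0"
        "\<And>s. s \<in> {a..b} \<Longrightarrow> s < t \<Longrightarrow> t - d2 < s \<Longrightarrow> \<bar>f s\<bar> \<le> B2" by blast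
    have "\<bar>f s\<bar> \<le> max (max B1 B2) \<bar>f t\<bar>" if "s \<in> ball t (min d1 d2) \<inter> {a..b}" for s
    proof -
      consider "s < t" | "s = t" | "t < s" by linarith
      then show ?thesis
        using 1(2)[of s] 2(2)[of s] that by cases (auto simp: dist_real_def)
    qed
    moreover have "min d1 d2 > 0" using 1(1) 2(1) by simp
    ultimately show ?thesis by blast
  qed
  then have "\<forall>t\<in>{a..b}. \<exists>p. fst p > 0 \<and> (\<forall>s\<in>ball t (fst p) \<inter> {a..b}. \<bar>f s\<bar> \<le> snd p)"
    by simp
  then obtain p where p: "\<forall>t\<in>{a..b}. fst (p t) > 0 \<and>
      (\<forall>s\<in>ball t (fst (p t)) \<inter> {a..b}. \<bar>f s\<bar> \<le> snd (p t))"
    by (rule bchoice[THEN exE])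
  define d B where "d = (\<lambda>t. fst (p t))" and "B = (\<lambda>t. snd (p t))"
  have dB: "\<And>t. t \<in> {a..b} \<Longrightarrow> d t > 0"
      "\<And>t s. t \<in> {a..b} \<Longrightarrow> s \<in> ball t (d t) \<inter> {a..b} \<Longrightarrow> \<bar>f s\<bar> \<le> B t"
    using p unfolding d_def B_def by blast+
  have "{a..b} \<subseteq> (\<Union>t\<in>{a..b}. ball t (d t))" using dB(1) by fastforce
  then obtain T where T: "T \<subseteq> {a..b}" "finite T" "{a..b} \<subseteq> (\<Union>t\<in>T. ball t (d t))"
    by (rule compactE_image[OF compact_Icc, rotated]) auto
  have "\<bar>f s\<bar> \<le> (\<Sum>t\<in>T. \<bar>B t\<bar>)" if s: "s \<in> {a..b}" for s
  proof -
    obtain t where t: "t \<in> T" "s \<in> ball t (d t)" using T(3) s by auto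
    then have "\<bar>f s\<bar> \<le> \<bar>B t\<bar>" using dB(2)[of t s] T(1) s by fastforce
    also have "\<dots> \<le> (\<Sum>t\<in>T. \<bar>B t\<bar>)"
      using T(2) t(1) by (intro member_le_sum) auto
    finally show ?thesis .
  qed
  then show ?thesis by blast
qed

lemma time_change_id: "(\<lambda>t. t) \<in> time_changes a b"
  by (auto simp: time_changes_def strict_mono_on_def)

lemma time_change_comp:
  assumes "\<mu> \<in> time_changes a b" "\<nu> \<in> time_changes a b"
  shows "(\<lambda>t. \<nu> (\<mu> t)) \<in> time_changes a b"
proof -
  have im: "\<mu> ` {a..b} = {a..b}" "\<nu> ` {a..b} = {a..b}"
    using assms by (auto simp: time_changes_def)
  have "strict_mono_on {a..b} (\<lambda>t. \<nu> (\<mu> t))"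
  proof (rule strict_mono_onI)
    fix r s assume rs: "r \<in> {a..b}" "s \<in> {a..b}" "r < s"
    have "\<mu> r \<in> {a..b}" "\<mu> s \<in> {a..b}" using rs im(1) by blast+
    moreover have "\<mu> r < \<mu> s"
      using assms(1) strict_mono_onD[of "{a..b}" \<mu>, OF _ rs] by (simp add: time_changes_def)
    ultimately    show "\<nu> (\<mu> r) < \<nu> (\<mu> s)"
      using assms(2) strict_mono_onD[of "{a..b}" \<nu> "\<mu> r" "\<mu> s"] by (simp add: time_changes_def)
  qed
  moreover have "continuous_on {a..b} (\<lambda>t. \<nu> (\<mu> t))"
  proof (rule continuous_on_compose2[of "{a..b}" \<nu>])
    show "continuous_on {a..b} \<nu>" "continuous_on {a..b} \<mu>"
      using assms by (simp_all add: time_changes_def)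
    show "\<mu> ` {a..b} \<subseteq> {a..b}" using im(1) by blast
  qed
  moreover have "(\<lambda>t. \<nu> (\<mu> t)) ` {a..b} = {a..b}"
    unfolding image_image[symmetric, of \<nu> \<mu>] im ..
  ultimately show ?thesis by (simp add: time_changes_def)
qed

lemma time_change_inv:
  assumes "\<mu> \<in> time_changes a b"
  shows "inv_into {a..b} \<mu> \<in> time_changes a b"
proof -
  have mono: "strict_mono_on {a..b} \<mu>" and cont: "continuous_on {a..b} \<mu>"
    and im: "\<mu> ` {a..b} = {a..b}"
    using assms by (auto simp: time_changes_def)
  have inj: "inj_on \<mu> {a..b}" using mono by (rule strict_mono_on_imp_inj_on)
  have "strict_mono_on {a..b} (inv_into {a..b} \<mu>)"
  proof (rule strict_mono_onI)
    fix r s assume rs: "r \<in> {a..b}" "s \<in> {a..b}" "r < s"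
    have in': "inv_into {a..b} \<mu> r \<in> {a..b}" "inv_into {a..b} \<mu> s \<in> {a..b}"
      using rs im inv_into_into[of _ \<mu> "{a..b}"] by blast+
    have "\<mu> (inv_into {a..b} \<mu> r) = r" "\<mu> (inv_into {a..b} \<mu> s) = s"
      using rs im f_inv_into_f[of _ \<mu> "{a..b}"] by blast+
    then show "inv_into {a..b} \<mu> r < inv_into {a..b} \<mu> s"
      using rs in' strict_mono_on_less[OF mono in'] by simp
  qed
  moreover have "continuous_on {a..b} (inv_into {a..b} \<mu>)"
    using continuous_on_inv[OF cont compact_Icc, of "inv_into {a..b} \<mu>"] inj im by simp
  moreover have "inv_into {a..b} \<mu> ` {a..b} = {a..b}"
    using bij_betw_imp_surj_on[OF bij_betw_inv_into[of \<mu> "{a..b}" "{a..b}"]] inj im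
    by (simp add: bij_betw_def)
  ultimately show ?thesis by (simp add: time_changes_def)
qed

lemma time_change_end:
  assumes "\<mu> \<in> time_changes a b" "a \<le> b"
  shows "\<mu> b = b"
proof -
  have im: "\<mu> ` {a..b} = {a..b}" and mono: "mono_on {a..b} \<mu>"
    using assms by (auto simp: time_changes_def strict_mono_on_imp_mono_on)
  obtain t where t: "t \<in> {a..b}" "\<mu> t = b"
  proof -
    have "b \<in> \<mu> ` {a..b}" using im assms(2) by simp
    then show thesis using that by blast
  qed
  then have "b \<le> \<mu> b" using mono_onD[OF mono, of t b] assms(2) by auto
  moreover have "\<mu> b \<in> {a..b}" using im assms(2) by auto
  ultimately show ?thesis by auto
qed

lemma skorokhod_close_sym:
  assumes "skorokhod_close a b f g e"
  shows "skorokhod_close a b g f e"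
proof -
  obtain \<mu> where \<mu>: "\<mu> \<in> time_changes a b"
    "\<And>t. t \<in> {a..b} \<Longrightarrow> \<bar>\<mu> t - t\<bar> \<le> e \<and> \<bar>f t - g (\<mu> t)\<bar> \<le> e"
    using assms by (auto simp: skorokhod_close_def)
  let ?\<nu> = "inv_into {a..b} \<mu>"
  have im: "\<mu> ` {a..b} = {a..b}" using \<mu>(1) by (auto simp: time_changes_def)
  have "\<bar>?\<nu> t - t\<bar> \<le> e \<and> \<bar>g t - f (?\<nu> t)\<bar> \<le> e" if "t \<in> {a..b}" for t
  proof -
    have "\<mu> (?\<nu> t) = t" "?\<nu> t \<in> {a..b}"
      using that im f_inv_into_f[of t \<mu> "{a..b}"] inv_into_into[of t \<mu> "{a..b}"] by blast+
    then show ?thesis using \<mu>(2)[of "?\<nu> t"] by (auto simp: abs_minus_commute)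
  qed
  then show ?thesis
    using time_change_inv[OF \<mu>(1)] unfolding skorokhod_close_def by blast
qed

lemma skorokhod_close_trans:
  assumes "skorokhod_close a b f g e" "skorokhod_close a b g h e'"
  shows "skorokhod_close a b f h (e + e')"
proof -
  obtain \<mu> where \<mu>: "\<mu> \<in> time_changes a b"
    "\<And>t. t \<in> {a..b} \<Longrightarrow> \<bar>\<mu> t - t\<bar> \<le> e \<and> \<bar>f t - g (\<mu> t)\<bar> \<le> e"
    using assms(1) by (auto simp: skorokhod_close_def)
  obtain \<nu> where \<nu>: "\<nu> \<in> time_changes a b"
    "\<And>t. t \<in> {a..b} \<Longrightarrow> \<bar>\<nu> t - t\<bar> \<le> e' \<and> \<bar>g t - h (\<nu> t)\<bar> \<le> e'"
    using assms(2) by (auto simp: skorokhod_close_def)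
  have "\<bar>\<nu> (\<mu> t) - t\<bar> \<le> e + e' \<and> \<bar>f t - h (\<nu> (\<mu> t))\<bar> \<le> e + e'" if t: "t \<in> {a..b}" for t
  proof -
    have "\<mu> t \<in> {a..b}" using \<mu>(1) t by (auto simp: time_changes_def)
    then show ?thesis using \<mu>(2)[OF t] \<nu>(2)[of "\<mu> t"] by linarith
  qed
  then show ?thesis
    unfolding skorokhod_close_def by (intro bexI[OF _ time_change_comp[OF \<mu>(1) \<nu>(1)]]) blast
qed

lemma skorokhod_close_refl: "e \<ge> 0 \<Longrightarrow> skorokhod_close a b f f e"
  unfolding skorokhod_close_def by (intro bexI[OF _ time_change_id]) auto

lemma skorokhod_close_ex:
  assumes "f \<in> skorokhod_space a b" "g \<in> skorokhod_space a b"
  shows "\<exists>e>0. skorokhod_close a b f g e"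
proof -
  obtain B where B: "\<And>t. t \<in> {a..b} \<Longrightarrow> \<bar>f t\<bar> \<le> B"
    using skorokhod_bounded[OF assms(1)] by blast
  obtain C where C: "\<And>t. t \<in> {a..b} \<Longrightarrow> \<bar>g t\<bar> \<le> C"
    using skorokhod_bounded[OF assms(2)] by blast
  have "\<bar>f t - g t\<bar> \<le> \<bar>B\<bar> + \<bar>C\<bar> + 1" if "t \<in> {a..b}" for t
    using B[OF that] C[OF that] by linarith
  then have "skorokhod_close a b f g (\<bar>B\<bar> + \<bar>C\<bar> + 1)"
    unfolding skorokhod_close_def by (intro bexI[OF _ time_change_id]) auto
  then show ?thesis by (intro exI[of _ "\<bar>B\<bar> + \<bar>C\<bar> + 1"]) auto
qed

lemma skorokhod_close_imp_eq:
  assumes f: "f \<in> skorokhod_space a b" and g: "g \<in> skorokhod_space a b"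
    and close: "\<And>e. e > 0 \<Longrightarrow> skorokhod_close a b f g e"
  shows "f = g"
proof (rule extensionalityI[of f "{a..b}" g])
  fix t assume t: "t \<in> {a..b}"
  have "\<bar>f t - g t\<bar> \<le> 0 + e" if e: "e > 0" for e
  proof (cases "t < b")
    case False
    then have "t = b" using t by auto
    then show ?thesis
      using close[OF e] time_change_end[of _ a b] t by (force simp: skorokhod_close_def)
  next
    case True
    have "(f \<longlongrightarrow> f t) (at_right t)" "(g \<longlongrightarrow> g t) (at_right t)"
      using f g t True by (auto simp: skorokhod_space_def)
    then have "\<forall>\<^sub>F s in at_right t. dist (f s) (f t) < e / 3 \<and> dist (g s) (g t) < e / 3"
      using e by (intro eventually_conj tendstoD) auto
    then obtain c where c: "c > t" "\<And>s. t < s \<Longrightarrow> s < c \<Longrightarrow>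
        dist (f s) (f t) < e / 3 \<and> dist (g s) (g t) < e / 3"
      by (auto simp: eventually_at_right_field)
    define d where "d = min c b - t"
    have d: "d > 0" "t + d \<le> c" "t + d \<le> b" using c(1) True by (auto simp: d_def)
    obtain \<mu> where \<mu>: "\<mu> \<in> time_changes a b" "\<And>s. s \<in> {a..b} \<Longrightarrow>
        \<bar>\<mu> s - s\<bar> \<le> min (e / 3) (d / 4) \<and> \<bar>f s - g (\<mu> s)\<bar> \<le> min (e / 3) (d / 4)"
      using close[of "min (e / 3) (d / 4)"] e d by (auto simp: skorokhod_close_def)
    have s: "t + d / 2 \<in> {a..b}" using t d by auto
    have \<mu>s: "\<bar>\<mu> (t + d / 2) - (t + d / 2)\<bar> \<le> d / 4" "\<bar>f (t + d / 2) - g (\<mu> (t + d / 2))\<bar> \<le> e / 3"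
      using \<mu>(2)[OF s] by simp_all
    have m: "t < \<mu> (t + d / 2)" "\<mu> (t + d / 2) < c"
      using \<mu>s(1) d by linarith+
    have "\<bar>f (t + d / 2) - f t\<bar> < e / 3" "\<bar>g (\<mu> (t + d / 2)) - g t\<bar> < e / 3"
      using c(2)[OF m] c(2)[of "t + d / 2"] d by (simp_all add: dist_real_def)
    then show ?thesis
      using \<mu>s(2) by linarith
  qed
  then show "f t = g t" using field_le_epsilon[of "\<bar>f t - g t\<bar>" 0] by auto
qed (use f g in \<open>auto simp: skorokhod_space_def\<close>)

lemma skorokhod_close_mono: "skorokhod_close a b f g e \<Longrightarrow> e \<le> e' \<Longrightarrow> skorokhod_close a b f g e'"
  unfolding skorokhod_close_def by (meson order_trans)

lemma skorokhod_dist_nonneg: "0 \<le> skorokhod_dist a b f g"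
proof (cases "f \<in> skorokhod_space a b \<and> g \<in> skorokhod_space a b")
  case True
  then have "{e. e > 0 \<and> skorokhod_close a b f g e} \<noteq> {}"
    using skorokhod_close_ex by auto
  then show ?thesis
    using True unfolding skorokhod_dist_def by (auto intro!: cInf_greatest)
qed (auto simp: skorokhod_dist_def)

lemma skorokhod_dist_le:
  assumes "e > 0" "skorokhod_close a b f g e"
  shows "skorokhod_dist a b f g \<le> e"
proof -
  have "Inf {e. e > 0 \<and> skorokhod_close a b f g e} \<le> e"
    using assms by (intro cInf_lower bdd_belowI[of _ 0]) auto
  then show ?thesis using assms(1) by (auto simp: skorokhod_dist_def)
qed

lemma skorokhod_dist_less:
  assumes "f \<in> skorokhod_space a b" "g \<in> skorokhod_space a b" "skorokhod_dist a b f g < r"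
  obtains e where "0 < e" "e < r" "skorokhod_close a b f g e"
proof -
  have ne: "{e. e > 0 \<and> skorokhod_close a b f g e} \<noteq> {}"
    using skorokhod_close_ex[OF assms(1,2)] by auto
  have "Inf {e. e > 0 \<and> skorokhod_close a b f g e} < r"
    using assms by (simp add: skorokhod_dist_def)
  from cInf_lessD[OF ne this] show thesis using that by auto
qed

lemma Metric_space_skorokhod: "Metric_space (skorokhod_space a b) (skorokhod_dist a b)"
proof
  show "0 \<le> skorokhod_dist a b f g" for f g
    by (rule skorokhod_dist_nonneg)
  show "skorokhod_dist a b f g = skorokhod_dist a b g f" for f g
  proof -
    have "skorokhod_close a b f g = skorokhod_close a b g f"
      using skorokhod_close_sym by blast
    then show ?thesis by (auto simp: skorokhod_dist_def)
  qed
  show "skorokhod_dist a b f g = 0 \<longleftrightarrow> f = g"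
    if fg: "f \<in> skorokhod_space a b" "g \<in> skorokhod_space a b" for f g
  proof
    assume 0: "skorokhod_dist a b f g = 0"
    show "f = g"
    proof (rule skorokhod_close_imp_eq[OF fg])
      fix e :: real assume "e > 0"
      then obtain e' where "e' < e" "skorokhod_close a b f g e'"
        using skorokhod_dist_less[OF fg, of e] 0 by auto
      then show "skorokhod_close a b f g e"
        using skorokhod_close_mono by (metis less_imp_le)
    qed
  next
    assume "f = g"
    then have "skorokhod_dist a b f g \<le> 0 + e" if "e > 0" for e
      using skorokhod_dist_le[OF that] skorokhod_close_refl[of e a b f] that by auto
    then have "skorokhod_dist a b f g \<le> 0" by (rule field_le_epsilon)
    then show "skorokhod_dist a b f g = 0"
      using skorokhod_dist_nonneg[of a b f g] by linarith
  qed
  show "skorokhod_dist a b f h \<le> skorokhod_dist a b f g + skorokhod_dist a b g h"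
    if fgh: "f \<in> skorokhod_space a b" "g \<in> skorokhod_space a b" "h \<in> skorokhod_space a b" for f g h
  proof (rule field_le_epsilon)
    fix e :: real assume "e > 0"
    then obtain e1 e2 where
      "0 < e1" "e1 < skorokhod_dist a b f g + e / 2" "skorokhod_close a b f g e1"
      "0 < e2" "e2 < skorokhod_dist a b g h + e / 2" "skorokhod_close a b g h e2"
      using skorokhod_dist_less[OF fgh(1,2), of "skorokhod_dist a b f g + e / 2"]
        skorokhod_dist_less[OF fgh(2,3), of "skorokhod_dist a b g h + e / 2"]
      by (smt (verit) half_gt_zero)
    then show "skorokhod_dist a b f h \<le> skorokhod_dist a b f g + skorokhod_dist a b g h + e"
      using skorokhod_dist_le[OF _ skorokhod_close_trans, of e1 e2 a b f g h] by linarith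
  qed
qed

lemma topspace_J1_topology: "topspace (J1_topology a b) = skorokhod_space a b"
  unfolding J1_topology_def by (rule Metric_space.topspace_mtopology[OF Metric_space_skorokhod])


section \<open>Convergence in distribution in a topological space\<close>

definition borel_of :: "'a topology \<Rightarrow> 'a measure" where
  "borel_of T = sigma (topspace T) {U. openin T U}"

definition weak_conv_in :: "'a topology \<Rightarrow> (nat \<Rightarrow> 'a measure) \<Rightarrow> 'a measure \<Rightarrow> bool" where
  "weak_conv_in T \<mu>s \<mu> \<longleftrightarrow>
     (\<forall>\<^sub>F n in sequentially. prob_space (\<mu>s n) \<and> sets (\<mu>s n) = sets (borel_of T)) \<and>
     prob_space \<mu> \<and> sets \<mu> = sets (borel_of T) \<and>
     (\<forall>\<phi>. continuous_map T euclideanreal \<phi> \<and> bounded (\<phi> ` topspace T) \<longrightarrow>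
        (\<lambda>n. \<integral>f. \<phi> f \<partial>\<mu>s n) \<longlonglongrightarrow> (\<integral>f. \<phi> f \<partial>\<mu>))"


section \<open>Slowly varying functions\<close>

text \<open>As usual, measurability and positivity are only required near infinity.\<close>

definition slowly_varying :: "(real \<Rightarrow> real) \<Rightarrow> bool" where
  "slowly_varying L \<longleftrightarrow>
     (\<exists>A. L \<in> borel_measurable (restrict_space borel {A..}) \<and> (\<forall>x\<ge>A. L x > 0)) \<and>
     (\<forall>c>0. ((\<lambda>x. L (c * x) / L x) \<longlongrightarrow> 1) at_top)"


section \<open>The random walk\<close>

definition walk :: "(nat \<Rightarrow> 'a \<Rightarrow> int) \<Rightarrow> nat \<Rightarrow> 'a \<Rightarrow> int" where
  "walk Xs n \<omega> = (\<Sum>i=1..n. Xs i \<omega>)"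

definition hitting_time :: "(nat \<Rightarrow> 'a \<Rightarrow> int) \<Rightarrow> 'a \<Rightarrow> enat" where
  "hitting_time Xs \<omega> = Inf {enat i |i. i \<ge> 1 \<and> walk Xs i \<omega> < 0}"

definition extended_walk :: "(nat \<Rightarrow> 'a \<Rightarrow> int) \<Rightarrow> int \<Rightarrow> 'a \<Rightarrow> int" where
  "extended_walk Xs k \<omega> = (if k < 0 then 0 else walk Xs (nat k) \<omega>)"

definition scaled_path :: "(nat \<Rightarrow> 'a \<Rightarrow> int) \<Rightarrow> (nat \<Rightarrow> real) \<Rightarrow> nat \<Rightarrow> 'a \<Rightarrow> real \<Rightarrow> real" where
  "scaled_path Xs b n \<omega> =
     (\<lambda>t\<in>{-1..1}. real_of_int (extended_walk Xs \<lfloor>real n * t\<rfloor> \<omega>) / \<bar>b n\<bar>)"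

text \<open>
  The law of the rescaled path under \<open>\<P>(\<sqdot> | \<zeta> = n)\<close>. If the conditioning event is null, this is
  the null measure rather than a probability measure.
\<close>

definition conditioned_path_law ::
  "'a measure \<Rightarrow> (nat \<Rightarrow> 'a \<Rightarrow> int) \<Rightarrow> (nat \<Rightarrow> real) \<Rightarrow> nat \<Rightarrow> (real \<Rightarrow> real) measure" where
  "conditioned_path_law M Xs b n =
     distr (uniform_measure M {\<omega> \<in> space M. hitting_time Xs \<omega> = enat n})
           (borel_of (J1_topology (-1) 1)) (scaled_path Xs b n)"

definition limit_path :: "real \<Rightarrow> real" where
  "limit_path = (\<lambda>t\<in>{-1..1}. (1 - t) * indicator {0..} t)"

end

theory Submission
  imports Defs
begin

text \<open>
  By the cyclic lemma, excursions of length \<open>n\<close> are the rotations of bridges with \<open>W\<^sub>n = -1\<close>, so the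
  probability of a set of excursions is at most that of any event into which each of its members can
  be rotated; this replaces the local limit theorem and the Vervaat transform. Rotate so that a
  largest jump comes first. The remaining \<open>n - 1\<close> steps follow the line of slope \<open>-|b\<^sub>n|/n\<close> by
  truncation and Kolmogorov's maximal inequality, so they require a first jump of size about
  \<open>|b\<^sub>n|\<close>; this alone gives \<open>\<P>(\<zeta> = n) \<ge> c \<P>(X = |b\<^sub>n|)\<close>. If the largest jump is of order \<open>v\<close>, much
  smaller than \<open>|b\<^sub>n|\<close>, a Chernoff bound at scale \<open>1/v\<close> against the truncated drift beats all powers
  of \<open>|b\<^sub>n|/v\<close>, and a dyadic sum over \<open>v\<close> shows that such excursions are negligible. On the remaining
  excursions positivity forces the big jump to occur at a time \<open>o(n)\<close>, and the path is then close to
  the limit.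
\<close>

text \<open>What makes a single jump win is \<open>rho_le_D\<close>: the jump density at scale
  \<open>x\<close>, measured by \<open>rho x\<close>, is negligible against the drift
  \<open>D x\<close> created by cutting the mean off at \<open>x\<close>. As \<open>be n\<close> is
  close to \<open>n * D (al n)\<close>, this one fact yields three things: \<open>n\<close> steps
  contain no jump of order \<open>be n\<close>, the total variance of \<open>n\<close> steps cut off
  at \<open>be n\<close> is \<open>o(be n ^ 2)\<close>, and their drift agrees to first order with
  that of steps cut off at \<open>al n\<close>, hence with \<open>b n\<close>. Only orders of
  magnitude are compared: excursions have probability at least \<open>pmf q (be n) / 32\<close>, bad
  ones at most \<open>h * pmf q (be n)\<close> for arbitrary \<open>h\<close>. Both bounds contain a
  value of \<open>pmf q\<close> because in a bridge the first step is determined by the others; the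
  factor \<open>n\<close> of the cyclic lemma cancels. The dyadic sum is small because the Chernoff
  factor leaves a spare power of \<open>v / be n\<close>, so that the sum is dominated by its
  largest level. The uniform distance would not do: the path jumps at a small positive time and the
  limit at 0. On [-1, 1] the time 0 is interior, so a time change can align the two jumps.\<close>

section \<open>Uniform convergence for slowly varying functions\<close>

text \<open>The Csiszar--Erdos proof: the points \<open>v\<close> where \<open>h (x\<^sub>m + v) - h x\<^sub>m\<close> and
  \<open>h (x\<^sub>m + u\<^sub>m + v) - h (x\<^sub>m + u\<^sub>m)\<close> have become small fill most of an interval, so the
  shifted sets must intersect.\<close>

lemma uniform_convergence_additive:
  fixes h :: "real \<Rightarrow> real" and x u :: "nat \<Rightarrow> real"
  assumes h[measurable]: "h \<in> borel_measurable borel"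
    and lim: "\<And>v. ((\<lambda>t. h (t + v) - h t) \<longlongrightarrow> 0) at_top"
    and R: "0 < R" and u: "\<And>n. 0 \<le> u n \<and> u n \<le> R"
    and x: "filterlim x at_top sequentially" and e: "0 < e"
  shows "\<exists>n. \<bar>h (x n + u n) - h (x n)\<bar> < e"
proof -
  \<comment> \<open>Three quarters of [0, 2 R] is the right threshold: \<open>V\<close> and the
    translate of \<open>W\<close> by \<open>u n\<close> both lie in [0, 3 R], and 3/2 R + 3/2 R = 3
    R.\<close>
  have fill: "\<forall>\<^sub>F n in sequentially.
      emeasure lborel {v \<in> {0..2*R}. \<forall>m\<ge>n. \<bar>h (y m + v) - h (y m)\<bar> < e / 2} > ennreal (3/2 * R)"
    if y: "filterlim y at_top sequentially" for y :: "nat \<Rightarrow> real"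
  proof -
    define A where "A = (\<lambda>n. {v \<in> {0..2*R}. \<forall>m\<ge>n. \<bar>h (y m + v) - h (y m)\<bar> < e / 2})"
    have meas: "A n \<in> sets lborel" for n unfolding A_def by measurable
    have inc: "incseq A" unfolding A_def by (auto simp: incseq_def)
    have un: "(\<Union>n. A n) = {0..2*R}"
    proof
      show "{0..2*R} \<subseteq> (\<Union>n. A n)"
      proof
        fix v assume v: "v \<in> {0..2*R}"
        have "((\<lambda>m. h (y m + v) - h (y m)) \<longlongrightarrow> 0) sequentially"
          using filterlim_compose[OF lim y] .
        then have "\<forall>\<^sub>F m in sequentially. \<bar>h (y m + v) - h (y m)\<bar> < e / 2"
          using e by (auto dest!: tendstoD[of _ _ _ "e / 2"] simp: dist_real_def)
        then show "v \<in> (\<Union>n. A n)" using v by (auto simp: A_def eventually_sequentially)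
      qed
    qed (auto simp: A_def)
    have "(\<lambda>n. emeasure lborel (A n)) \<longlonglongrightarrow> emeasure lborel (\<Union>n. A n)"
      using meas inc by (intro Lim_emeasure_incseq) auto
    then have "(\<lambda>n. emeasure lborel (A n)) \<longlonglongrightarrow> ennreal (2 * R)"
      using R by (simp add: un)
    moreover have "ennreal (3/2 * R) < ennreal (2 * R)" using R by (simp add: ennreal_less_iff)
    ultimately show ?thesis unfolding A_def by (rule order_tendstoD(1))
  qed
  have xu: "filterlim (\<lambda>n. x n + u n) at_top sequentially"
    by (rule filterlim_at_top_mono[OF x]) (use u in auto)
  from eventually_conj[OF fill[OF x] fill[OF xu]] obtain n where
    n: "emeasure lborel {v \<in> {0..2*R}. \<forall>m\<ge>n. \<bar>h (x m + v) - h (x m)\<bar> < e / 2} > ennreal (3/2 * R)"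
       "emeasure lborel {v \<in> {0..2*R}. \<forall>m\<ge>n. \<bar>h (x m + u m + v) - h (x m + u m)\<bar> < e / 2} > ennreal (3/2 * R)"
    by (auto simp: eventually_sequentially)
  define V where "V = {v \<in> {0..2*R}. \<forall>m\<ge>n. \<bar>h (x m + v) - h (x m)\<bar> < e / 2}"
  define W where "W = {v \<in> {0..2*R}. \<forall>m\<ge>n. \<bar>h (x m + u m + v) - h (x m + u m)\<bar> < e / 2}"
  define W' where "W' = (\<lambda>w. - u n + w) -` W"
  have mV: "V \<in> sets lborel" unfolding V_def by measurable
  have mW: "W \<in> sets lborel" unfolding W_def by measurable
  have mW': "W' \<in> sets lborel"
  proof -
    have "W' = (\<lambda>w. - u n + w) -` W \<inter> space borel" by (simp add: W'_def)
    also have "\<dots> \<in> sets borel" by (rule measurable_sets[of _ borel borel]) (use mW in auto)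
    finally show ?thesis by simp
  qed
  have eW': "emeasure lborel W' = emeasure lborel W"
  proof -
    have "emeasure lborel W = emeasure (distr lborel borel ((+) (- u n))) W"
      by (simp add: lborel_distr_plus)
    also have "\<dots> = emeasure lborel ((+) (- u n) -` W)"
      using mW by (subst emeasure_distr) auto
    finally show ?thesis by (simp only: W'_def)
  qed
  have "V \<inter> W' \<noteq> {}"
  proof
    assume "V \<inter> W' = {}"
    then have "emeasure lborel V + emeasure lborel W' = emeasure lborel (V \<union> W')"
      using mV mW' by (intro plus_emeasure) auto
    also have "\<dots> \<le> emeasure lborel {0..3*R}"
      using u[of n] R by (intro emeasure_mono) (auto simp: V_def W'_def W_def)
    also have "\<dots> = ennreal (3 * R)" using R by simp
    also have "\<dots> = ennreal (3/2 * R) + ennreal (3/2 * R)"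
      using R by (simp add: ennreal_plus[symmetric] del: ennreal_plus)
    also have "\<dots> < emeasure lborel V + emeasure lborel W'"
      unfolding eW' using n unfolding V_def[symmetric] W_def[symmetric] by (intro add_strict_mono) auto
    finally show False by simp
  qed
  then obtain v where v: "v \<in> V" "v - u n \<in> W" by (auto simp: W'_def)
  have "\<bar>h (x n + v) - h (x n)\<bar> < e / 2" "\<bar>h (x n + v) - h (x n + u n)\<bar> < e / 2"
    using v by (auto simp: V_def W_def)
  then show ?thesis by (intro exI[of _ n]) linarith
qed

text \<open>Logarithms turn the claim into the additive statement. That statement provides a single
  good index only, which is enough because a failure here produces sequences that are bad at every
  index.\<close>

lemma slowly_varying_uniform:
  assumes L: "slowly_varying L" and m: "1 < m" and e: "0 < e"
  shows "\<exists>x0. \<forall>x\<ge>x0. \<forall>y. x \<le> y \<and> y \<le> m * x \<longrightarrow> 0 < L x \<and> \<bar>L y / L x - 1\<bar> \<le> e"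
proof -
  obtain A where A: "L \<in> borel_measurable (restrict_space borel {A..})" "\<And>x. x \<ge> A \<Longrightarrow> L x > 0"
    and lim: "\<And>c. c > 0 \<Longrightarrow> ((\<lambda>x. L (c * x) / L x) \<longlongrightarrow> 1) at_top"
    using L by (auto simp: slowly_varying_def)
  \<comment> \<open>\<open>L\<close> is measurable and positive only on \<open>{A..}\<close>; the
    \<open>max\<close> makes \<open>h\<close> a Borel function on the whole line without changing it
    near infinity.\<close>
  define h where "h = (\<lambda>t. ln (L (max A (exp t))))"
  have h: "h \<in> borel_measurable borel"
  proof -
    have "(\<lambda>t. max A (exp t)) \<in> measurable borel (restrict_space borel {A..})"
      by (intro measurable_restrict_space2) auto
    from measurable_compose[OF this A(1)] show ?thesis unfolding h_def by measurable
  qed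
  have hlim: "((\<lambda>t. h (t + v) - h t) \<longlongrightarrow> 0) at_top" for v
  proof -
    have "((\<lambda>t. L (exp v * exp t) / L (exp t)) \<longlongrightarrow> 1) at_top"
      using filterlim_compose[OF lim[of "exp v"] exp_at_top] by simp
    then have "((\<lambda>t. ln (L (exp v * exp t) / L (exp t))) \<longlongrightarrow> ln 1) at_top"
      by (intro tendsto_ln) auto
    moreover have "\<forall>\<^sub>F t in at_top. ln (L (exp v * exp t) / L (exp t)) = h (t + v) - h t"
    proof -
      have "\<forall>\<^sub>F t in at_top. A \<le> exp t" using exp_at_top by (auto simp: filterlim_at_top)
      moreover have "\<forall>\<^sub>F t in at_top. A / exp v \<le> exp t" using exp_at_top by (auto simp: filterlim_at_top)
      ultimately show ?thesis
      proof eventually_elim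
        case (elim t)
        have "A \<le> exp v * exp t" using elim(2) by (simp add: field_simps)
        then show ?case using A(2)[of "exp t"] A(2)[of "exp v * exp t"] elim(1)
          by (simp add: h_def exp_add ln_div max_def mult.commute)
      qed
    qed
    ultimately show ?thesis by (auto intro: Lim_transform_eventually)
  qed
  define e' where "e' = min (ln (1 + e)) (- ln (1 - min e (1/2)))"
  have e': "0 < e'" using e by (auto simp: e'_def ln_less_zero)
  have close: "\<bar>r - 1\<bar> \<le> e" if "0 < r" "\<bar>ln r\<bar> < e'" for r
  proof -
    have "ln r < ln (1 + e)" "ln (1 - min e (1/2)) < ln r" using that(2) by (auto simp: e'_def)
    then have "r < 1 + e" "1 - min e (1/2) < r" using that(1) e by auto
    then show ?thesis by (auto simp: min_def split: if_splits)
  qed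
  show ?thesis
  proof (rule ccontr)
    assume contr: "\<not> ?thesis"
    have "\<exists>x y. x \<ge> max (max A 1) (real n) \<and> x \<le> y \<and> y \<le> m * x \<and> \<not> (0 < L x \<and> \<bar>L y / L x - 1\<bar> \<le> e)" for n :: nat
      using contr by (meson not_le)
    then obtain X Y where XY: "\<And>n. X n \<ge> max (max A 1) (real n)" "\<And>n. X n \<le> Y n" "\<And>n. Y n \<le> m * X n"
       "\<And>n. \<not> (0 < L (X n) \<and> \<bar>L (Y n) / L (X n) - 1\<bar> \<le> e)"
      by metis
    have X: "X n \<ge> 1" "X n \<ge> A" "X n \<ge> real n" "Y n \<ge> 1" "Y n \<ge> A" for n
      using XY(1)[of n] XY(2)[of n] by auto
    have "\<exists>n. \<bar>h (ln (X n) + (ln (Y n) - ln (X n))) - h (ln (X n))\<bar> < e'"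
    proof (rule uniform_convergence_additive[OF h hlim, of "ln m"])
      show "0 < ln m" using m by simp
      show "0 \<le> ln (Y n) - ln (X n) \<and> ln (Y n) - ln (X n) \<le> ln m" for n
      proof -
        have "ln (Y n) \<le> ln (m * X n)" using XY(3)[of n] X(4)[of n] by simp
        moreover have "ln (m * X n) = ln m + ln (X n)" using m X(1)[of n] by (simp add: ln_mult)
        moreover have "ln (X n) \<le> ln (Y n)" using XY(2)[of n] X(1)[of n] by simp
        ultimately show ?thesis by linarith
      qed
      have "filterlim X at_top sequentially"
        using X(3) by (intro filterlim_at_top_mono[OF filterlim_real_sequentially]) auto
      from filterlim_compose[OF ln_at_top this]
      show "filterlim (\<lambda>n. ln (X n)) at_top sequentially" .
    qed (use e' in auto)
    then obtain n where n: "\<bar>h (ln (Y n)) - h (ln (X n))\<bar> < e'" by auto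
    have pos: "0 < L (X n)" "0 < L (Y n)" using A(2) X by auto
    have "h (ln (Y n)) - h (ln (X n)) = ln (L (Y n) / L (X n))"
      using X(1,2,4,5)[of n] pos by (simp add: h_def max_def ln_div)
    then have "\<bar>L (Y n) / L (X n) - 1\<bar> \<le> e" using n pos by (intro close) auto
    then show False using XY(4)[of n] pos by auto
  qed
qed

text \<open>This is the form in which slow variation enters everything that follows: a statement
  about the mass function alone, with \<open>L\<close> eliminated.\<close>

lemma square_mult_uniformly_slowly_varying:
  fixes p :: "nat \<Rightarrow> real"
  assumes L: "slowly_varying L" and p: "p \<sim>[sequentially] (\<lambda>x. L (real x) / (real x)\<^sup>2)"
    and e: "0 < e" and m: "1 < m"
  shows "\<exists>x0. \<forall>x\<ge>x0. 0 < (real x)\<^sup>2 * p x \<and> (\<forall>y. x \<le> y \<and> real y \<le> m * real x \<longrightarrow>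
     \<bar>(real y)\<^sup>2 * p y - (real x)\<^sup>2 * p x\<bar> \<le> e * ((real x)\<^sup>2 * p x))"
proof -
  define r where "r = (\<lambda>x. (real x)\<^sup>2 * p x)"
  \<comment> \<open>Passing from \<open>r y\<close> to \<open>L y\<close> to \<open>L x\<close> to
    \<open>r x\<close> costs at most \<open>4 * d * L x\<close> in all, while \<open>r x\<close> is
    at least \<open>9/10 * L x\<close>.\<close>
  define d where "d = min (e / 10) (1/10)"
  have d: "0 < d" "d \<le> 1/10" "d \<le> e / 10" using e by (auto simp: d_def)
  obtain x1 where x1: "\<And>x y. x \<ge> x1 \<Longrightarrow> x \<le> y \<Longrightarrow> y \<le> m * x \<Longrightarrow> 0 < L x \<and> \<bar>L y / L x - 1\<bar> \<le> d"
    using slowly_varying_uniform[OF L m d(1)] by blast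
  have "((\<lambda>x. p x / (L (real x) / (real x)\<^sup>2)) \<longlongrightarrow> 1) sequentially"
  proof (rule asymp_equivD_strong[OF p])
    show "\<forall>\<^sub>F x in sequentially. p x \<noteq> 0 \<or> L (real x) / (real x)\<^sup>2 \<noteq> 0"
    proof -
      have "\<forall>\<^sub>F x::nat in sequentially. max x1 1 \<le> real x"
        using filterlim_real_sequentially unfolding filterlim_at_top by blast
      then show ?thesis
      proof eventually_elim
        case (elim x)
        have "real x \<le> m * real x" using m elim by simp
        then show ?case using elim x1[of "real x" "real x"] by auto
      qed
    qed
  qed
  then have "\<forall>\<^sub>F x in sequentially. \<bar>p x / (L (real x) / (real x)\<^sup>2) - 1\<bar> < d"
    using d(1) by (auto dest!: tendstoD simp: dist_real_def)
  then obtain x2 where x2: "\<And>x. x \<ge> x2 \<Longrightarrow> \<bar>p x / (L (real x) / (real x)\<^sup>2) - 1\<bar> < d"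
    by (auto simp: eventually_sequentially)
  define x0 where "x0 = max (max x2 1) (nat \<lceil>x1\<rceil>)"
  have rL: "0 < L (real x)" "\<bar>r x - L (real x)\<bar> \<le> d * L (real x)" if "x \<ge> x0" for x
  proof -
    have x: "x \<ge> x2" "x \<ge> 1" "real x \<ge> x1" using that by (auto simp: x0_def)
    have "real x \<le> m * real x" using m by (simp add: mult_le_cancel_right1)
    then show pos: "0 < L (real x)" using x1[of "real x" "real x"] x by auto
    have eq: "p x / (L (real x) / (real x)\<^sup>2) = r x / L (real x)" using x by (simp add: r_def field_simps)
    have "\<bar>r x / L (real x) - 1\<bar> \<le> d" using x2[OF x(1)] unfolding eq by linarith
    then have "\<bar>(r x - L (real x)) / L (real x)\<bar> \<le> d" using pos by (simp add: diff_divide_distrib)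
    then show "\<bar>r x - L (real x)\<bar> \<le> d * L (real x)" using pos by (simp add: abs_divide field_simps)
  qed
  have "0 < r x \<and> (\<forall>y. x \<le> y \<and> real y \<le> m * real x \<longrightarrow> \<bar>r y - r x\<bar> \<le> e * r x)" if x: "x \<ge> x0" for x
  proof
    have Lx: "0 < L (real x)" "\<bar>r x - L (real x)\<bar> \<le> d * L (real x)" using rL[OF x] by auto
    have dL: "d * L (real x) \<le> 1/10 * L (real x)" using d(2) Lx(1) by (intro mult_right_mono) auto
    then have rx: "r x \<ge> 9/10 * L (real x)" using Lx(2) by linarith
    then show "0 < r x" using Lx(1) by linarith
    show "\<forall>y. x \<le> y \<and> real y \<le> m * real x \<longrightarrow> \<bar>r y - r x\<bar> \<le> e * r x"
    proof (intro allI impI)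
      fix y assume y: "x \<le> y \<and> real y \<le> m * real x"
      have "real x \<ge> x1" using x by (auto simp: x0_def)
      then have "\<bar>L (real y) / L (real x) - 1\<bar> \<le> d" using x1[of "real x" "real y"] y by auto
      then have "\<bar>(L (real y) - L (real x)) / L (real x)\<bar> \<le> d" using Lx(1) by (simp add: diff_divide_distrib)
      then have Ly: "\<bar>L (real y) - L (real x)\<bar> \<le> d * L (real x)" using Lx(1) by (simp add: abs_divide field_simps)
      then have Ly2: "L (real y) \<le> 2 * L (real x)" using dL Lx(1) by linarith
      have "\<bar>r y - L (real y)\<bar> \<le> d * L (real y)" using rL(2)[of y] x y by auto
      also have "\<dots> \<le> d * (2 * L (real x))" using Ly2 d(1) by (intro mult_left_mono) auto
      finally have "\<bar>r y - r x\<bar> \<le> 4 * (d * L (real x))" using Ly Lx(2) by linarith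
      also have "\<dots> \<le> 4 * (e / 10 * L (real x))" using d(3) Lx(1) by (intro mult_left_mono mult_right_mono) auto
      also have "\<dots> \<le> e * (9/10 * L (real x))" using Lx(1) e by simp
      also have "\<dots> \<le> e * r x" using rx e by (intro mult_left_mono) auto
      finally show "\<bar>r y - r x\<bar> \<le> e * r x" .
    qed
  qed
  then show ?thesis unfolding r_def by blast
qed

section \<open>Independent steps as random lists\<close>

lemma map_pmf_rotate_replicate_pmf:
  "map_pmf (rotate r) (replicate_pmf n q) = replicate_pmf n q"
proof (induction r)
  case (Suc r)
  have r1: "map_pmf rotate1 (replicate_pmf n q) = replicate_pmf n q"
  proof (cases n)
    case (Suc m)
    have "map_pmf rotate1 (replicate_pmf (Suc m) q)
        = bind_pmf q (\<lambda>x. bind_pmf (replicate_pmf m q) (\<lambda>xs. return_pmf (xs @ [x])))"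
      by (simp add: map_bind_pmf)
    also have "\<dots> = bind_pmf (replicate_pmf m q) (\<lambda>xs. bind_pmf q (\<lambda>x. return_pmf (xs @ [x])))"
      by (rule bind_commute_pmf)
    also have "\<dots> = replicate_pmf (m + 1) q"
      unfolding replicate_pmf_distrib by (simp add: bind_return_pmf bind_assoc_pmf)
    finally show ?thesis using Suc by simp
  qed simp
  have "map_pmf (rotate (Suc r)) (replicate_pmf n q)
      = map_pmf rotate1 (map_pmf (rotate r) (replicate_pmf n q))"
    by (simp add: pmf.map_comp o_def rotate_def)
  also have "\<dots> = replicate_pmf n q" by (simp only: Suc r1)
  finally show ?case .
qed (simp add: rotate_def)

lemma prob_rotate_replicate_pmf:
  "measure_pmf.prob (replicate_pmf n q) (rotate r -` A) = measure_pmf.prob (replicate_pmf n q) A"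
  using measure_map_pmf[of "rotate r" "replicate_pmf n q" A] by (simp add: map_pmf_rotate_replicate_pmf)

text \<open>Double counting: the \<open>n\<close> rotated copies of \<open>A\<close> are disjoint
  and equally likely, their union lies in the union of the rotated copies of \<open>F\<close>, and
  the factor \<open>n\<close> cancels. It serves both ways, with the excursions as the source and as
  the target.\<close>

lemma prob_le_if_rotates_into:
  assumes len: "\<And>xs. xs \<in> A \<Longrightarrow> length xs = n"
    and uniq: "\<And>xs r. xs \<in> A \<Longrightarrow> 0 < r \<Longrightarrow> r < n \<Longrightarrow> rotate r xs \<notin> A"
    and into: "\<And>xs. xs \<in> A \<Longrightarrow> \<exists>r. rotate r xs \<in> F"
  shows "measure_pmf.prob (replicate_pmf n q) A \<le> measure_pmf.prob (replicate_pmf n q) F"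
proof (cases "n = 0")
  case True
  have "A \<subseteq> F"
  proof
    fix xs assume "xs \<in> A"
    with len[of xs] into[of xs] True show "xs \<in> F" by auto
  qed
  then show ?thesis by (simp add: measure_pmf.finite_measure_mono)
next
  case False
  let ?P = "measure_pmf.prob (replicate_pmf n q)"
  \<comment> \<open>If two rotations of one list were in \<open>A\<close>, they would be rotations
    of each other by an amount strictly between 0 and \<open>n\<close>.\<close>
  have disj: "disjoint_family_on (\<lambda>r. rotate r -` A) {..<n}"
  proof -
    have "False" if "r < r'" "r' < n" "rotate r xs \<in> A" "rotate r' xs \<in> A" for r r' xs
    proof -
      have "rotate (r' - r) (rotate r xs) = rotate r' xs"
        using that by (simp add: rotate_rotate)
      then show False using uniq[OF that(3), of "r' - r"] that by (simp add: less_imp_diff_less)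
    qed
    then show ?thesis
      unfolding disjoint_family_on_def by (auto, metis linorder_neqE_nat)
  qed
  have "real n * ?P A = (\<Sum>r<n. ?P (rotate r -` A))"
    by (simp add: prob_rotate_replicate_pmf)
  also have "\<dots> = ?P (\<Union>r<n. rotate r -` A)"
    using disj by (intro measure_pmf.finite_measure_finite_Union[symmetric]) auto
  also have "\<dots> \<le> ?P (\<Union>r<n. rotate r -` F)"
  proof (rule measure_pmf.finite_measure_mono)
    show "(\<Union>r<n. rotate r -` A) \<subseteq> (\<Union>r<n. rotate r -` F)"
    proof
      fix xs assume "xs \<in> (\<Union>r<n. rotate r -` A)"
      then obtain r where r: "rotate r xs \<in> A" by auto
      from into[OF r] obtain s where "rotate (s + r) xs \<in> F" by (auto simp: rotate_rotate)
      moreover have "length xs = n" using len[OF r] by simp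
      ultimately have "rotate ((s + r) mod n) xs \<in> F"
        using rotate_conv_mod[of "s + r" xs] by simp
      then show "xs \<in> (\<Union>r<n. rotate r -` F)" using False by (auto intro!: bexI[of _ "(s + r) mod n"])
    qed
  qed auto
  also have "\<dots> \<le> (\<Sum>r<n. ?P (rotate r -` F))"
    by (intro measure_pmf.finite_measure_subadditive_finite) auto
  also have "\<dots> = real n * ?P F" by (simp add: prob_rotate_replicate_pmf)
  finally show ?thesis using False by simp
qed

section \<open>Bridges: the total sum prescribes the first step\<close>

lemma replicate_pmf_Suc_tl_first:
  "replicate_pmf (Suc m) q = bind_pmf (replicate_pmf m q) (\<lambda>ys. map_pmf (\<lambda>x. x # ys) q)"
  by (simp add: map_pmf_def bind_commute_pmf[of q])

text \<open>Given the tail, the sum leaves a single value for the head, so the bridge condition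
  costs one value of \<open>pmf q\<close>. The two bounds below take that value out of the
  integral.\<close>

lemma emeasure_hd_tl_sum:
  fixes q :: "int pmf"
  shows "emeasure (replicate_pmf (Suc m) q) {xs. hd xs \<in> Y \<and> tl xs \<in> G \<and> sum_list xs = s}
    = (\<integral>\<^sup>+ys. ennreal (pmf q (s - sum_list ys)) * indicator {ys \<in> G. s - sum_list ys \<in> Y} ys
         \<partial>replicate_pmf m q)"
proof -
  have "emeasure (map_pmf (\<lambda>x. x # ys) q) {xs. hd xs \<in> Y \<and> tl xs \<in> G \<and> sum_list xs = s}
      = ennreal (pmf q (s - sum_list ys)) * indicator {ys \<in> G. s - sum_list ys \<in> Y} ys" for ys
  proof -
    have "(\<lambda>x. x # ys) -` {xs. hd xs \<in> Y \<and> tl xs \<in> G \<and> sum_list xs = s}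
        = (if ys \<in> G \<and> s - sum_list ys \<in> Y then {s - sum_list ys} else {})"
      by auto
    then show ?thesis by (simp add: emeasure_pmf_single)
  qed
  then show ?thesis unfolding replicate_pmf_Suc_tl_first by (simp only: emeasure_bind_pmf)
qed

lemma prob_hd_tl_sum_le:
  fixes q :: "int pmf"
  assumes c: "0 \<le> c" "\<And>y. y \<in> Y \<Longrightarrow> pmf q y \<le> c"
  shows "measure_pmf.prob (replicate_pmf (Suc m) q) {xs. hd xs \<in> Y \<and> tl xs \<in> G \<and> sum_list xs = s}
    \<le> c * measure_pmf.prob (replicate_pmf m q) {ys \<in> G. s - sum_list ys \<in> Y}"
proof -
  have "emeasure (replicate_pmf (Suc m) q) {xs. hd xs \<in> Y \<and> tl xs \<in> G \<and> sum_list xs = s}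
    \<le> (\<integral>\<^sup>+ys. ennreal c * indicator {ys \<in> G. s - sum_list ys \<in> Y} ys \<partial>replicate_pmf m q)"
    unfolding emeasure_hd_tl_sum using c
    by (intro nn_integral_mono) (auto simp: indicator_def)
  also have "\<dots> = ennreal c * emeasure (replicate_pmf m q) {ys \<in> G. s - sum_list ys \<in> Y}"
    by (subst nn_integral_cmult_indicator) auto
  finally show ?thesis
    using c(1) by (simp add: measure_pmf.emeasure_eq_measure ennreal_mult'[symmetric])
qed

lemma prob_hd_tl_sum_ge:
  fixes q :: "int pmf"
  assumes c: "0 \<le> c" "\<And>y. y \<in> Y \<Longrightarrow> c \<le> pmf q y"
  shows "c * measure_pmf.prob (replicate_pmf m q) {ys \<in> G. s - sum_list ys \<in> Y}
    \<le> measure_pmf.prob (replicate_pmf (Suc m) q) {xs. hd xs \<in> Y \<and> tl xs \<in> G \<and> sum_list xs = s}"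
proof -
  have "ennreal c * emeasure (replicate_pmf m q) {ys \<in> G. s - sum_list ys \<in> Y} =
     (\<integral>\<^sup>+ys. ennreal c * indicator {ys \<in> G. s - sum_list ys \<in> Y} ys \<partial>replicate_pmf m q)"
    by (subst nn_integral_cmult_indicator) auto
  also have "\<dots> \<le> emeasure (replicate_pmf (Suc m) q) {xs. hd xs \<in> Y \<and> tl xs \<in> G \<and> sum_list xs = s}"
    unfolding emeasure_hd_tl_sum using c
    by (intro nn_integral_mono) (auto simp: indicator_def)
  finally show ?thesis
    using c(1) by (simp add: measure_pmf.emeasure_eq_measure ennreal_mult'[symmetric])
qed

section \<open>Exponential and maximal inequalities for lists of steps\<close>

lemma nn_integral_prod_list_replicate_pmf:
  "(\<integral>\<^sup>+xs. prod_list (map f xs) \<partial>replicate_pmf n q) = (\<integral>\<^sup>+x. f x \<partial>measure_pmf q) ^ n"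
  for f :: "'a \<Rightarrow> ennreal"
  by (induction n) (simp_all add: nn_integral_cmult nn_integral_multc)

text \<open>Markov's inequality for the exponential of the sum. The restriction to \<open>S\<close>
  is multiplicative over the list and so goes into the one-step moment, which keeps that moment
  finite for heavy tails.\<close>

lemma prob_sum_list_ge_le:
  fixes q :: "int pmf" and s c r :: real
  assumes "0 \<le> s" "0 \<le> r"
    and r: "(\<integral>\<^sup>+x. ennreal (exp (s * real_of_int x)) * indicator S x \<partial>measure_pmf q) \<le> ennreal r"
  shows "measure_pmf.prob (replicate_pmf n q) {xs. set xs \<subseteq> S \<and> c \<le> real_of_int (sum_list xs)}
    \<le> exp (- s * c) * r ^ n"
proof -
  define f where "f = (\<lambda>x::int. ennreal (exp (s * real_of_int x)) * indicator S x)"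
  have prod: "prod_list (map f xs) = ennreal (exp (s * real_of_int (sum_list xs)))" if "set xs \<subseteq> S" for xs
    using that by (induction xs) (auto simp: f_def ennreal_mult' exp_add ring_distribs)
  have "emeasure (replicate_pmf n q) {xs. set xs \<subseteq> S \<and> c \<le> real_of_int (sum_list xs)}
      = (\<integral>\<^sup>+xs. indicator {xs. set xs \<subseteq> S \<and> c \<le> real_of_int (sum_list xs)} xs \<partial>replicate_pmf n q)"
    by simp
  also have "\<dots> \<le> (\<integral>\<^sup>+xs. ennreal (exp (- s * c)) * prod_list (map f xs) \<partial>replicate_pmf n q)"
  proof (rule nn_integral_mono)
    fix xs :: "int list"
    show "indicator {xs. set xs \<subseteq> S \<and> c \<le> real_of_int (sum_list xs)} xs
        \<le> ennreal (exp (- s * c)) * prod_list (map f xs)"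
    proof (cases "set xs \<subseteq> S \<and> c \<le> real_of_int (sum_list xs)")
      case True
      have "0 \<le> s * (real_of_int (sum_list xs) - c)" using True assms(1) by simp
      then have "1 \<le> exp (- s * c) * exp (s * real_of_int (sum_list xs))"
        unfolding exp_add[symmetric] by (simp add: algebra_simps)
      then show ?thesis using True
        by (simp add: prod ennreal_mult'[symmetric] del: ennreal_1 add: ennreal_1[symmetric])
    qed simp
  qed
  also have "\<dots> = ennreal (exp (- s * c)) * (\<integral>\<^sup>+x. f x \<partial>measure_pmf q) ^ n"
    by (simp add: nn_integral_cmult nn_integral_prod_list_replicate_pmf)
  also have "\<dots> \<le> ennreal (exp (- s * c)) * ennreal r ^ n"
    using r by (intro mult_left_mono power_mono) (auto simp: f_def)
  also have "\<dots> = ennreal (exp (- s * c) * r ^ n)"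
    using assms(2) by (simp add: ennreal_power ennreal_mult'[symmetric])
  finally show ?thesis
    using assms(2) by (simp add: measure_pmf.emeasure_eq_measure)
qed

lemma prob_all_le:
  fixes q :: "int pmf"
  shows "measure_pmf.prob (replicate_pmf n q) {xs. set xs \<subseteq> S} \<le> measure_pmf.prob q S ^ n"
proof -
  have "emeasure (replicate_pmf n q) {xs. set xs \<subseteq> S} = emeasure q S ^ n"
  proof -
    have "emeasure (replicate_pmf n q) {xs. set xs \<subseteq> S}
        = (\<integral>\<^sup>+xs. indicator {xs. set xs \<subseteq> S} xs \<partial>replicate_pmf n q)" by simp
    also have "\<dots> = (\<integral>\<^sup>+xs. prod_list (map (indicator S) xs) \<partial>replicate_pmf n q)"
    proof -
      have "prod_list (map (indicator S) xs) = (indicator {xs. set xs \<subseteq> S} xs :: ennreal)" for xs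
        by (induction xs) (simp_all add: indicator_def of_bool_conj)
      then show ?thesis by simp
    qed
    also have "\<dots> = emeasure q S ^ n" by (simp add: nn_integral_prod_list_replicate_pmf)
    finally show ?thesis .
  qed
  then show ?thesis
    by (simp add: measure_pmf.emeasure_eq_measure ennreal_power)
qed

lemma prob_not_all_le:
  "measure_pmf.prob (replicate_pmf n q) {xs. \<not> set xs \<subseteq> S} \<le> real n * measure_pmf.prob q (- S)"
proof (induction n)
  case (Suc n)
  let ?R = "replicate_pmf n q"
  have "replicate_pmf (Suc n) q = map_pmf (\<lambda>(x, xs). x # xs) (pair_pmf q ?R)"
    by (simp add: pair_pmf_def map_bind_pmf)
  then have "measure_pmf.prob (replicate_pmf (Suc n) q) {xs. \<not> set xs \<subseteq> S}
     = measure_pmf.prob (pair_pmf q ?R) ((\<lambda>(x, xs). x # xs) -` {xs. \<not> set xs \<subseteq> S})"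
    by simp
  also have "(\<lambda>(x, xs). x # xs) -` {xs. \<not> set xs \<subseteq> S} = fst -` (-S) \<union> snd -` {xs. \<not> set xs \<subseteq> S}"
    by auto
  also have "measure_pmf.prob (pair_pmf q ?R) (fst -` (-S) \<union> snd -` {xs. \<not> set xs \<subseteq> S})
     \<le> measure_pmf.prob (pair_pmf q ?R) (fst -` (-S)) + measure_pmf.prob (pair_pmf q ?R) (snd -` {xs. \<not> set xs \<subseteq> S})"
    by (intro measure_Un_le) auto
  also have "\<dots> = measure_pmf.prob (map_pmf fst (pair_pmf q ?R)) (-S)
       + measure_pmf.prob (map_pmf snd (pair_pmf q ?R)) {xs. \<not> set xs \<subseteq> S}"
    by simp
  also have "\<dots> \<le> measure_pmf.prob q (-S) + real n * measure_pmf.prob q (-S)"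
    using Suc by (simp add: map_fst_pair_pmf map_snd_pair_pmf)
  finally show ?case by (simp add: algebra_simps)
qed simp

text \<open>The starting value \<open>s\<close> carries the induction on \<open>n\<close>: if
  \<open>s\<close> is already out of range, the bound is at least 1; otherwise the first step moves
  the start to \<open>s + g x\<close>, and the mean of \<open>(s + g x)^2\<close> is
  \<open>s^2\<close> plus the variance because \<open>g\<close> is centred.\<close>

lemma kolmogorov_maximal:
  fixes q :: "'a pmf" and g :: "'a \<Rightarrow> real"
  assumes l: "0 < l" and int: "integrable (measure_pmf q) g" "integrable (measure_pmf q) (\<lambda>x. (g x)\<^sup>2)"
    and mean: "measure_pmf.expectation q g = 0"
  shows "measure_pmf.prob (replicate_pmf n q)
      {xs. \<exists>k\<le>length xs. l \<le> \<bar>s + sum_list (map g (take k xs))\<bar>}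
     \<le> (s\<^sup>2 + real n * measure_pmf.expectation q (\<lambda>x. (g x)\<^sup>2)) / l\<^sup>2"
proof -
  define v where "v = measure_pmf.expectation q (\<lambda>x. (g x)\<^sup>2)"
  have v: "0 \<le> v" by (simp add: v_def)
  define E where "E = (\<lambda>s. {xs. \<exists>k\<le>length xs. l \<le> \<bar>s + sum_list (map g (take k xs))\<bar>})"
  have "emeasure (replicate_pmf n q) (E s) \<le> ennreal ((s\<^sup>2 + real n * v) / l\<^sup>2)"
  proof (induction n arbitrary: s)
    case 0
    show ?case
    proof (cases "l \<le> \<bar>s\<bar>")
      case True
      then have "l\<^sup>2 \<le> s\<^sup>2" using l by (simp add: abs_le_square_iff[symmetric])
      then have "1 \<le> s\<^sup>2 / l\<^sup>2" using l by (simp add: field_simps)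
      then show ?thesis
        by (simp add: emeasure_return_pmf indicator_def del: ennreal_1 add: ennreal_1[symmetric])
    qed (simp add: E_def indicator_def)
  next
    case (Suc n)
    show ?case
    proof (cases "l \<le> \<bar>s\<bar>")
      case True
      then have "l\<^sup>2 \<le> s\<^sup>2" using l by (simp add: abs_le_square_iff[symmetric])
      moreover have "0 \<le> real (Suc n) * v" using v by simp
      ultimately have 1: "1 \<le> (s\<^sup>2 + real (Suc n) * v) / l\<^sup>2" using l by simp
      have "emeasure (replicate_pmf (Suc n) q) (E s) \<le> 1"
        by (rule measure_pmf.emeasure_le_1)
      also have "\<dots> \<le> ennreal ((s\<^sup>2 + real (Suc n) * v) / l\<^sup>2)"
        using 1 by (simp del: ennreal_1 add: ennreal_1[symmetric])
      finally show ?thesis .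
    next
      case False
      have vim: "Cons x -` E s \<subseteq> E (s + g x)" for x
      proof
        fix xs assume "xs \<in> Cons x -` E s"
        then obtain k where k: "k \<le> Suc (length xs)" "l \<le> \<bar>s + sum_list (map g (take k (x # xs)))\<bar>"
          by (auto simp: E_def)
        with False obtain j where "k = Suc j" by (cases k) auto
        with k show "xs \<in> E (s + g x)" by (auto simp: E_def add.assoc intro!: exI[of _ j])
      qed
      have "emeasure (replicate_pmf (Suc n) q) (E s)
          = (\<integral>\<^sup>+x. emeasure (map_pmf (Cons x) (replicate_pmf n q)) (E s) \<partial>measure_pmf q)"
        by (simp add: map_pmf_def)
      also have "\<dots> \<le> (\<integral>\<^sup>+x. ennreal (((s + g x)\<^sup>2 + real n * v) / l\<^sup>2) \<partial>measure_pmf q)"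
      proof (rule nn_integral_mono)
        fix x
        have "emeasure (map_pmf (Cons x) (replicate_pmf n q)) (E s) \<le> emeasure (replicate_pmf n q) (E (s + g x))"
          using vim by (simp add: emeasure_mono)
        also have "\<dots> \<le> ennreal (((s + g x)\<^sup>2 + real n * v) / l\<^sup>2)" by (rule Suc)
        finally show "emeasure (map_pmf (Cons x) (replicate_pmf n q)) (E s)
            \<le> ennreal (((s + g x)\<^sup>2 + real n * v) / l\<^sup>2)" .
      qed
      also have "\<dots> = ennreal (\<integral>x. ((s + g x)\<^sup>2 + real n * v) / l\<^sup>2 \<partial>measure_pmf q)"
        proof (rule nn_integral_eq_integral)
        show "integrable (measure_pmf q) (\<lambda>x. ((s + g x)\<^sup>2 + real n * v) / l\<^sup>2)"
          using int by (simp add: power2_sum)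
      qed (use v in simp)
      also have "(\<integral>x. ((s + g x)\<^sup>2 + real n * v) / l\<^sup>2 \<partial>measure_pmf q) = (s\<^sup>2 + real (Suc n) * v) / l\<^sup>2"
        using int mean by (simp add: power2_sum v_def algebra_simps)
      finally show ?thesis .
    qed
  qed
  then show ?thesis using v
    by (simp add: E_def v_def[symmetric] measure_pmf.emeasure_eq_measure)
qed

section \<open>Tail estimates for the step distribution\<close>

text \<open>Here \<open>(real x)\<^sup>2 * pmf q (int x)\<close> replaces \<open>L x\<close>, and \<open>usv\<close> is the uniform convergence theorem.\<close>

locale cauchy_step =
  fixes q :: "int pmf"
  assumes skip_free: "\<And>x. x < -1 \<Longrightarrow> pmf q x = 0"
    and integrable_step: "integrable (measure_pmf q) real_of_int"
    and mean_step: "measure_pmf.expectation q real_of_int = 0"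
    and usv: "\<And>e m::real. 0 < e \<Longrightarrow> 1 < m \<Longrightarrow>
      \<exists>x0. \<forall>x\<ge>x0. 0 < (real x)\<^sup>2 * pmf q (int x) \<and> (\<forall>y. x \<le> y \<and> real y \<le> m * real x \<longrightarrow>
        \<bar>(real y)\<^sup>2 * pmf q (int y) - (real x)\<^sup>2 * pmf q (int x)\<bar> \<le> e * ((real x)\<^sup>2 * pmf q (int x)))"
begin

definition rho :: "nat \<Rightarrow> real" where "rho x = (real x)\<^sup>2 * pmf q (int x)"
definition T :: "nat \<Rightarrow> real" where "T x = measure_pmf.prob q {int x..}"
text \<open>Because the step has mean zero, this is minus the mean of the step cut off below
  \<open>x\<close>, that is, the downward drift left when jumps of size at least \<open>x\<close>
  are removed.\<close>

definition D :: "nat \<Rightarrow> real" where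
  "D x = measure_pmf.expectation q (\<lambda>k. real_of_int k * indicator {int x..} k)"
definition V :: "nat \<Rightarrow> real" where
  "V x = measure_pmf.expectation q (\<lambda>k. (real_of_int k)\<^sup>2 * indicator {..<int x} k)"

lemma rho_nonneg: "0 \<le> rho x" by (simp add: rho_def)
lemma T_nonneg: "0 \<le> T x" by (simp add: T_def)

lemma AE_ge: "AE k in measure_pmf q. -1 \<le> k"
proof (rule AE_pmfI)
  fix k assume "k \<in> set_pmf q"
  then show "-1 \<le> k" using skip_free[of k] by (force simp: set_pmf_iff)
qed

lemma pmf_eq_rho: "1 \<le> x \<Longrightarrow> pmf q (int x) = rho x / (real x)\<^sup>2"
  by (simp add: rho_def)

lemma expectation_atLeastLessThan:
  fixes f :: "int \<Rightarrow> real"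
  shows "measure_pmf.expectation q (\<lambda>k. f k * indicator {int x..<int y} k) = (\<Sum>k=x..<y. f (int k) * pmf q (int k))"
proof -
  have "measure_pmf.expectation q (\<lambda>k. f k * indicator {int x..<int y} k)
     = (\<Sum>k\<in>{int x..<int y}. f k * indicator {int x..<int y} k * pmf q k)"
    by (rule integral_measure_pmf_real) (auto simp: indicator_def)
  also have "\<dots> = (\<Sum>k\<in>int ` {x..<y}. f k * pmf q k)"
    by (intro sum.cong) (auto simp: image_int_atLeastLessThan)
  also have "\<dots> = (\<Sum>k=x..<y. f (int k) * pmf q (int k))"
    by (subst sum.reindex) auto
  finally show ?thesis .
qed

lemma integrable_indicator_step:
  "integrable (measure_pmf q) (\<lambda>k. real_of_int k * indicator S k)"
  using integrable_step by (rule Bochner_Integration.integrable_bound) (auto simp: indicator_def)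

text \<open>Skip-freeness leaves only finitely many charged values below \<open>x\<close>, so any
  function is bounded there.\<close>

lemma integrable_below:
  fixes f :: "int \<Rightarrow> real"
  shows "integrable (measure_pmf q) (\<lambda>k. f k * indicator {..<int x} k)"
proof -
  have fin: "finite (set_pmf q \<inter> {..<int x})"
  proof (rule finite_subset)
    show "set_pmf q \<inter> {..<int x} \<subseteq> {-1..<int x}"
    proof
      fix k assume k: "k \<in> set_pmf q \<inter> {..<int x}"
      then show "k \<in> {-1..<int x}" using skip_free[of k] by (force simp: set_pmf_iff)
    qed
  qed simp
  define C where "C = Max (insert 0 ((\<lambda>k. \<bar>f k\<bar>) ` (set_pmf q \<inter> {..<int x})))"
  show ?thesis
  proof (rule measure_pmf.integrable_const_bound[where B = C])
    show "AE k in measure_pmf q. norm (f k * indicator {..<int x} k) \<le> C"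
      using fin by (intro AE_pmfI) (auto simp: C_def indicator_def intro!: Max_ge)
  qed simp
qed

lemma D_diff: "x \<le> y \<Longrightarrow> D x - D y = (\<Sum>k=x..<y. real k * pmf q (int k))"
proof -
  assume "x \<le> y"
  have "D x - D y = measure_pmf.expectation q
      (\<lambda>k. real_of_int k * indicator {int x..} k - real_of_int k * indicator {int y..} k)"
    unfolding D_def by (intro Bochner_Integration.integral_diff[symmetric] integrable_indicator_step)
  also have "\<dots> = measure_pmf.expectation q (\<lambda>k. real_of_int k * indicator {int x..<int y} k)"
    using \<open>x \<le> y\<close> by (intro Bochner_Integration.integral_cong) (auto simp: indicator_def)
  finally show ?thesis by (simp add: expectation_atLeastLessThan)
qed

lemma D_nonneg: "0 \<le> D x"
  unfolding D_def by (intro integral_nonneg_AE) (auto simp: indicator_def)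

lemma D_antimono: "x \<le> y \<Longrightarrow> D y \<le> D x"
  using D_diff[of x y] by (smt (verit) sum_nonneg mult_nonneg_nonneg of_nat_0_le_iff pmf_nonneg)

lemma T_diff: "x \<le> y \<Longrightarrow> T x - T y = (\<Sum>k=x..<y. pmf q (int k))"
proof -
  assume "x \<le> y"
  have "{int x..} = {int x..<int y} \<union> {int y..}" using \<open>x \<le> y\<close> by auto
  then have "T x = measure_pmf.prob q {int x..<int y} + T y"
    unfolding T_def by (subst measure_pmf.finite_measure_Union[symmetric]) auto
  then show ?thesis
    using expectation_atLeastLessThan[of "\<lambda>_. 1" x y] by simp
qed

lemma T_antimono: "x \<le> y \<Longrightarrow> T y \<le> T x"
  unfolding T_def by (intro measure_pmf.finite_measure_mono) auto

lemma mult_T_le_D: "real x * T x \<le> D x"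
proof -
  have "real x * T x = measure_pmf.expectation q (\<lambda>k. real x * indicator {int x..} k)"
    by (simp add: T_def)
  also have "\<dots> \<le> D x"
    unfolding D_def
  proof (intro integral_mono integrable_indicator_step)
    show "integrable (measure_pmf q) (\<lambda>k. real x * indicator {int x..} k)"
      by (rule measure_pmf.integrable_const_bound[where B = "real x"]) (auto simp: indicator_def)
  qed (auto simp: indicator_def)
  finally show ?thesis .
qed

lemma expectation_below: "measure_pmf.expectation q (\<lambda>k. real_of_int k * indicator {..<int x} k) = - D x"
proof -
  have "measure_pmf.expectation q (\<lambda>k. real_of_int k * indicator {..<int x} k) + D x
     = measure_pmf.expectation q (\<lambda>k. real_of_int k * indicator {..<int x} k + real_of_int k * indicator {int x..} k)"
    unfolding D_def by (intro Bochner_Integration.integral_add[symmetric] integrable_indicator_step)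
  also have "\<dots> = measure_pmf.expectation q real_of_int"
    by (intro Bochner_Integration.integral_cong) (auto simp: indicator_def)
  finally show ?thesis using mean_step by simp
qed

lemma V_add: "x \<le> y \<Longrightarrow> V y = V x + (\<Sum>k=x..<y. rho k)"
proof -
  assume "x \<le> y"
  have "V y = measure_pmf.expectation q (\<lambda>k. (real_of_int k)\<^sup>2 * indicator {..<int x} k
      + (real_of_int k)\<^sup>2 * indicator {int x..<int y} k)"
    unfolding V_def using \<open>x \<le> y\<close> by (intro Bochner_Integration.integral_cong) (auto simp: indicator_def)
  also have "\<dots> = V x + measure_pmf.expectation q (\<lambda>k. (real_of_int k)\<^sup>2 * indicator {int x..<int y} k)"
    unfolding V_def
  proof (intro Bochner_Integration.integral_add integrable_below)
    show "integrable (measure_pmf q) (\<lambda>k. (real_of_int k)\<^sup>2 * indicator {int x..<int y} k)"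
      using integrable_below[of "\<lambda>k. (real_of_int k)\<^sup>2 * indicator {int x..} k" y]
      by (rule Bochner_Integration.integrable_cong[THEN iffD1, rotated -1]) (auto simp: indicator_def)
  qed
  finally show ?thesis by (simp add: expectation_atLeastLessThan rho_def)
qed

lemma V_nonneg: "0 \<le> V x"
  unfolding V_def by (intro integral_nonneg_AE) auto

lemma T_tendsto_0: "T \<longlonglongrightarrow> 0"
proof (rule tendsto_sandwich[of "\<lambda>_. 0" _ _ "\<lambda>x. D 0 / real x"])
  show "\<forall>\<^sub>F x in sequentially. T x \<le> D 0 / real x"
    using eventually_ge_at_top[of 1]
  proof eventually_elim
    case (elim x)
    have "real x * T x \<le> D 0" using mult_T_le_D[of x] D_antimono[of 0 x] by simp
    then show ?case using elim by (simp add: field_simps)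
  qed
  show "(\<lambda>x. D 0 / real x) \<longlonglongrightarrow> 0"
    by (rule lim_const_over_n)
qed (auto simp: T_nonneg)

section \<open>Potter bounds and Karamata type estimates\<close>

text \<open>Potter bounds with exponent 1/2. Double \<open>x\<close> until it is within a factor 2
  of \<open>y\<close>: far out, each doubling changes \<open>rho\<close> by a factor of at most 4/3
  in either direction, and 4/3 is below \<open>sqrt 2\<close>.\<close>

lemma potter:
  "\<forall>\<^sub>F x in sequentially. 1 \<le> x \<and> 0 < rho x \<and> (\<forall>y\<ge>x. rho y \<le> 2 * sqrt (real y / real x) * rho x
      \<and> rho x \<le> 2 * sqrt (real y / real x) * rho y)"
proof -
  obtain x0 where x0: "\<And>x. x \<ge> x0 \<Longrightarrow> 0 < rho x"
     "\<And>x y. x \<ge> x0 \<Longrightarrow> x \<le> y \<Longrightarrow> real y \<le> 2 * real x \<Longrightarrow> \<bar>rho y - rho x\<bar> \<le> 1/4 * rho x"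
    using usv[of "1/4" 2] unfolding rho_def by auto
  have main: "rho y \<le> 2 * sqrt (real y / real x) * rho x \<and> rho x \<le> 2 * sqrt (real y / real x) * rho y"
    if "max x0 1 \<le> x" "x \<le> y" for x y
    using that
  proof (induction "y - x" arbitrary: x rule: less_induct)
    case less
    have x: "x \<ge> x0" "x \<ge> 1" using less.prems by auto
    show ?case
    proof (cases "y \<le> 2 * x")
      case True
      have 1: "\<bar>rho y - rho x\<bar> \<le> 1/4 * rho x" using x0(2)[of x y] x less.prems True by simp
      have "1 \<le> sqrt (real y / real x)" using less.prems x by simp
      then have "rho x \<le> sqrt (real y / real x) * rho x" "rho y \<le> sqrt (real y / real x) * rho y"
        using mult_right_mono[of 1 "sqrt (real y / real x)", OF _ rho_nonneg] by simp_all
      then show ?thesis using 1 rho_nonneg[of x] by (simp only: mult.assoc) linarith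
    next
      case False
      have IH: "rho y \<le> 2 * sqrt (real y / real (2 * x)) * rho (2 * x)"
         "rho (2 * x) \<le> 2 * sqrt (real y / real (2 * x)) * rho y"
        using less.hyps[of "2 * x"] less.prems x False by auto
      have st: "\<bar>rho (2 * x) - rho x\<bar> \<le> 1/4 * rho x" using x0(2)[of x "2 * x"] x by simp
      have s2: "4/3 \<le> sqrt 2" by (rule real_le_rsqrt) (simp add: power2_eq_square)
      then have "5/4 * rho x \<le> sqrt 2 * rho x" "4/3 * rho (2*x) \<le> sqrt 2 * rho (2 * x)"
        by (intro mult_right_mono rho_nonneg; linarith)+
      then have st2: "rho (2 * x) \<le> sqrt 2 * rho x" "rho x \<le> sqrt 2 * rho (2 * x)"
        using st by linarith+
      have sq: "sqrt (real y / real (2 * x)) * sqrt 2 = sqrt (real y / real x)"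
        by (simp add: real_sqrt_mult[symmetric])
      have "rho y \<le> 2 * sqrt (real y / real (2 * x)) * (sqrt 2 * rho x)"
        using IH(1) st2(1) by (rule order_trans[OF _ mult_left_mono]) simp
      moreover have "rho x \<le> sqrt 2 * (2 * sqrt (real y / real (2 * x)) * rho y)"
        using st2(2) IH(2) by (rule order_trans[OF _ mult_left_mono]) simp
      moreover have "2 * sqrt (real y / real (2 * x)) * (sqrt 2 * r) = 2 * sqrt (real y / real x) * r"
        "sqrt 2 * (2 * sqrt (real y / real (2 * x)) * r) = 2 * sqrt (real y / real x) * r" for r
        unfolding sq[symmetric] by algebra+
      ultimately show ?thesis by (simp only:)
    qed
  qed
  show ?thesis
    using eventually_ge_at_top[of "max x0 1"] by eventually_elim (use x0(1) main in auto)
qed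

text \<open>Each summand is compared with an increment of \<open>3 * sqrt k\<close>, of
  \<open>-4 / sqrt k\<close> or of \<open>ln k\<close>, and the increments telescope. The bound of
  \<open>sqrt (k + 1)\<close> by \<open>3/2 * sqrt k\<close> absorbs the index shift.\<close>

lemma sum_sqrt_le:
  assumes "1 \<le> x" "x \<le> y"
  shows "(\<Sum>k=x..<y. 1 / sqrt (real k)) \<le> 3 * sqrt (real y)"
    and "(\<Sum>k=x..<y. sqrt (real k) / (real k)\<^sup>2) \<le> 4 / sqrt (real x)"
    and "ln (real y / real x) \<le> (\<Sum>k=x..<y. 1 / real k)"
proof -
  have s2: "sqrt 2 \<le> 3/2" by (rule real_le_lsqrt) (auto simp: power2_eq_square)
  have sq: "sqrt (real k) \<le> sqrt (real (Suc k))" "sqrt (real (Suc k)) \<le> 3/2 * sqrt (real k)"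
     "sqrt (real k) > 0" if "k \<ge> x" for k
  proof -
    have "sqrt (real (Suc k)) \<le> sqrt (2 * real k)" using that assms by simp
    also have "\<dots> \<le> 3/2 * sqrt (real k)" unfolding real_sqrt_mult by (intro mult_right_mono s2) simp
    finally show "sqrt (real (Suc k)) \<le> 3/2 * sqrt (real k)" .
  qed (use that assms in auto)
  have diff: "(sqrt (real (Suc k)) - sqrt (real k)) * (sqrt (real (Suc k)) + sqrt (real k)) = 1" for k
    by (simp add: algebra_simps)
  have "(\<Sum>k=x..<y. 1 / sqrt (real k)) \<le> (\<Sum>k=x..<y. 3 * sqrt (real (Suc k)) - 3 * sqrt (real k))"
  proof (rule sum_mono)
    fix k assume "k \<in> {x..<y}"
    then have kx: "x \<le> k" by simp
    have k: "sqrt (real (Suc k)) + sqrt (real k) \<le> 3 * sqrt (real k)" "sqrt (real k) > 0"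
      "sqrt (real k) \<le> sqrt (real (Suc k))"
      using sq[OF kx] by linarith+
    have "(sqrt (real (Suc k)) - sqrt (real k)) * (sqrt (real (Suc k)) + sqrt (real k))
        \<le> (sqrt (real (Suc k)) - sqrt (real k)) * (3 * sqrt (real k))"
      by (rule mult_left_mono[OF k(1)]) (use k(3) in simp)
    then have "1 \<le> (sqrt (real (Suc k)) - sqrt (real k)) * (3 * sqrt (real k))"
      by (simp only: diff)
    then show "1 / sqrt (real k) \<le> 3 * sqrt (real (Suc k)) - 3 * sqrt (real k)"
      using k(2) by (simp add: field_simps)
  qed
  also have "\<dots> = 3 * sqrt (real y) - 3 * sqrt (real x)"
    using assms(2) by (rule sum_Suc_diff')
  also have "\<dots> \<le> 3 * sqrt (real y)" by simp
  finally show "(\<Sum>k=x..<y. 1 / sqrt (real k)) \<le> 3 * sqrt (real y)" .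
  have "(\<Sum>k=x..<y. sqrt (real k) / (real k)\<^sup>2) \<le> (\<Sum>k=x..<y. (- 4 / sqrt (real (Suc k))) - (- 4 / sqrt (real k)))"
  proof (rule sum_mono)
    fix k assume "k \<in> {x..<y}"
    then have kx: "x \<le> k" by simp
    have k: "sqrt (real (Suc k)) \<le> 3/2 * sqrt (real k)" "sqrt (real k) > 0"
      "sqrt (real k) \<le> sqrt (real (Suc k))"
      using sq[OF kx] by linarith+
    define u v where "u = sqrt (real k)" and "v = sqrt (real (Suc k))"
    have uv: "0 < u" "u \<le> v" "v \<le> 3/2 * u" "(v - u) * (v + u) = 1"
      using k diff[of k] by (simp_all only: u_def v_def)
    have "v * (v + u) \<le> (3/2 * u) * (5/2 * u)" using uv by (intro mult_mono) auto
    also have "\<dots> \<le> 4 * u * u" using uv by simp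
    finally have vu: "v * (v + u) \<le> 4 * u * u" .
    have "1 / u ^ 3 = (v - u) * (v + u) * v * inverse (u ^ 3 * v)" using uv by (simp add: field_simps)
    also have "\<dots> = (v - u) * (v * (v + u)) * inverse (u ^ 3 * v)" by (simp add: algebra_simps)
    also have "\<dots> \<le> (v - u) * (4 * u * u) * inverse (u ^ 3 * v)"
      using uv vu by (intro mult_right_mono mult_left_mono) auto
    also have "\<dots> = 4 / u - 4 / v" using uv by (simp add: field_simps power3_eq_cube)
    finally have "1 / u ^ 3 \<le> 4 / u - 4 / v" .
    moreover have "sqrt (real k) / (real k)\<^sup>2 = 1 / u ^ 3"
    proof -
      have "real k = u * u" by (simp add: u_def)
      then show ?thesis using uv(1) unfolding u_def[symmetric] by (simp add: power2_eq_square power3_eq_cube)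
    qed
    ultimately show "sqrt (real k) / (real k)\<^sup>2 \<le> (- 4 / sqrt (real (Suc k))) - (- 4 / sqrt (real k))"
      by (simp add: u_def v_def)
  qed
  also have "\<dots> = - 4 / sqrt (real y) - (- 4 / sqrt (real x))"
    using assms(2) by (rule sum_Suc_diff')
  also have "\<dots> \<le> 4 / sqrt (real x)" by simp
  finally show "(\<Sum>k=x..<y. sqrt (real k) / (real k)\<^sup>2) \<le> 4 / sqrt (real x)" .
  have "ln (real y) - ln (real x) = (\<Sum>k=x..<y. ln (real (Suc k)) - ln (real k))"
    using assms(2) by (rule sum_Suc_diff'[symmetric])
  also have "\<dots> \<le> (\<Sum>k=x..<y. 1 / real k)"
  proof (rule sum_mono)
    fix k assume "k \<in> {x..<y}"
    then have k: "0 < real k" using assms by auto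
    have "ln (real (Suc k)) - ln (real k) = ln (1 + 1 / real k)"
    proof -
      have "real (Suc k) = real k * (1 + 1 / real k)" using k by (simp add: field_simps)
      then have "ln (real (Suc k)) = ln (real k) + ln (1 + 1 / real k)"
        using k by (simp only:) (rule ln_mult_pos, auto intro: add_pos_nonneg)
      then show ?thesis by simp
    qed
    also have "\<dots> \<le> 1 / real k" using k by (intro ln_add_one_self_le_self) auto
    finally show "ln (real (Suc k)) - ln (real k) \<le> 1 / real k" .
  qed
  finally show "ln (real y / real x) \<le> (\<Sum>k=x..<y. 1 / real k)"
    using assms by (simp add: ln_div)
qed

text \<open>Potter bounds the mass of \<open>{x..<y}\<close> by a convergent sum; then
  \<open>y\<close> tends to infinity.\<close>

lemma T_le: "\<forall>\<^sub>F x in sequentially. T x \<le> 8 * rho x / real x"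
  using potter
proof eventually_elim
  case (elim x)
  have x: "1 \<le> x" using elim by simp
  have le: "T x - T y \<le> 8 * rho x / real x" if "y \<ge> x" for y
  proof -
    have "T x - T y = (\<Sum>k=x..<y. rho k / (real k)\<^sup>2)"
      using x by (simp add: T_diff[OF that] pmf_eq_rho)
    also have "\<dots> \<le> (\<Sum>k=x..<y. 2 * rho x / sqrt (real x) * (sqrt (real k) / (real k)\<^sup>2))"
    proof (rule sum_mono)
      fix k assume "k \<in> {x..<y}"
      then have "rho k \<le> 2 * sqrt (real k / real x) * rho x" using elim by auto
      then have "rho k / (real k)\<^sup>2 \<le> 2 * sqrt (real k / real x) * rho x / (real k)\<^sup>2"
        by (rule divide_right_mono) simp
      then show "rho k / (real k)\<^sup>2 \<le> 2 * rho x / sqrt (real x) * (sqrt (real k) / (real k)\<^sup>2)"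
        by (simp add: real_sqrt_divide mult_ac)
    qed
    also have "\<dots> = 2 * rho x / sqrt (real x) * (\<Sum>k=x..<y. sqrt (real k) / (real k)\<^sup>2)"
      by (simp only: sum_distrib_left)
    also have "\<dots> \<le> 2 * rho x / sqrt (real x) * (4 / sqrt (real x))"
      using sum_sqrt_le(2)[OF x that] rho_nonneg by (intro mult_left_mono) auto
    finally show ?thesis by simp
  qed
  have "(\<lambda>y. T x - T y) \<longlonglongrightarrow> T x - 0" by (intro tendsto_intros T_tendsto_0)
  then have "T x - 0 \<le> 8 * rho x / real x"
    by (rule LIMSEQ_le_const2) (use le in blast)
  then show ?case by simp
qed

text \<open>Meant for \<open>x = al n\<close> and \<open>y = be n\<close>, where the ratio
  \<open>y / x\<close> may be unbounded; hence the explicit dependence on it.\<close>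

lemma D_diff_le:
  "\<forall>\<^sub>F x in sequentially. \<forall>y\<ge>x. D x - D y \<le> 6 * sqrt (real y / real x) * rho x"
  using potter
proof eventually_elim
  case (elim x)
  have x: "1 \<le> x" using elim by simp
  show ?case
  proof (intro allI impI)
    fix y assume y: "x \<le> y"
    have "D x - D y = (\<Sum>k=x..<y. real k * pmf q (int k))" by (rule D_diff[OF y])
    also have "\<dots> \<le> (\<Sum>k=x..<y. 2 * rho x / sqrt (real x) * (1 / sqrt (real k)))"
    proof (rule sum_mono)
      fix k assume "k \<in> {x..<y}"
      then have k: "rho k \<le> 2 * sqrt (real k / real x) * rho x" "1 \<le> k" using elim x by auto
      have "real k * pmf q (int k) = rho k / real k" using k by (simp add: rho_def power2_eq_square)
      also have "\<dots> \<le> 2 * sqrt (real k / real x) * rho x / real k"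
        using k(1) by (rule divide_right_mono) simp
      also have "\<dots> = 2 * rho x / sqrt (real x) * (sqrt (real k) / real k)"
        by (simp add: real_sqrt_divide mult_ac)
      also have "sqrt (real k) / real k = 1 / sqrt (real k)"
        using k(2) by (simp add: frac_eq_eq)
      finally show "real k * pmf q (int k) \<le> 2 * rho x / sqrt (real x) * (1 / sqrt (real k))" .
    qed
    also have "\<dots> = 2 * rho x / sqrt (real x) * (\<Sum>k=x..<y. 1 / sqrt (real k))"
      by (simp only: sum_distrib_left)
    also have "\<dots> \<le> 2 * rho x / sqrt (real x) * (3 * sqrt (real y))"
      using sum_sqrt_le(1)[OF x y] rho_nonneg by (intro mult_left_mono) auto
    finally show "D x - D y \<le> 6 * sqrt (real y / real x) * rho x"
      by (simp add: real_sqrt_divide mult_ac)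
  qed
qed

text \<open>The block from \<open>x\<close> to \<open>2 * x\<close> already carries this much:
  Potter costs a factor 3 there and the change of the square a factor 4.\<close>

lemma T_ge: "\<forall>\<^sub>F x in sequentially. rho x / (12 * real x) \<le> T x"
  using potter
proof eventually_elim
  case (elim x)
  have x: "1 \<le> x" using elim by simp
  have "rho x / (12 * real x) = (\<Sum>k=x..<2*x. rho x / (12 * (real x)\<^sup>2))"
    using x by (simp add: power2_eq_square)
  also have "\<dots> \<le> (\<Sum>k=x..<2*x. pmf q (int k))"
  proof (rule sum_mono)
    fix k assume k: "k \<in> {x..<2*x}"
    have "sqrt (real k / real x) \<le> 3/2"
      using k x by (intro real_le_lsqrt) (auto simp: field_simps power2_eq_square)
    then have "2 * sqrt (real k / real x) * rho k \<le> 3 * rho k" using rho_nonneg[of k] by (intro mult_right_mono) auto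
    then have "rho x \<le> 3 * rho k" using elim k by (meson atLeastLessThan_iff order_trans)
    also have "\<dots> \<le> 3 * ((2 * real x)\<^sup>2 * pmf q (int k))"
      unfolding rho_def using k by (intro mult_left_mono mult_right_mono power_mono) auto
    finally show "rho x / (12 * (real x)\<^sup>2) \<le> pmf q (int k)"
      using x by (simp add: field_simps power_mult_distrib)
  qed
  also have "\<dots> = T x - T (2 * x)" using T_diff[of x "2 * x"] by simp
  also have "\<dots> \<le> T x" using T_nonneg by simp
  finally show ?case .
qed

lemma T_pos: "0 < T x"
proof -
  have "\<forall>\<^sub>F y in sequentially. 0 < T y"
    using T_ge potter
  proof eventually_elim
    case (elim y)
    then have "0 < rho y / (12 * real y)" by simp
    then show ?case using elim by linarith
  qed
  then obtain N where "\<And>y. y \<ge> N \<Longrightarrow> 0 < T y" by (auto simp: eventually_sequentially)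
  from this[of "max x N"] show ?thesis using T_antimono[of x "max x N"] by simp
qed

lemma D_pos: "0 < D x"
proof -
  have "0 < real (Suc x) * T (Suc x)" using T_pos by simp
  also have "\<dots> \<le> D (Suc x)" by (rule mult_T_le_D)
  also have "\<dots> \<le> D x" by (rule D_antimono) simp
  finally show ?thesis .
qed

text \<open>Beyond a fixed \<open>z\<close>, Potter sums \<open>rho\<close> to at most
  \<open>6 * x * rho x\<close>. The constant \<open>V z\<close> is absorbed because Potter in the
  other direction keeps \<open>x * rho x\<close> away from 0.\<close>

lemma V_le: "\<exists>C>0. \<forall>\<^sub>F x in sequentially. V x \<le> C * (real x * rho x)"
proof -
  obtain z where z: "1 \<le> z" "0 < rho z" and
     P: "\<And>x y. z \<le> x \<Longrightarrow> x \<le> y \<Longrightarrow> rho y \<le> 2 * sqrt (real y / real x) * rho x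
      \<and> rho x \<le> 2 * sqrt (real y / real x) * rho y"
    using potter by (auto simp: eventually_sequentially)
  have "V x \<le> (6 + 2 * V z / rho z) * (real x * rho x)" if x: "x \<ge> z" for x
  proof -
    have "(\<Sum>k=z..<x. rho k) \<le> (\<Sum>k=z..<x. 2 * sqrt (real x) * rho x * (1 / sqrt (real k)))"
    proof (rule sum_mono)
      fix k assume "k \<in> {z..<x}"
      then show "rho k \<le> 2 * sqrt (real x) * rho x * (1 / sqrt (real k))"
        using P[of k x] by (simp add: real_sqrt_divide mult_ac)
    qed
    also have "\<dots> = 2 * sqrt (real x) * rho x * (\<Sum>k=z..<x. 1 / sqrt (real k))"
      by (simp only: sum_distrib_left)
    also have "\<dots> \<le> 2 * sqrt (real x) * rho x * (3 * sqrt (real x))"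
      using sum_sqrt_le(1)[OF z(1) x] rho_nonneg by (intro mult_left_mono) auto
    also have "\<dots> = 6 * ((sqrt (real x) * sqrt (real x)) * rho x)" by algebra
    finally have 1: "(\<Sum>k=z..<x. rho k) \<le> 6 * (real x * rho x)" by simp
    have "rho z \<le> 2 * sqrt (real x / real z) * rho x" using P[of z x] x by simp
    also have "\<dots> \<le> 2 * real x * rho x"
    proof (intro mult_right_mono mult_left_mono)
      have "real x / real z \<le> real x" using z by (simp add: divide_le_eq mult_le_cancel_left1)
      also have "\<dots> \<le> (real x)\<^sup>2" using x z by (simp add: power2_eq_square)
      finally have "real x / real z \<le> (real x)\<^sup>2" .
      then show "sqrt (real x / real z) \<le> real x" by (rule real_le_lsqrt[rotated]) auto
    qed (use rho_nonneg in auto)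
    finally have "V z * rho z \<le> V z * (2 * real x * rho x)" using V_nonneg by (rule mult_left_mono)
    then have "V z \<le> 2 * V z / rho z * (real x * rho x)" using z(2) by (simp add: field_simps)
    then show ?thesis using 1 V_add[OF x] by (simp add: algebra_simps)
  qed
  moreover have "0 < 6 + 2 * V z / rho z" using V_nonneg[of z] z by (simp add: add_pos_nonneg)
  ultimately show ?thesis by (auto simp: eventually_sequentially)
qed

text \<open>The logarithm of Karamata's theorem: on \<open>{x..<m * x}\<close> the function
  \<open>rho\<close> is nearly constant, so this block contributes at least
  \<open>rho x * ln m / 2\<close> to \<open>D x\<close>, and \<open>m\<close> is arbitrary.\<close>

lemma rho_le_D:
  assumes e: "0 < e"
  shows "\<forall>\<^sub>F x in sequentially. rho x \<le> e * D x"
proof -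
  \<comment> \<open>Chosen so that \<open>ln m / 2\<close> is at least \<open>1 / e\<close>.\<close>
  define m where "m = nat \<lceil>exp (2 / e)\<rceil>"
  have m: "exp (2 / e) \<le> real m" by (simp add: m_def real_nat_ceiling_ge)
  have "exp (2 / e) > 1" using e by simp
  then have m1: "1 < real m" using m by linarith
  have lnm: "2 / e \<le> ln (real m)" using m m1 by (simp add: ln_ge_iff)
  obtain x0 where x0: "\<And>x y. x \<ge> x0 \<Longrightarrow> x \<le> y \<Longrightarrow> real y \<le> real m * real x \<Longrightarrow> \<bar>rho y - rho x\<bar> \<le> 1/2 * rho x"
    using usv[of "1/2" "real m"] m1 unfolding rho_def by auto
  show ?thesis
    using eventually_ge_at_top[of "max x0 1"]
  proof eventually_elim
    case (elim x)
    have x: "1 \<le> x" "x \<le> m * x" using elim m1 by auto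
    have "rho x / e = 1/2 * rho x * (2 / e)" by simp
    also have "\<dots> \<le> 1/2 * rho x * ln (real m)" using lnm rho_nonneg by (intro mult_left_mono) auto
    also have "ln (real m) = ln (real (m * x) / real x)" using x by simp
    also have "1/2 * rho x * \<dots> \<le> 1/2 * rho x * (\<Sum>k=x..<m*x. 1 / real k)"
      by (rule mult_left_mono[OF sum_sqrt_le(3)[OF x]]) (use rho_nonneg in simp)
    also have "\<dots> = (\<Sum>k=x..<m*x. 1/2 * rho x * (1 / real k))" by (simp only: sum_distrib_left)
    also have "\<dots> \<le> (\<Sum>k=x..<m*x. real k * pmf q (int k))"
    proof (rule sum_mono)
      fix k assume k: "k \<in> {x..<m*x}"
      have "real k \<le> real (m * x)" using k by (intro of_nat_mono) simp
      then have "\<bar>rho k - rho x\<bar> \<le> 1/2 * rho x" using x0[of x k] elim k by simp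
      then have "1/2 * rho x \<le> rho k" by linarith
      then have "1/2 * rho x * (1 / real k) \<le> rho k * (1 / real k)" by (rule mult_right_mono) simp
      also have "\<dots> = real k * pmf q (int k)" using k x by (simp add: rho_def power2_eq_square)
      finally show "1/2 * rho x * (1 / real k) \<le> real k * pmf q (int k)" .
    qed
    also have "\<dots> = D x - D (m * x)" using D_diff[OF x(2)] by simp
    also have "\<dots> \<le> D x" using D_nonneg by simp
    finally show ?case using e by (simp add: field_simps)
  qed
qed

text \<open>The exponent 3 is 2 from the square in \<open>rho\<close> plus the Potter exponent
  rounded up to 1. This crudeness is harmless: the cube is only set against exponentials or applied
  to bounded ratios.\<close>

lemma pmf_potter:
  "\<forall>\<^sub>F x in sequentially. 1 \<le> x \<and> 0 < pmf q (int x) \<and> (\<forall>y\<ge>x. pmf q (int y) \<le> 2 * pmf q (int x)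
      \<and> pmf q (int x) \<le> 2 * (real y / real x) ^ 3 * pmf q (int y))"
  using potter
proof eventually_elim
  case (elim x)
  have x: "1 \<le> x" "0 < rho x" using elim by auto
  have "pmf q (int y) \<le> 2 * pmf q (int x) \<and> pmf q (int x) \<le> 2 * (real y / real x) ^ 3 * pmf q (int y)"
    if y: "y \<ge> x" for y
  proof -
    define z where "z = real y / real x"
    have z: "1 \<le> z" using y x by (simp add: z_def)
    have "z \<le> z\<^sup>2" using z by (simp add: power2_eq_square)
    then have sz: "sqrt z \<le> z" using z by (intro real_le_lsqrt) auto
    have zz: "z * 1 \<le> z * z" using z by (intro mult_left_mono) auto
    have yz: "real y = z * real x" using x by (simp add: z_def)
    have R: "rho y = z\<^sup>2 * (real x)\<^sup>2 * pmf q (int y)" "rho x = (real x)\<^sup>2 * pmf q (int x)"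
      by (simp_all add: rho_def yz power_mult_distrib)
    have P: "rho y \<le> 2 * sqrt z * rho x" "rho x \<le> 2 * sqrt z * rho y"
      using elim y by (auto simp: z_def)
    have "rho y \<le> 2 * z\<^sup>2 * rho x"
      using P(1) sz zz rho_nonneg[of x] by (elim order_trans) (intro mult_right_mono, auto simp: power2_eq_square)
    then have "pmf q (int y) \<le> 2 * pmf q (int x)"
      using x z unfolding R by (simp add: mult_ac) 
    moreover have "rho x \<le> 2 * z * rho y"
      using P(2) sz rho_nonneg[of y] by (elim order_trans) (intro mult_right_mono, auto)
    then have "pmf q (int x) \<le> 2 * z ^ 3 * pmf q (int y)"
      using x z unfolding R by (simp add: power2_eq_square power3_eq_cube mult_ac)
    ultimately show ?thesis by (simp add: z_def)
  qed
  moreover have "0 < pmf q (int x)" using x pmf_eq_rho[of x] by simp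
  ultimately show ?case using x by blast
qed

end

section \<open>Excursions and their distance to the limit path\<close>

text \<open>The bridge form of the event that the walk first becomes negative at time
  \<open>n\<close>: a skip-free walk can do so only at -1.\<close>

definition excursions :: "nat \<Rightarrow> int list set" where
  "excursions n = {xs. length xs = n \<and> sum_list xs = -1 \<and> (\<forall>k<n. 0 \<le> sum_list (take k xs))}"

text \<open>Used for the \<open>n - 1\<close> steps other than the big jump; the slope nevertheless
  refers to \<open>n\<close>, and the tolerance is relative to \<open>B\<close>.\<close>

definition near_line :: "nat \<Rightarrow> real \<Rightarrow> real \<Rightarrow> int list set" where
  "near_line n B e = {ys. \<forall>i\<le>length ys. \<bar>real_of_int (sum_list (take i ys)) + real i * B / real n\<bar> \<le> e * B}"

text \<open>Cut the excursion at step \<open>j\<close>. The part before the jump is an increment of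
  a walk falling at rate \<open>B / n\<close>, so nonnegativity limits its duration. The part after
  it is anchored at the end value -1, which is the source of the \<open>+ 1\<close>. The factors 2
  arise because increments involve two positions on the line.\<close>

lemma excursion_of_near_line:
  assumes xs: "xs \<in> excursions n" and j: "j < n" and B: "0 < B"
    and near: "tl (rotate j xs) \<in> near_line n B e"
  shows "real j \<le> 2 * e * real n"
    and "\<And>k. k \<le> j \<Longrightarrow> 0 \<le> sum_list (take k xs) \<and> real_of_int (sum_list (take k xs)) \<le> 2 * e * B"
    and "\<And>k. j < k \<Longrightarrow> k \<le> n \<Longrightarrow>
      \<bar>real_of_int (sum_list (take k xs)) - (1 - real k / real n) * B\<bar> \<le> 2 * e * B + 1"
proof -
  define W where "W = (\<lambda>k. sum_list (take k xs))"
  \<comment> \<open>In the cyclic order that starts at the jump, the steps after it come before the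
    steps preceding it; \<open>N\<close> below is the number of the former.\<close>
  define ys where "ys = drop (Suc j) xs @ take j xs"
  define S where "S = (\<lambda>i. sum_list (take i ys))"
  have len: "length xs = n" and Wn: "W n = -1" and pos: "\<And>k. k < n \<Longrightarrow> 0 \<le> W k"
    using xs by (auto simp: excursions_def W_def)
  have "tl (rotate j xs) = ys"
    using j len by (simp add: rotate_drop_take ys_def tl_append2 tl_drop drop_Suc)
  moreover have "length ys = n - 1" using j len by (simp add: ys_def)
  ultimately have near: "\<bar>real_of_int (S i) + real i * B / real n\<bar> \<le> e * B" if "i \<le> n - 1" for i
    using near that by (auto simp: near_line_def S_def)
  have S1: "S i = W (Suc j + i) - W (Suc j)" if "i \<le> n - 1 - j" for i
  proof -
    have "take i ys = take i (drop (Suc j) xs)" using that len by (simp add: ys_def)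
    then show ?thesis using take_add[of "Suc j" i xs] by (simp add: S_def W_def)
  qed
  define N where "N = n - 1 - j"
  have SN: "S N = - 1 - W (Suc j)" using S1[of N] j Wn by (simp add: N_def)
  have S2: "S (N + i) = S N + W i" if "i \<le> j" for i
  proof -
    have lN: "length (drop (Suc j) xs) = N" using len by (simp add: N_def)
    then have "take (N + i) ys = drop (Suc j) xs @ take i xs" "take N ys = drop (Suc j) xs"
      using that by (simp_all add: ys_def min_absorb1)
    then show ?thesis by (simp add: S_def W_def)
  qed
  have Wi: "real_of_int (W i) \<le> 2 * e * B - real i * B / real n" if "i \<le> j" for i
  proof -
    have "\<bar>real_of_int (S (N + i)) + real (N + i) * B / real n\<bar> \<le> e * B"
         "\<bar>real_of_int (S N) + real N * B / real n\<bar> \<le> e * B"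
      using that j by (intro near; simp add: N_def)+
    then have "\<bar>real_of_int (S N) + real_of_int (W i) + (real N * B / real n + real i * B / real n)\<bar> \<le> e * B"
      "\<bar>real_of_int (S N) + real N * B / real n\<bar> \<le> e * B"
      by (simp_all add: S2[OF that] ring_distribs add_divide_distrib)
    moreover have "w \<le> 2 * E - c" if "\<bar>s + w + (a + c)\<bar> \<le> E" "\<bar>s + a\<bar> \<le> E" for s w a c E :: real
      using that by linarith
    ultimately have "real_of_int (W i) \<le> 2 * (e * B) - real i * B / real n" by blast
    then show ?thesis by (simp only: mult.assoc)
  qed
  show "real j \<le> 2 * e * real n"
  proof -
    have "0 \<le> real_of_int (W j)" using pos[OF j] by simp
    then have "real j * B / real n \<le> 2 * e * B" using Wi[of j] by linarith
    then have "real j / real n * B \<le> 2 * e * B" by simp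
    then have "real j / real n \<le> 2 * e" using B by (simp only: mult_le_cancel_right)
    then show ?thesis using j by (simp add: divide_le_eq)
  qed
  show "0 \<le> sum_list (take k xs) \<and> real_of_int (sum_list (take k xs)) \<le> 2 * e * B" if "k \<le> j" for k
  proof -
    have "0 \<le> real k * B / real n" using B by simp
    then show ?thesis using Wi[OF that] pos[of k] that j by (auto simp: W_def)
  qed
  show "\<bar>real_of_int (sum_list (take k xs)) - (1 - real k / real n) * B\<bar> \<le> 2 * e * B + 1"
    if k: "j < k" "k \<le> n" for k
  proof -
    define i where "i = k - Suc j"
    have i: "i \<le> N" "Suc j + i = k" using k by (auto simp: i_def N_def)
    have "W k = - 1 - S N + S i" using S1[of i] i SN by (simp add: N_def)
    then have "real_of_int (W k) = - 1 - real_of_int (S N) + real_of_int (S i)" by simp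
    moreover have "\<bar>real_of_int (S i) + real i * B / real n\<bar> \<le> e * B"
         "\<bar>real_of_int (S N) + real N * B / real n\<bar> \<le> e * B"
      using i j by (intro near; simp add: N_def)+
    moreover have "real N * B / real n - real i * B / real n = (1 - real k / real n) * B"
    proof -
      have "real N - real i = real n - real k" using k j by (simp add: N_def i_def of_nat_diff)
      then have "(real N - real i) * B / real n = (real n - real k) * B / real n" by simp
      then show ?thesis using j by (simp add: field_simps)
    qed
    moreover have "\<bar>w - z\<bar> \<le> 2 * E + 1"
      if "w = - 1 - v + u" "\<bar>u + x\<bar> \<le> E" "\<bar>v + y\<bar> \<le> E" "y - x = z" for w v u x y z E :: real
      using that by linarith
    ultimately have "\<bar>real_of_int (W k) - (1 - real k / real n) * B\<bar> \<le> 2 * (e * B) + 1" by blast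
    then show ?thesis by (simp only: W_def mult.assoc)
  qed
qed

section \<open>Distance to the limit path in the Skorokhod space\<close>

text \<open>The piecewise linear map that fixes -1 and 1 and sends \<open>r\<close> to 0. It aligns
  a jump at time \<open>r\<close> with the jump of the limit at 0.\<close>

lemma time_change_to_0:
  fixes r :: real
  assumes r: "0 < r" "r < 1"
  obtains \<mu> where "\<mu> \<in> time_changes (-1) 1" "\<And>t. t \<in> {-1..1} \<Longrightarrow> \<bar>\<mu> t - t\<bar> \<le> r"
    "\<And>t. t \<in> {-1..1} \<Longrightarrow> t < r \<Longrightarrow> \<mu> t < 0" "\<And>t. t \<in> {-1..1} \<Longrightarrow> r \<le> t \<Longrightarrow> 0 \<le> \<mu> t"
proof
  define \<mu> where "\<mu> = (\<lambda>t. if t \<le> r then (t - r) / (1 + r) else (t - r) / (1 - r))"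
  have sm: "strict_mono_on {-1..1} \<mu>"
  proof (rule strict_mono_onI)
    fix s t :: real assume st: "s \<in> {-1..1}" "t \<in> {-1..1}" "s < t"
    consider "t \<le> r" | "s \<le> r" "r < t" | "r < s" by linarith
    then show "\<mu> s < \<mu> t"
    proof cases
      case 1 then show ?thesis using st r by (simp add: \<mu>_def divide_strict_right_mono)
    next
      case 2
      have "(s - r) / (1 + r) \<le> 0" "0 < (t - r) / (1 - r)" using 2 r by (auto simp: divide_le_0_iff)
      then show ?thesis using 2 by (simp add: \<mu>_def)
    next
      case 3 then show ?thesis using st r by (simp add: \<mu>_def divide_strict_right_mono)
    qed
  qed
  have cont: "continuous_on {-1..1} \<mu>"
  proof -
    have "continuous_on ({-1..r} \<union> {r..1}) \<mu>"
      unfolding \<mu>_def using r by (intro continuous_on_If continuous_intros) auto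
    moreover have "{-1..r} \<union> {r..1} = {-1..1}" using r by auto
    ultimately show ?thesis by simp
  qed
  have ends: "\<mu> (-1) = -1" "\<mu> 1 = 1" using r by (auto simp: \<mu>_def field_simps)
  have "\<mu> ` {-1..1} = {-1..1}"
  proof
    show "\<mu> ` {-1..1} \<subseteq> {-1..1}"
    proof
      fix y assume "y \<in> \<mu> ` {-1..1}"
      then obtain t where t: "t \<in> {-1..1}" "y = \<mu> t" by auto
      have "\<mu> (-1) \<le> \<mu> t" "\<mu> t \<le> \<mu> 1"
        using strict_mono_on_imp_mono_on[OF sm] t by (auto intro: mono_onD)
      then show "y \<in> {-1..1}" using t ends by simp
    qed
    show "{-1..1} \<subseteq> \<mu> ` {-1..1}"
    proof
      fix y :: real assume "y \<in> {-1..1}"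
      then have "\<exists>x. -1 \<le> x \<and> x \<le> 1 \<and> \<mu> x = y" using ends cont by (intro IVT') auto
      then show "y \<in> \<mu> ` {-1..1}" by auto
    qed
  qed
  then show "\<mu> \<in> time_changes (-1) 1" using sm cont by (simp add: time_changes_def)
  fix t :: real assume t: "t \<in> {-1..1}"
  show "\<bar>\<mu> t - t\<bar> \<le> r"
  proof (cases "t \<le> r")
    case True
    have "\<mu> t - t = - (r * ((1 + t) / (1 + r)))" using True r by (simp add: \<mu>_def field_simps)
    moreover have "(1 + t) / (1 + r) \<le> 1" using r True by simp
    then have "r * ((1 + t) / (1 + r)) \<le> r * 1" by (rule mult_left_mono) (use r in simp)
    moreover have "0 \<le> r * ((1 + t) / (1 + r))" using t r by simp
    ultimately show ?thesis by linarith
  next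
    case False
    have "\<mu> t - t = - (r * ((1 - t) / (1 - r)))" using False r by (simp add: \<mu>_def field_simps)
    moreover have "(1 - t) / (1 - r) \<le> 1" using r False by simp
    then have "r * ((1 - t) / (1 - r)) \<le> r * 1" by (rule mult_left_mono) (use r in simp)
    moreover have "0 \<le> r * ((1 - t) / (1 - r))" using t r by simp
    ultimately show ?thesis by linarith
  qed
  show "t < r \<Longrightarrow> \<mu> t < 0" using r t by (simp add: \<mu>_def divide_neg_pos)
  show "r \<le> t \<Longrightarrow> 0 \<le> \<mu> t" using r t by (simp add: \<mu>_def)
qed

text \<open>Before the jump both paths are near 0. After it the error is
  \<open>2 * e + 1 / B\<close> from the height, \<open>1 / n\<close> from rounding time, and
  \<open>2 * e + 1 / n\<close> from the time change.\<close>

lemma skorokhod_close_limit_path: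
  fixes w :: "int \<Rightarrow> real" and B e :: real
  assumes n: "Suc j < n" and B: "0 < B" and e: "0 \<le> e"
    and j: "real j \<le> 2 * e * real n" and neg: "\<And>k. k < 0 \<Longrightarrow> w k = 0"
    and before: "\<And>k. k \<le> j \<Longrightarrow> 0 \<le> w (int k) \<and> w (int k) \<le> 2 * e * B"
    and after: "\<And>k. j < k \<Longrightarrow> k \<le> n \<Longrightarrow> \<bar>w (int k) - (1 - real k / real n) * B\<bar> \<le> 2 * e * B + 1"
  shows "skorokhod_close (-1) 1 (\<lambda>t\<in>{-1..1}. w \<lfloor>real n * t\<rfloor> / B) limit_path (4 * e + 1 / B + 2 / real n)"
proof -
  \<comment> \<open>Index \<open>j\<close> counts from 0, so the big step is the one leading to time
    \<open>Suc j\<close>, where the rescaled path jumps.\<close>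
  define r where "r = real (Suc j) / real n"
  have r: "0 < r" "r < 1" using n by (auto simp: r_def)
  have "r = real j / real n + 1 / real n" by (simp add: r_def add_divide_distrib)
  moreover have "real j / real n \<le> 2 * e" using j n by (simp add: divide_le_eq)
  ultimately have r_le: "r \<le> 2 * e + 1 / real n" by simp
  obtain \<mu> where \<mu>: "\<mu> \<in> time_changes (-1) 1" "\<And>t. t \<in> {-1..1} \<Longrightarrow> \<bar>\<mu> t - t\<bar> \<le> r"
    "\<And>t. t \<in> {-1..1} \<Longrightarrow> t < r \<Longrightarrow> \<mu> t < 0" "\<And>t. t \<in> {-1..1} \<Longrightarrow> r \<le> t \<Longrightarrow> 0 \<le> \<mu> t"
    using time_change_to_0[OF r] by blast
  have nB: "0 \<le> 1 / B" "0 \<le> 1 / real n" "2 / real n = 2 * (1 / real n)" using B by auto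
  have "\<bar>\<mu> t - t\<bar> \<le> 4 * e + 1 / B + 2 / real n \<and>
     \<bar>(\<lambda>t\<in>{-1..1}. w \<lfloor>real n * t\<rfloor> / B) t - limit_path (\<mu> t)\<bar> \<le> 4 * e + 1 / B + 2 / real n"
    if t: "t \<in> {-1..1}" for t
  proof
    show "\<bar>\<mu> t - t\<bar> \<le> 4 * e + 1 / B + 2 / real n"
      using \<mu>(2)[OF t] r_le nB e by linarith
    have \<mu>t: "\<mu> t \<in> {-1..1}" using \<mu>(1) t by (auto simp: time_changes_def)
    show "\<bar>(\<lambda>t\<in>{-1..1}. w \<lfloor>real n * t\<rfloor> / B) t - limit_path (\<mu> t)\<bar> \<le> 4 * e + 1 / B + 2 / real n"
    proof (cases "t < r")
      case True
      have l0: "limit_path (\<mu> t) = 0" using \<mu>(3)[OF t True] \<mu>t by (simp add: limit_path_def)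
      have "\<lfloor>real n * t\<rfloor> < int (Suc j)"
        using True n by (simp add: floor_less_iff r_def field_simps)
      then have "0 \<le> w \<lfloor>real n * t\<rfloor> \<and> w \<lfloor>real n * t\<rfloor> \<le> 2 * e * B"
        using neg[of "\<lfloor>real n * t\<rfloor>"] before[of "nat \<lfloor>real n * t\<rfloor>"] e B
        by (cases "\<lfloor>real n * t\<rfloor> < 0") auto
      then have "0 \<le> w \<lfloor>real n * t\<rfloor> / B \<and> w \<lfloor>real n * t\<rfloor> / B \<le> 2 * e"
        using B by (simp add: divide_le_eq)
      moreover have "(\<lambda>t\<in>{-1..1}. w \<lfloor>real n * t\<rfloor> / B) t = w \<lfloor>real n * t\<rfloor> / B" using t by simp
      ultimately show ?thesis using l0 nB e by linarith
    next
      case False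
      have l1: "limit_path (\<mu> t) = 1 - \<mu> t" using \<mu>(4)[OF t] False \<mu>t by (simp add: limit_path_def)
      have lo: "int (Suc j) \<le> \<lfloor>real n * t\<rfloor>"
        using False n by (simp add: le_floor_iff r_def field_simps)
      have "real n * t \<le> real n * 1" using t by (intro mult_left_mono) auto
      then have hi: "\<lfloor>real n * t\<rfloor> \<le> int n" by (simp add: floor_le_iff)
      define k where "k = nat \<lfloor>real n * t\<rfloor>"
      have "int k = \<lfloor>real n * t\<rfloor>" unfolding k_def by (rule nat_0_le) (use lo in linarith)
      then have k: "j < k" "k \<le> n" "\<lfloor>real n * t\<rfloor> = int k" using lo hi by linarith+
      have "\<bar>w (int k) - (1 - real k / real n) * B\<bar> / B \<le> (2 * e * B + 1) / B"
        using after[OF k(1,2)] B by (intro divide_right_mono) auto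
      also have "\<bar>w (int k) - (1 - real k / real n) * B\<bar> / B = \<bar>(w (int k) - (1 - real k / real n) * B) / B\<bar>"
        using B by simp
      also have "(w (int k) - (1 - real k / real n) * B) / B = w (int k) / B - (1 - real k / real n)"
        using B by (simp add: diff_divide_distrib)
      also have "(2 * e * B + 1) / B = 2 * e + 1 / B" using B by (simp add: add_divide_distrib)
      finally have 1: "\<bar>w (int k) / B - (1 - real k / real n)\<bar> \<le> 2 * e + 1 / B" .
      have "real k \<le> real n * t" "real n * t < real k + 1" using k(3) by linarith+
      then have "real k / real n \<le> t" "t < real k / real n + 1 / real n"
        using n by (simp_all add: field_simps)
      then show ?thesis using 1 \<mu>(2)[OF t] r_le l1 t k(3) by simp
    qed
  qed
  then show ?thesis using \<mu>(1) unfolding skorokhod_close_def by blast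
qed

lemma step_path_in_skorokhod_space:
  "(\<lambda>t\<in>{a..b}. g \<lfloor>real n * t\<rfloor>) \<in> skorokhod_space a b" for g :: "int \<Rightarrow> real"
proof (cases "n = 0")
  case True
  have "((\<lambda>t\<in>{a..b}. g 0) \<longlongrightarrow> g 0) (at_right t)" if "a \<le> t" "t < b" for t
  proof (rule tendsto_eventually)
    show "\<forall>\<^sub>F s in at_right t. (\<lambda>t\<in>{a..b}. g 0) s = g 0"
      using that by (auto simp: eventually_at_right_field intro!: exI[of _ b])
  qed
  moreover have "((\<lambda>t\<in>{a..b}. g 0) \<longlongrightarrow> g 0) (at_left t)" if "a < t" "t \<le> b" for t
  proof (rule tendsto_eventually)
    show "\<forall>\<^sub>F s in at_left t. (\<lambda>t\<in>{a..b}. g 0) s = g 0"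
      using that by (auto simp: eventually_at_left_field intro!: exI[of _ a])
  qed
  ultimately have "(\<lambda>t\<in>{a..b}. g 0) \<in> skorokhod_space a b" unfolding skorokhod_space_def by force
  then show ?thesis using True by simp
next
  case False
  then have n: "0 < real n" by simp
  define f where "f = (\<lambda>t\<in>{a..b}. g \<lfloor>real n * t\<rfloor>)"
  have "(f \<longlongrightarrow> f t) (at_right t)" if t: "a \<le> t" "t < b" for t
  proof (rule tendsto_eventually)
    have "real n * t < of_int (\<lfloor>real n * t\<rfloor> + 1)" by linarith
    then have 1: "t < of_int (\<lfloor>real n * t\<rfloor> + 1) / real n" using n by (simp add: field_simps)
    have "\<lfloor>real n * s\<rfloor> = \<lfloor>real n * t\<rfloor>" if "t < s" "s < of_int (\<lfloor>real n * t\<rfloor> + 1) / real n" for s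
    proof -
      have "real n * t \<le> real n * s" "real n * s < of_int (\<lfloor>real n * t\<rfloor> + 1)"
        using that n by (auto simp: field_simps)
      then show ?thesis by linarith
    qed
    then show "\<forall>\<^sub>F s in at_right t. f s = f t"
      using t 1 unfolding eventually_at_right_field f_def
      by (intro exI[of _ "min b (of_int (\<lfloor>real n * t\<rfloor> + 1) / real n)"]) auto
  qed
  \<comment> \<open>The ceiling minus one is the value of the floor just left of \<open>t\<close>,
    whether or not \<open>n * t\<close> is an integer.\<close>
  moreover have "(f \<longlongrightarrow> g (\<lceil>real n * t\<rceil> - 1)) (at_left t)" if t: "a < t" "t \<le> b" for t
  proof (rule tendsto_eventually)
    have "of_int (\<lceil>real n * t\<rceil> - 1) < real n * t" by linarith
    then have 1: "of_int (\<lceil>real n * t\<rceil> - 1) / real n < t" using n by (simp add: field_simps)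
    have "\<lfloor>real n * s\<rfloor> = \<lceil>real n * t\<rceil> - 1" if "s < t" "of_int (\<lceil>real n * t\<rceil> - 1) / real n < s" for s
    proof -
      have "real n * s < real n * t" "of_int (\<lceil>real n * t\<rceil> - 1) < real n * s"
        using that n by (auto simp: field_simps)
      then show ?thesis by linarith
    qed
    then show "\<forall>\<^sub>F s in at_left t. f s = g (\<lceil>real n * t\<rceil> - 1)"
      using t 1 unfolding eventually_at_left_field f_def
      by (intro exI[of _ "max a (of_int (\<lceil>real n * t\<rceil> - 1) / real n)"]) auto
  qed
  moreover have "f \<in> extensional {a..b}" by (simp add: f_def)
  ultimately show ?thesis unfolding f_def[symmetric] skorokhod_space_def by force
qed

lemma limit_path_in_skorokhod_space: "limit_path \<in> skorokhod_space (-1) 1"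
proof -
  have "(limit_path \<longlongrightarrow> limit_path t) (at_right t)" if t: "-1 \<le> t" "t < 1" for t
  proof (cases "t < 0")
    case True
    show ?thesis
    proof (rule tendsto_eventually)
      show "\<forall>\<^sub>F s in at_right t. limit_path s = limit_path t"
        using t True by (auto simp: eventually_at_right_field limit_path_def intro!: exI[of _ 0])
    qed
  next
    case False
    have "((\<lambda>s. 1 - s) \<longlongrightarrow> 1 - t) (at_right t)" by (intro tendsto_intros)
    moreover have "\<forall>\<^sub>F s in at_right t. 1 - s = limit_path s"
      using t False by (auto simp: eventually_at_right_field limit_path_def intro!: exI[of _ 1])
    ultimately have "(limit_path \<longlongrightarrow> 1 - t) (at_right t)" by (rule Lim_transform_eventually)
    then show ?thesis using t False by (simp add: limit_path_def)
  qed
  moreover have "\<exists>l. (limit_path \<longlongrightarrow> l) (at_left t)" if t: "-1 < t" "t \<le> 1" for t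
  proof (cases "t \<le> 0")
    case True
    have "(limit_path \<longlongrightarrow> 0) (at_left t)"
    proof (rule tendsto_eventually)
      show "\<forall>\<^sub>F s in at_left t. limit_path s = 0"
        using t True by (auto simp: eventually_at_left_field limit_path_def intro!: exI[of _ "-1"])
    qed
    then show ?thesis ..
  next
    case False
    have "((\<lambda>s. 1 - s) \<longlongrightarrow> 1 - t) (at_left t)" by (intro tendsto_intros)
    moreover have "\<forall>\<^sub>F s in at_left t. 1 - s = limit_path s"
      using t False by (auto simp: eventually_at_left_field limit_path_def intro!: exI[of _ 0])
    ultimately have "(limit_path \<longlongrightarrow> 1 - t) (at_left t)" by (rule Lim_transform_eventually)
    then show ?thesis ..
  qed
  ultimately show ?thesis by (simp add: skorokhod_space_def limit_path_def)
qed

section \<open>Rotations of bridges and the cyclic lemma\<close>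

lemma rotate_eq_drop_take: "m \<le> length xs \<Longrightarrow> rotate m xs = drop m xs @ take m xs"
  using rotate_append[of "take m xs" "drop m xs"] by simp

lemma sum_list_take_rotate:
  fixes xs :: "int list"
  assumes "m \<le> length xs"
  shows "k \<le> length xs - m \<Longrightarrow> sum_list (take k (rotate m xs)) = sum_list (take (m + k) xs) - sum_list (take m xs)"
    and "length xs - m \<le> k \<Longrightarrow> k \<le> length xs \<Longrightarrow> sum_list (take k (rotate m xs))
      = sum_list xs - sum_list (take m xs) + sum_list (take (k - (length xs - m)) xs)"
proof -
  have "sum_list (take m xs) + sum_list (drop m xs) = sum_list xs"
    by (metis append_take_drop_id sum_list_append)
  then have 1: "sum_list (drop m xs) = sum_list xs - sum_list (take m xs)" by simp
  show "k \<le> length xs - m \<Longrightarrow> sum_list (take k (rotate m xs)) = sum_list (take (m + k) xs) - sum_list (take m xs)"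
    using assms by (simp add: rotate_eq_drop_take take_add)
  show "length xs - m \<le> k \<Longrightarrow> k \<le> length xs \<Longrightarrow> sum_list (take k (rotate m xs))
      = sum_list xs - sum_list (take m xs) + sum_list (take (k - (length xs - m)) xs)"
    using assms 1 by (simp add: rotate_eq_drop_take min_absorb1)
qed

lemma sum_list_rotate: "sum_list (rotate m xs) = sum_list xs" for xs :: "int list"
proof (induction m)
  case (Suc m)
  have "sum_list (rotate1 ys) = sum_list ys" for ys :: "int list" by (cases ys) auto
  then show ?case using Suc by (simp add: rotate_def)
qed simp

text \<open>Cyclic lemma: the rotation starting at the first minimum of the walk is an excursion.\<close>

lemma ex_rotate_excursion:
  assumes len: "length xs = n" "0 < n" and sum: "sum_list xs = -1"
  shows "\<exists>r. rotate r xs \<in> excursions n"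
proof -
  define W where "W = (\<lambda>k. sum_list (take k xs))"
  define P where "P = (\<lambda>k. 1 \<le> k \<and> k \<le> n \<and> (\<forall>i\<in>{1..n}. W k \<le> W i))"
  have "finite (W ` {1..n})" "W ` {1..n} \<noteq> {}" using len by auto
  from Min_in[OF this] obtain k where "k \<in> {1..n}" "W k = Min (W ` {1..n})" by auto
  then have "P k" by (auto simp: P_def intro!: Min_le)
  \<comment> \<open>The minimum has to be the first one: earlier positions are then strictly higher,
    which pays for the -1 collected when the rotation wraps around.\<close>
  define m where "m = (LEAST k. P k)"
  have m: "P m" unfolding m_def using \<open>P k\<close> by (rule LeastI)
  have strict: "W m < W i" if "1 \<le> i" "i < m" for i
  proof (rule ccontr)
    assume "\<not> W m < W i"
    then have "P i" using m that by (force simp: P_def)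
    then show False using that not_less_Least[of i P] by (simp add: m_def)
  qed
  have mn: "m \<le> length xs" using m len by (simp add: P_def)
  have Wn: "W n = -1" using len sum by (simp add: W_def)
  have "W m \<le> W n" using m len unfolding P_def by auto
  then have Wm: "W m \<le> -1" using Wn by simp
  have "0 \<le> sum_list (take k (rotate m xs))" if k: "k < n" for k
  proof (cases "k \<le> n - m")
    case True
    then have "sum_list (take k (rotate m xs)) = W (m + k) - W m"
      using sum_list_take_rotate(1)[OF mn, of k] len by (simp add: W_def)
    moreover have "W m \<le> W (m + k)" using m True by (auto simp: P_def)
    ultimately show ?thesis by simp
  next
    case False
    define i where "i = k - (n - m)"
    have i: "1 \<le> i" "i < m" using False k mn len by (auto simp: i_def)
    have "sum_list (take k (rotate m xs)) = -1 - W m + W i"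
      using sum_list_take_rotate(2)[OF mn, of k] False k len sum by (simp add: W_def i_def)
    then show ?thesis using strict[OF i] by simp
  qed
  then have "rotate m xs \<in> excursions n"
    using len sum by (simp add: excursions_def sum_list_rotate)
  then show ?thesis by blast
qed

text \<open>The first \<open>r\<close> steps of an excursion have sum at least 0, so the others have
  sum at most -1. In the rotation these others form a proper initial segment, which therefore ends
  below 0.\<close>

lemma rotate_not_excursion:
  assumes xs: "xs \<in> excursions n" and r: "0 < r" "r < n"
  shows "rotate r xs \<notin> excursions n"
proof
  assume r': "rotate r xs \<in> excursions n"
  have len: "length xs = n" "sum_list xs = -1" "0 \<le> sum_list (take r xs)"
    using xs r by (auto simp: excursions_def)
  have "sum_list (take (n - r) (rotate r xs)) = sum_list xs - sum_list (take r xs)"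
    using sum_list_take_rotate(1)[of r xs "n - r"] r len by simp
  moreover have "0 \<le> sum_list (take (n - r) (rotate r xs))" using r' r by (simp add: excursions_def)
  ultimately show False using len by simp
qed

lemma rotate_hd:
  assumes "x \<in> set xs"
  obtains j where "j < length xs" "hd (rotate j xs) = x"
proof -
  obtain j where j: "j < length xs" "xs ! j = x" using assms by (auto simp: in_set_conv_nth)
  have "hd (rotate j xs) = xs ! (j mod length xs)" using j by (intro hd_rotate_conv_nth) auto
  then show thesis using j that by simp
qed

lemma prob_replicate_pmf_length:
  "measure_pmf.prob (replicate_pmf n q) {xs. length xs = n \<and> xs \<in> A} = measure_pmf.prob (replicate_pmf n q) A"
proof -
  have "{xs. length xs = n \<and> xs \<in> A} \<inter> set_pmf (replicate_pmf n q) = A \<inter> set_pmf (replicate_pmf n q)"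
    by (auto simp: set_replicate_pmf)
  then show ?thesis by (metis measure_Int_set_pmf)
qed

text \<open>Rotate the walk so that it starts with a jump in \<open>Y\<close>; an excursion is the only excursion
  among its rotations.\<close>

lemma prob_excursion_jump_le:
  assumes Y: "\<And>xs. xs \<in> E \<Longrightarrow> xs \<in> excursions n \<and> (\<exists>j<n. hd (rotate j xs) \<in> Y \<and> tl (rotate j xs) \<in> G)"
    and c: "0 \<le> c" "\<And>y. y \<in> Y \<Longrightarrow> pmf q y \<le> c" and n: "0 < n"
  shows "measure_pmf.prob (replicate_pmf n q) E
    \<le> c * measure_pmf.prob (replicate_pmf (n - 1) q) {ys \<in> G. - 1 - sum_list ys \<in> Y}"
proof -
  have "measure_pmf.prob (replicate_pmf n q) E
      \<le> measure_pmf.prob (replicate_pmf n q) {xs. hd xs \<in> Y \<and> tl xs \<in> G \<and> sum_list xs = -1}"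
  proof (rule prob_le_if_rotates_into)
    show "length xs = n" if "xs \<in> E" for xs using Y[OF that] by (simp add: excursions_def)
    show "rotate r xs \<notin> E" if "xs \<in> E" "0 < r" "r < n" for xs r
      using rotate_not_excursion[of xs n r] that Y by blast
    show "\<exists>r. rotate r xs \<in> {xs. hd xs \<in> Y \<and> tl xs \<in> G \<and> sum_list xs = - 1}" if "xs \<in> E" for xs
      using Y[OF that] by (auto simp: sum_list_rotate excursions_def)
  qed
  also have "\<dots> \<le> c * measure_pmf.prob (replicate_pmf (n - 1) q) {ys \<in> G. - 1 - sum_list ys \<in> Y}"
    using prob_hd_tl_sum_le[OF c, of Y "n - 1" G "-1"] n by simp
  finally show ?thesis .
qed

text \<open>The cyclic lemma in the opposite direction. The level \<open>h\<close> makes the head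
  the only step of size at least \<open>h\<close>, so no other rotation of the list lies in the same
  event, while some rotation is an excursion.\<close>

lemma prob_excursions_ge:
  fixes h :: int
  assumes G: "\<And>ys. ys \<in> G \<Longrightarrow> length ys = n - 1 \<and> set ys \<subseteq> {..<h} \<and> - 1 - sum_list ys \<in> Y"
    and Y: "Y \<subseteq> {h..}"
    and c: "0 \<le> c" "\<And>y. y \<in> Y \<Longrightarrow> c \<le> pmf q y" and n: "0 < n"
  shows "c * measure_pmf.prob (replicate_pmf (n - 1) q) G \<le> measure_pmf.prob (replicate_pmf n q) (excursions n)"
proof -
  let ?E = "{xs. hd xs \<in> Y \<and> tl xs \<in> G \<and> sum_list xs = -1}"
  have "{ys \<in> G. - 1 - sum_list ys \<in> Y} = G" using G by auto
  then have "c * measure_pmf.prob (replicate_pmf (n - 1) q) G \<le> measure_pmf.prob (replicate_pmf n q) ?E"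
    using prob_hd_tl_sum_ge[OF c, of Y "n - 1" G "-1"] n by simp
  also have "\<dots> = measure_pmf.prob (replicate_pmf n q) {xs. length xs = n \<and> xs \<in> ?E}"
    by (rule prob_replicate_pmf_length[symmetric])
  also have "\<dots> \<le> measure_pmf.prob (replicate_pmf n q) (excursions n)"
  proof (rule prob_le_if_rotates_into)
    show "rotate r xs \<notin> {xs. length xs = n \<and> xs \<in> ?E}" if "xs \<in> {xs. length xs = n \<and> xs \<in> ?E}" "0 < r" "r < n" for xs r
    proof
      assume *: "rotate r xs \<in> {xs. length xs = n \<and> xs \<in> ?E}"
      have ne: "xs \<noteq> []" using that by auto
      have "hd (rotate r xs) = xs ! r" using hd_rotate_conv_nth[OF ne, of r] that by simp
      also have "\<dots> = tl xs ! (r - 1)" using that ne by (simp add: nth_tl)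
      also have "\<dots> \<in> set (tl xs)" using that by (intro nth_mem) auto
      finally have "hd (rotate r xs) < h" using G[of "tl xs"] that by auto
      then show False using * Y by auto
    qed
    show "\<exists>r. rotate r xs \<in> excursions n" if "xs \<in> {xs. length xs = n \<and> xs \<in> ?E}" for xs
      using ex_rotate_excursion[of xs n] that n by auto
  qed auto
  finally show ?thesis .
qed

section \<open>The scale of the walk\<close>

context cauchy_step begin

text \<open>\<open>x * T x\<close> is at most \<open>8 * rho x\<close>, and \<open>rho\<close> is
  negligible against \<open>D\<close>. This places \<open>B n\<close> above
  \<open>al n\<close>.\<close>

lemma D_ge_2_mult_T: "\<forall>\<^sub>F x in sequentially. 2 * (real x * T x) \<le> D x"
  using rho_le_D[of "1/16", simplified] T_le eventually_ge_at_top[of 1]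
proof eventually_elim
  case (elim x)
  have "real x * T x \<le> real x * (8 * rho x / real x)" using elim by (intro mult_left_mono) auto
  also have "\<dots> = 8 * rho x" using elim by simp
  finally show ?case using elim by (simp add: rho_nonneg)
qed

end

text \<open>The integers \<open>al n\<close> play the role of \<open>a\<^sub>n\<close>; then \<open>B n\<close> is \<open>|b\<^sub>n|\<close>, and \<open>be n\<close> is \<open>|b\<^sub>n|\<close> rounded up.\<close>

locale cauchy_scale = cauchy_step +
  fixes al :: "nat \<Rightarrow> nat"
  assumes nT: "(\<lambda>n. real n * T (al n)) \<longlonglongrightarrow> 1"
begin

definition B :: "nat \<Rightarrow> real" where "B n = real n * D (al n)"
definition be :: "nat \<Rightarrow> nat" where "be n = nat \<lceil>B n\<rceil>"

lemma al_at_top: "filterlim al at_top sequentially"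
  unfolding filterlim_at_top
proof
  fix N
  have "(\<lambda>n. real n * T (al n) * (1 / real n)) \<longlonglongrightarrow> 1 * 0"
    by (intro tendsto_mult nT lim_1_over_n)
  then have "\<forall>\<^sub>F n in sequentially. real n * T (al n) * (1 / real n) < T N"
    using T_pos[of N] by (intro order_tendstoD(2)) auto
  then show "\<forall>\<^sub>F n in sequentially. N \<le> al n"
    using eventually_gt_at_top[of 0]
  proof eventually_elim
    case (elim n)
    then have "T (al n) < T N" by simp
    then show ?case using T_antimono[of "al n" N] by (meson linear not_less)
  qed
qed

lemma eventually_al: "eventually P sequentially \<Longrightarrow> \<forall>\<^sub>F n in sequentially. P (al n)"
  using al_at_top by (rule eventually_compose_filterlim[rotated])

lemma eventually_nT: "\<forall>\<^sub>F n in sequentially. real n * T (al n) \<le> 2 \<and> 1/2 \<le> real n * T (al n)"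
  using order_tendstoD(1)[OF nT, of "1/2"] order_tendstoD(2)[OF nT, of 2]
  by (auto elim: eventually_elim2)

lemma B_ge_al: "\<forall>\<^sub>F n in sequentially. real (al n) \<le> B n"
  using eventually_al[OF D_ge_2_mult_T] eventually_nT
proof eventually_elim
  case (elim n)
  have "real (al n) * 1 \<le> real (al n) * (2 * (real n * T (al n)))" using elim by (intro mult_left_mono) auto
  also have "\<dots> = real n * (2 * (real (al n) * T (al n)))" by simp
  also have "\<dots> \<le> B n" unfolding B_def using elim by (intro mult_left_mono) auto
  finally show ?case by simp
qed

lemma B_at_top: "filterlim B at_top sequentially"
  using B_ge_al by (rule filterlim_at_top_mono[OF filterlim_compose[OF filterlim_real_sequentially al_at_top]])

lemma be_bounds: "\<forall>\<^sub>F n in sequentially. 8 \<le> B n \<and> B n \<le> real (be n) \<and> real (be n) \<le> 2 * B n \<and> al n \<le> be n"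
  using B_ge_al filterlim_at_top[THEN iffD1, OF B_at_top, rule_format, of 8]
proof eventually_elim
  case (elim n)
  have "real (be n) = of_int \<lceil>B n\<rceil>" using elim by (simp add: be_def)
  then have "B n \<le> real (be n)" "real (be n) \<le> B n + 1" by linarith+
  then show ?case using elim by linarith
qed

lemma be_at_top: "filterlim be at_top sequentially"
proof (rule filterlim_at_top_mono[OF al_at_top])
  show "\<forall>\<^sub>F n in sequentially. al n \<le> be n" using be_bounds by eventually_elim auto
qed

lemma eventually_be: "eventually P sequentially \<Longrightarrow> \<forall>\<^sub>F n in sequentially. P (be n)"
  using be_at_top by (rule eventually_compose_filterlim[rotated])

text \<open>The drift hardly depends on whether steps are cut off at \<open>al n\<close> or at
  \<open>be n\<close>. The difference is at most \<open>6 * sqrt (be n / al n) * rho (al n)\<close>.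
  As \<open>n * T (al n)\<close> is near 1, \<open>n * rho (al n)\<close> is at most
  \<open>24 * al n\<close>; so the square of the root times \<open>rho\<close> is at most
  \<open>48 * D * rho\<close> at \<open>al n\<close>, which \<open>rho_le_D\<close> makes small
  against the square of \<open>D\<close>.\<close>

lemma D_be:
  assumes e: "0 < e"
  shows "\<forall>\<^sub>F n in sequentially. 0 \<le> D (al n) - D (be n) \<and> D (al n) - D (be n) \<le> e * D (al n)"
proof -
  define e' where "e' = (e / 6)\<^sup>2 / 48"
  have e': "0 < e'" using e by (simp add: e'_def)
  show ?thesis
    using eventually_al[OF D_diff_le] eventually_al[OF rho_le_D[OF e']] eventually_al[OF T_ge]
      eventually_nT be_bounds eventually_al[OF eventually_ge_at_top[of 1]]
  proof eventually_elim
    case (elim n)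
    define a d where "a = real (al n)" and "d = D (al n)"
    have a: "0 < a" and d: "0 < d" using elim D_pos by (auto simp: a_def d_def)
    have "real n * (rho (al n) / (12 * a)) \<le> real n * T (al n)"
      using elim by (intro mult_left_mono) (auto simp: a_def)
    also have "\<dots> \<le> 2" using elim by simp
    finally have r24: "real n * rho (al n) \<le> 24 * a" using a by (simp add: field_simps)
    have "(sqrt (real (be n) / a) * rho (al n))\<^sup>2 = real (be n) * (rho (al n))\<^sup>2 / a"
      using a by (simp add: power_mult_distrib)
    also have "\<dots> \<le> 2 * B n * (rho (al n))\<^sup>2 / a"
      using elim a by (intro divide_right_mono mult_right_mono) auto
    also have "\<dots> = 2 * d * rho (al n) * (real n * rho (al n)) / a"
      by (simp add: B_def d_def power2_eq_square)
    also have "\<dots> \<le> 2 * d * rho (al n) * (24 * a) / a"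
      using r24 a d rho_nonneg by (intro divide_right_mono mult_left_mono) auto
    also have "\<dots> = 48 * d * rho (al n)" using a by simp
    also have "\<dots> \<le> 48 * d * (e' * d)" using elim d by (intro mult_left_mono) (auto simp: d_def)
    also have "\<dots> = (e / 6 * d)\<^sup>2" by (simp add: e'_def power2_eq_square)
    finally have "sqrt (real (be n) / a) * rho (al n) \<le> e / 6 * d"
      by (rule power2_le_imp_le) (use e d in simp)
    moreover have "D (al n) - D (be n) \<le> 6 * sqrt (real (be n) / a) * rho (al n)"
      using elim by (simp add: a_def)
    ultimately show ?case using D_antimono[of "al n" "be n"] elim by (simp add: d_def)
  qed
qed

text \<open>Since \<open>be n\<close> is at least \<open>n * D (al n)\<close>, the left side is at
  most \<open>rho (be n) / D (al n)\<close>. It controls both the expected number of jumps of order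
  \<open>be n\<close> and the variance of smaller steps on that scale.\<close>

lemma n_rho_be:
  assumes e: "0 < e"
  shows "\<forall>\<^sub>F n in sequentially. real n * rho (be n) / real (be n) \<le> e"
  using eventually_be[OF rho_le_D[OF e]] be_bounds eventually_gt_at_top[of 0]
proof eventually_elim
  case (elim n)
  have d: "0 < D (al n)" by (rule D_pos)
  have "real n * rho (be n) / real (be n) \<le> real n * rho (be n) / B n"
    using elim rho_nonneg by (intro divide_left_mono) auto
  also have "\<dots> = rho (be n) / D (al n)" using elim by (simp add: B_def)
  also have "\<dots> \<le> e * D (be n) / D (al n)" using elim d by (intro divide_right_mono) auto
  also have "\<dots> \<le> e * D (al n) / D (al n)"
    using elim e d D_antimono[of "al n" "be n"] by (intro divide_right_mono mult_left_mono) auto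
  finally show ?case using d by simp
qed

text \<open>The quarter prepares the lower bound for excursions: there the big jump is at least
  \<open>B n / 2\<close>, hence at least \<open>be n div 4\<close>, and all other steps are to stay
  below that level.\<close>

lemma n_T_be: "0 < e \<Longrightarrow> \<forall>\<^sub>F n in sequentially. real n * T (be n div 4) \<le> e"
proof -
  assume e: "0 < e"
  have "filterlim (\<lambda>n. n div 4) at_top (sequentially :: nat filter)"
    by (rule filterlim_at_top_div_const_nat) simp
  then have q4: "filterlim (\<lambda>n. be n div 4) at_top sequentially"
    using be_at_top by (rule filterlim_compose)
  have ev: "eventually P sequentially \<Longrightarrow> \<forall>\<^sub>F n in sequentially. P (be n div 4)" for P
    using q4 by (rule eventually_compose_filterlim[rotated])
  have "0 < e / 240" using e by simp
  from n_rho_be[OF this] show ?thesis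
    using ev[OF T_le] ev[OF potter] eventually_be[OF eventually_ge_at_top[of 16]]
  proof eventually_elim
    case (elim n)
    define x where "x = be n div 4"
    have x: "1 \<le> x" "x \<le> be n" "real (be n) \<le> 5 * real x"
      using elim by (auto simp: x_def)
    have "real (be n) / real x \<le> 5" using x by (simp add: divide_le_eq)
    then have s: "sqrt (real (be n) / real x) \<le> 3" by (intro real_le_lsqrt) auto
    have "rho x \<le> 2 * sqrt (real (be n) / real x) * rho (be n)" using elim x by (auto simp: x_def)
    also have "\<dots> \<le> 2 * 3 * rho (be n)" using s rho_nonneg by (intro mult_right_mono mult_left_mono) auto
    finally have r: "rho x \<le> 6 * rho (be n)" by simp
    have "real n * T x \<le> real n * (8 * rho x / real x)"
      using elim by (intro mult_left_mono) (auto simp: x_def)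
    also have "\<dots> \<le> real n * (8 * (6 * rho (be n)) / (real (be n) / 5))"
      using r x rho_nonneg by (intro mult_left_mono frac_le) auto
    also have "\<dots> = 240 * (real n * rho (be n) / real (be n))" by simp
    also have "\<dots> \<le> 240 * (e / 240)" using elim by (intro mult_left_mono) auto
    finally show ?case by (simp add: x_def)
  qed
qed

text \<open>Steps are cut off at \<open>be n\<close>, not at \<open>al n\<close>: no step is likely
  to exceed this level, yet \<open>V_le\<close> and \<open>n_rho_be\<close> still make the variance
  of the sum small against \<open>B n ^ 2\<close>, and by \<open>D_be\<close> the drift is still the
  right one.\<close>

lemma prob_not_near_line:
  assumes e: "0 < e" and h: "0 < h"
  shows "\<forall>\<^sub>F n in sequentially.
    measure_pmf.prob (replicate_pmf (n - 1) q) (- near_line n (B n) e) \<le> h"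
proof -
  obtain C where C: "0 < C" "\<forall>\<^sub>F x in sequentially. V x \<le> C * (real x * rho x)" using V_le by blast
  define d where "d = h * e\<^sup>2 / (32 * C)"
  have d: "0 < d" using e h C by (simp add: d_def)
  have e4: "0 < e / 4" "0 < h / 2" using e h by auto
  show ?thesis
    using D_be[OF e4(1)] n_rho_be[OF d] n_T_be[OF e4(2)] eventually_be[OF C(2)] be_bounds eventually_gt_at_top[of 0]
  proof eventually_elim
    case (elim n)
    let ?P = "measure_pmf.prob (replicate_pmf (n - 1) q)"
    define x where "x = be n"
    \<comment> \<open>The truncated step has mean \<open>- D x\<close>, so adding \<open>D x\<close>
      centres it.\<close>
    define g where "g = (\<lambda>k::int. real_of_int k * indicator {..<int x} k + D x)"
    have Bn: "B n = real n * D (al n)" "0 < B n" using elim by (auto simp: B_def)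
    have int1: "integrable (measure_pmf q) (\<lambda>k. real_of_int k * indicator {..<int x} k)"
      by (rule integrable_below)
    have int2: "integrable (measure_pmf q) (\<lambda>k. (real_of_int k)\<^sup>2 * indicator {..<int x} k)"
      by (rule integrable_below)
    have g2: "(g k)\<^sup>2 = (real_of_int k)\<^sup>2 * indicator {..<int x} k
        + 2 * D x * (real_of_int k * indicator {..<int x} k) + (D x)\<^sup>2" for k
      by (auto simp: g_def indicator_def power2_sum)
    have ig: "integrable (measure_pmf q) g" unfolding g_def using int1 by simp
    have ig2: "integrable (measure_pmf q) (\<lambda>k. (g k)\<^sup>2)" unfolding g2
      by (intro Bochner_Integration.integrable_add integrable_mult_right int1 int2) auto
    have mg: "measure_pmf.expectation q g = 0"
      unfolding g_def using int1 expectation_below[of x] by simp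
    have "measure_pmf.expectation q (\<lambda>k. (g k)\<^sup>2) = V x + 2 * D x * (- D x) + (D x)\<^sup>2"
      unfolding g2 using int1 int2 expectation_below[of x] by (simp add: V_def)
    also have "\<dots> \<le> V x" by (simp add: power2_eq_square)
    finally have vg: "measure_pmf.expectation q (\<lambda>k. (g k)\<^sup>2) \<le> V x" .
    define A where "A = {ys. \<exists>k\<le>length ys. e * B n / 2 \<le> \<bar>0 + sum_list (map g (take k ys))\<bar>}"
    have "?P A \<le> (0\<^sup>2 + real (n - 1) * measure_pmf.expectation q (\<lambda>k. (g k)\<^sup>2)) / (e * B n / 2)\<^sup>2"
      unfolding A_def using e Bn by (intro kolmogorov_maximal ig ig2 mg) auto
    also have "\<dots> \<le> (0\<^sup>2 + real n * V x) / (e * B n / 2)\<^sup>2"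
      using vg V_nonneg by (intro divide_right_mono add_left_mono mult_mono) auto
    also have "\<dots> \<le> (0\<^sup>2 + real n * (C * (real x * rho x))) / (e * B n / 2)\<^sup>2"
      using elim by (intro divide_right_mono add_left_mono mult_left_mono) (auto simp: x_def)
    also have "\<dots> = 4 * C / e\<^sup>2 * (real n * rho x / real x) * (real x / B n)\<^sup>2"
    proof -
      have "B n \<noteq> 0" "e \<noteq> 0" "real x \<noteq> 0" using elim e by (auto simp: x_def)
      then show ?thesis by (simp add: field_simps power2_eq_square)
    qed
    also have "\<dots> \<le> 4 * C / e\<^sup>2 * d * 2\<^sup>2"
    proof (intro mult_mono power_mono)
      show "real x / B n \<le> 2" using elim Bn by (simp add: x_def divide_le_eq)
    qed (use elim C d e Bn rho_nonneg in \<open>auto simp: x_def\<close>)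
    also have "\<dots> = h / 2" using e C by (simp add: d_def)
    finally have PA: "?P A \<le> h / 2" .
    have "?P {ys. \<not> set ys \<subseteq> {..<int x}} \<le> real (n - 1) * measure_pmf.prob q (- {..<int x})"
      by (rule prob_not_all_le)
    also have "\<dots> \<le> real n * T x"
      unfolding T_def by (intro mult_mono measure_pmf.finite_measure_mono) auto
    also have "\<dots> \<le> real n * T (be n div 4)"
      by (intro mult_left_mono T_antimono) (auto simp: x_def)
    also have "\<dots> \<le> h / 2" using elim by simp
    finally have PN: "?P {ys. \<not> set ys \<subseteq> {..<int x}} \<le> h / 2" .
    have sub: "- near_line n (B n) e \<inter> set_pmf (replicate_pmf (n - 1) q) \<subseteq> A \<union> {ys. \<not> set ys \<subseteq> {..<int x}}"
    proof
      fix ys assume ys: "ys \<in> - near_line n (B n) e \<inter> set_pmf (replicate_pmf (n - 1) q)"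
      then have len: "length ys = n - 1" by (simp add: set_replicate_pmf)
      from ys obtain k where k: "k \<le> length ys"
        "e * B n < \<bar>real_of_int (sum_list (take k ys)) + real k * B n / real n\<bar>"
        by (auto simp: near_line_def not_le)
      show "ys \<in> A \<union> {ys. \<not> set ys \<subseteq> {..<int x}}"
      proof (cases "set ys \<subseteq> {..<int x}")
        case True
        have gs: "sum_list (map g zs) = real_of_int (sum_list zs) + real (length zs) * D x"
          if "set zs \<subseteq> {..<int x}" for zs
          using that by (induction zs) (auto simp: g_def algebra_simps)
        have "set (take k ys) \<subseteq> {..<int x}" using True set_take_subset[of k ys] by blast
        from gs[OF this] have s: "sum_list (map g (take k ys)) = real_of_int (sum_list (take k ys)) + real k * D x"
          using k by simp
        have kB: "real k * B n / real n = real k * D (al n)" using elim by (simp add: Bn)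
        \<comment> \<open>The two drifts differ by at most \<open>e * B n / 4\<close> over the whole
          walk, so leaving the strip of width \<open>e * B n\<close> takes the centred walk beyond
          \<open>e * B n / 2\<close>.\<close>
        have "real k * (D (al n) - D x) \<le> real n * (e / 4 * D (al n))"
          using elim k len by (intro mult_mono) (auto simp: x_def)
        also have "\<dots> = e * B n / 4" by (simp add: Bn)
        finally have "real k * D (al n) - real k * D x \<le> e * B n / 4" by (simp add: right_diff_distrib)
        moreover have "0 \<le> real k * (D (al n) - D x)" using elim by (intro mult_nonneg_nonneg) (auto simp: x_def)
        then have "0 \<le> real k * D (al n) - real k * D x" by (simp add: right_diff_distrib)
        moreover have "p / 2 \<le> \<bar>0 + (s + b)\<bar>"
          if "p < \<bar>s + a\<bar>" "a - b \<le> p / 4" "0 \<le> a - b" for p s a b :: real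
          using that by linarith
        ultimately have "e * B n / 2 \<le> \<bar>0 + sum_list (map g (take k ys))\<bar>"
          using k(2) unfolding s kB by blast
        then show ?thesis using k(1) by (auto simp: A_def)
      qed auto
    qed
    have "?P (- near_line n (B n) e) = ?P (- near_line n (B n) e \<inter> set_pmf (replicate_pmf (n - 1) q))"
      by (simp add: measure_Int_set_pmf)
    also have "\<dots> \<le> ?P (A \<union> {ys. \<not> set ys \<subseteq> {..<int x}})"
      using sub by (rule measure_pmf.finite_measure_mono) simp
    also have "\<dots> \<le> ?P A + ?P {ys. \<not> set ys \<subseteq> {..<int x}}"
      by (intro measure_Un_le) auto
    also have "\<dots> \<le> h" using PA PN by simp
    finally show ?case .
  qed
qed

end

section \<open>Excursions have one big jump\<close>

text \<open>The cube comes from \<open>pmf_potter\<close>. The extra factor \<open>1 / y\<close> on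
  the right is what makes the sum over dyadic jump sizes small.\<close>

lemma pow3_exp_le:
  assumes y: "0 < (y::real)"
  shows "y ^ 3 * exp (- y / 16) \<le> 64 ^ 4 / y"
proof -
  have "y / 64 \<le> exp (y / 64)" using exp_ge_add_one_self[of "y / 64"] by linarith
  then have "(y / 64) ^ 4 \<le> exp (y / 64) ^ 4" using y by (intro power_mono) auto
  also have "\<dots> = exp (y / 16)" by (simp flip: exp_of_nat_mult)
  finally have "y ^ 4 \<le> 64 ^ 4 * exp (y / 16)" by (simp add: power_divide)
  then have "y ^ 4 * exp (- y / 16) \<le> 64 ^ 4 * exp (y / 16) * exp (- y / 16)" by (intro mult_right_mono) auto
  also have "\<dots> = 64 ^ 4" by (simp add: exp_minus)
  finally have "y * (y ^ 3 * exp (- y / 16)) \<le> 64 ^ 4" by (simp add: eval_nat_numeral mult_ac)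
  then show ?thesis using y by (simp add: le_divide_eq mult.commute)
qed

lemma exp_le_quadratic:
  assumes "-1 \<le> x" "x \<le> (1::real)"
  shows "exp x \<le> 1 + x + x\<^sup>2"
proof (cases "0 \<le> x")
  case False
  have "exp x = inverse (exp (- x))" by (simp add: exp_minus)
  also have "\<dots> \<le> inverse (1 + (- x) + (- x)\<^sup>2 / 2)"
    using exp_lower_Taylor_quadratic[of "- x"] False by (intro le_imp_inverse_le) (auto intro: add_pos_nonneg)
  also have "\<dots> \<le> 1 + x + x\<^sup>2"
  proof -
    have p: "0 < 1 - x + x\<^sup>2 / 2" using False by (intro add_pos_nonneg) auto
    have "0 \<le> x\<^sup>2 * ((1 - x + x\<^sup>2) / 2)"
      using False by (intro mult_nonneg_nonneg) auto
    also have "\<dots> = (1 + x + x\<^sup>2) * (1 - x + x\<^sup>2 / 2) - 1" by (simp add: field_simps power2_eq_square)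
    finally have "1 \<le> (1 + x + x\<^sup>2) * (1 - x + x\<^sup>2 / 2)" by (simp only: diff_ge_0_iff_ge)
    then have "1 / (1 - x + x\<^sup>2 / 2) \<le> 1 + x + x\<^sup>2" by (simp only: pos_divide_le_eq[OF p])
    then show ?thesis by (simp add: inverse_eq_divide)
  qed
  finally show ?thesis .
qed (use assms exp_bound in auto)

context cauchy_step begin

text \<open>For \<open>-1 <= k < u\<close> the quotient \<open>k / u\<close> lies in [-1, 1], where
  the exponential has a quadratic bound. Its linear term gives \<open>- D u / u\<close>; the
  quadratic term gives back at most half of this, because \<open>V u\<close> is at most
  \<open>C * u * rho u\<close> and \<open>rho\<close> is negligible against
  \<open>D\<close>.\<close>

lemma nn_integral_exp_below:
  "\<forall>\<^sub>F u in sequentially. (\<integral>\<^sup>+k. ennreal (exp (1 / real u * real_of_int k)) * indicator {..<int u} k \<partial>measure_pmf q)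
     \<le> ennreal (1 - D u / (2 * real u))"
proof -
  obtain C where C: "0 < C" "\<forall>\<^sub>F x in sequentially. V x \<le> C * (real x * rho x)" using V_le by blast
  have c: "0 < 1 / (2 * C)" using C by simp
  show ?thesis
    using C(2) rho_le_D[OF c] eventually_ge_at_top[of 1]
  proof eventually_elim
    case (elim u)
    then have u: "1 \<le> real u" by simp
    define f where "f = (\<lambda>k::int. indicator {..<int u} k + 1 / real u * (real_of_int k * indicator {..<int u} k)
        + 1 / (real u)\<^sup>2 * ((real_of_int k)\<^sup>2 * indicator {..<int u} k))"
    have int0: "integrable (measure_pmf q) (indicator {..<int u} :: int \<Rightarrow> real)"
      by (simp add: integrable_indicator_iff measure_pmf.emeasure_eq_measure)
    have int1: "integrable (measure_pmf q) (\<lambda>k. real_of_int k * indicator {..<int u} k)" by (rule integrable_below)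
    have int2: "integrable (measure_pmf q) (\<lambda>k. (real_of_int k)\<^sup>2 * indicator {..<int u} k)" by (rule integrable_below)
    have intf: "integrable (measure_pmf q) f" unfolding f_def
      by (intro Bochner_Integration.integrable_add integrable_mult_right int0 int1 int2)
    have f0: "0 \<le> f k" for k
    proof -
      have "0 \<le> 1 + z + z\<^sup>2" for z :: real
      proof -
        have "1 + z + z\<^sup>2 = (z + 1/2)\<^sup>2 + 3/4" by (simp add: power2_eq_square algebra_simps)
        then show ?thesis by (simp add: add_nonneg_nonneg)
      qed
      from this[of "real_of_int k / real u"] show ?thesis
        by (simp add: f_def indicator_def power_divide)
    qed
    have "(\<integral>\<^sup>+k. ennreal (exp (1 / real u * real_of_int k)) * indicator {..<int u} k \<partial>measure_pmf q)
      \<le> (\<integral>\<^sup>+k. ennreal (f k) \<partial>measure_pmf q)"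
    proof (rule nn_integral_mono_AE)
      show "AE k in measure_pmf q. ennreal (exp (1 / real u * real_of_int k)) * indicator {..<int u} k \<le> ennreal (f k)"
        using AE_ge
      proof eventually_elim
        case (elim k)
        show ?case
        proof (cases "k < int u")
          case True
          have "-1 \<le> real_of_int k / real u" "real_of_int k / real u \<le> 1"
            using True elim u by (auto simp: le_divide_eq divide_le_eq)
          from exp_le_quadratic[OF this] show ?thesis
            using True by (simp add: f_def power_divide ennreal_leI)
        qed simp
      qed
    qed
    also have "\<dots> = ennreal (measure_pmf.expectation q f)"
      using intf f0 by (intro nn_integral_eq_integral) auto
    also have "measure_pmf.expectation q f
        = measure_pmf.prob q {..<int u} + 1 / real u * (- D u) + 1 / (real u)\<^sup>2 * V u"
      unfolding f_def using int0 int1 int2 expectation_below[of u] by (simp add: V_def)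
    also have "\<dots> \<le> 1 + 1 / real u * (- D u) + 1 / (real u)\<^sup>2 * (C * (real u * (1 / (2 * C) * D u)))"
    proof -
      have "V u \<le> C * (real u * (1 / (2 * C) * D u))"
        using elim C(1) by (elim order_trans) (intro mult_left_mono, auto)
      then have "1 / (real u)\<^sup>2 * V u \<le> 1 / (real u)\<^sup>2 * (C * (real u * (1 / (2 * C) * D u)))"
        by (rule mult_left_mono) simp
      then show ?thesis using measure_pmf.prob_le_1[of q "{..<int u}"] by linarith
    qed
    also have "\<dots> = 1 - D u / (2 * real u)" using u C(1) by (simp add: field_simps power2_eq_square)
    finally show ?case by (simp add: ennreal_leI)
  qed
qed

end

context cauchy_scale begin

text \<open>Chernoff bound at scale \<open>1 / (2 v)\<close>: a bridge whose largest jump is of order \<open>v\<close>, far below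
  the scale \<open>be n\<close>, has to fight against a drift of order \<open>be n\<close>.\<close>

lemma prob_excursion_level:
  "\<exists>z. \<forall>\<^sub>F n in sequentially. \<forall>v. z \<le> v \<and> 2 * v \<le> be n \<longrightarrow>
     measure_pmf.prob (replicate_pmf n q)
       {xs \<in> excursions n. (\<exists>x\<in>set xs. int v \<le> x) \<and> set xs \<subseteq> {..<int (2 * v)}}
     \<le> (4 * 9 * 64 ^ 4 * 8) * (real (2 * v) / real (be n)) * pmf q (int (be n))"
proof -
  obtain z where z: "\<And>u. z \<le> u \<Longrightarrow> (\<integral>\<^sup>+k. ennreal (exp (1 / real u * real_of_int k)) * indicator {..<int u} k \<partial>measure_pmf q)
     \<le> ennreal (1 - D u / (2 * real u))"
    "\<And>x. z \<le> x \<Longrightarrow> 1 \<le> x \<and> 0 < pmf q (int x) \<and> (\<forall>y\<ge>x. pmf q (int y) \<le> 2 * pmf q (int x)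
      \<and> pmf q (int x) \<le> 2 * (real y / real x) ^ 3 * pmf q (int y))"
    "\<And>u. z \<le> u \<Longrightarrow> D u \<le> 2 * real u"
  proof -
    \<comment> \<open>This keeps \<open>1 - D u / (2 * u)\<close> nonnegative, as required of the
      moment bound and for taking its powers.\<close>
    have "\<forall>\<^sub>F u in sequentially. D u \<le> 2 * real u"
      using eventually_ge_at_top[of "nat \<lceil>D 0\<rceil>"]
    proof eventually_elim
      case (elim u)
      then have "D 0 \<le> real u" by linarith
      then show ?case using D_antimono[of 0 u] by simp
    qed
    with nn_integral_exp_below pmf_potter
    have "\<forall>\<^sub>F u in sequentially. (\<integral>\<^sup>+k. ennreal (exp (1 / real u * real_of_int k)) * indicator {..<int u} k \<partial>measure_pmf q)
     \<le> ennreal (1 - D u / (2 * real u)) \<and> (1 \<le> u \<and> 0 < pmf q (int u) \<and> (\<forall>y\<ge>u. pmf q (int y) \<le> 2 * pmf q (int u)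
      \<and> pmf q (int u) \<le> 2 * (real y / real u) ^ 3 * pmf q (int y))) \<and> D u \<le> 2 * real u"
      by eventually_elim blast
    then show thesis using that unfolding eventually_sequentially by blast
  qed
  have half: "0 < (1/2 :: real)" by simp
  have "\<forall>\<^sub>F n in sequentially. \<forall>v. z \<le> v \<and> 2 * v \<le> be n \<longrightarrow>
     measure_pmf.prob (replicate_pmf n q)
       {xs \<in> excursions n. (\<exists>x\<in>set xs. int v \<le> x) \<and> set xs \<subseteq> {..<int (2 * v)}}
     \<le> (4 * 9 * 64 ^ 4 * 8) * (real (2 * v) / real (be n)) * pmf q (int (be n))"
    using D_be[OF half] be_bounds eventually_ge_at_top[of 2]
  proof eventually_elim
    case (elim n)
    show ?case
    proof (intro allI impI)
      fix v assume v: "z \<le> v \<and> 2 * v \<le> be n"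
      define u where "u = 2 * v"
      define y where "y = real (be n) / real u"
      define p where "p = pmf q (int (be n))"
      have v1: "1 \<le> v" using z(2)[of v] v by simp
      have u: "z \<le> u" "u \<le> be n" "1 \<le> real u" using v v1 by (auto simp: u_def)
      have y: "1 \<le> y" using u by (simp add: y_def)
      have p0: "0 \<le> p" by (simp add: p_def)
      let ?E = "{xs \<in> excursions n. (\<exists>x\<in>set xs. int v \<le> x) \<and> set xs \<subseteq> {..<int u}}"
      let ?Y = "{int v..<int u}" and ?G = "{ys. set ys \<subseteq> {..<int u}}"
      let ?R = "replicate_pmf (n - 1) q"
      have "measure_pmf.prob (replicate_pmf n q) ?E
        \<le> (2 * pmf q (int v)) * measure_pmf.prob ?R {ys \<in> ?G. - 1 - sum_list ys \<in> ?Y}"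
      proof (rule prob_excursion_jump_le)
        fix xs assume xs: "xs \<in> ?E"
        then obtain x where x: "x \<in> set xs" "int v \<le> x" by auto
        obtain j where j: "j < length xs" "hd (rotate j xs) = x" using x(1) by (rule rotate_hd)
        have len: "length xs = n" using xs by (simp add: excursions_def)
        have "set (tl (rotate j xs)) \<subseteq> set xs"
          by (metis list.set_sel(2) set_rotate subsetI tl_Nil)
        then show "xs \<in> excursions n \<and> (\<exists>j<n. hd (rotate j xs) \<in> ?Y \<and> tl (rotate j xs) \<in> ?G)"
          using xs x j len by (auto intro!: exI[of _ j])
      next
        fix k assume k: "k \<in> ?Y"
        then have "int (nat k) = k" "v \<le> nat k" by auto
        then show "pmf q k \<le> 2 * pmf q (int v)" using z(2)[of v] v by metis
      qed (use elim in auto)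
      \<comment> \<open>\<open>be n / v\<close> equals \<open>2 * y\<close>: comparing the mass at
        \<open>v\<close> with the mass at \<open>be n\<close> costs its cube, and the Chernoff bound
        has to win it back.\<close>
      also have "\<dots> \<le> (2 * (2 * (2 * y) ^ 3 * p)) * (9 * exp (- y / 16))"
      proof (intro mult_mono)
        show "pmf q (int v) \<le> 2 * (2 * y) ^ 3 * p"
          using z(2)[of v] v v1 unfolding y_def u_def p_def by simp
        \<comment> \<open>The head is below \<open>u\<close> and the total is -1, so the remaining
          steps cannot fall below \<open>- (u + 1)\<close>, although their drift pulls them much
          lower.\<close>
        have "measure_pmf.prob ?R {ys \<in> ?G. - 1 - sum_list ys \<in> ?Y}
          \<le> measure_pmf.prob ?R {ys. set ys \<subseteq> {..<int u} \<and> - (real u + 1) \<le> real_of_int (sum_list ys)}"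
          by (rule measure_pmf.finite_measure_mono) auto
        also have "\<dots> \<le> exp (- (1 / real u) * (- (real u + 1))) * (1 - D u / (2 * real u)) ^ (n - 1)"
          using z(1)[OF u(1)] z(3)[OF u(1)] u(3) by (intro prob_sum_list_ge_le) (auto simp: divide_le_eq)
        also have "\<dots> \<le> 9 * exp (- y / 16)"
        proof (intro mult_mono)
          have "- (1 / real u) * (- (real u + 1)) \<le> 2" using u(3) by (simp add: field_simps)
          then have "exp (- (1 / real u) * (- (real u + 1))) \<le> exp 1 * exp 1"
            by (simp flip: exp_add)
          also have "\<dots> \<le> 3 * 3" using exp_le by (intro mult_mono) auto
          finally show "exp (- (1 / real u) * (- (real u + 1))) \<le> 9" by simp
          have D1: "D u / (2 * real u) \<le> 1" using z(3)[OF u(1)] u(3) by (simp add: divide_le_eq)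
          have "1 - D u / (2 * real u) \<le> exp (- (D u / (2 * real u)))"
            using exp_ge_add_one_self[of "- (D u / (2 * real u))"] by simp
          then have "(1 - D u / (2 * real u)) ^ (n - 1) \<le> exp (- (D u / (2 * real u))) ^ (n - 1)"
            using D1 by (intro power_mono) auto
          also have "\<dots> = exp (- (real (n - 1) * (D u / (2 * real u))))"
            by (simp flip: exp_of_nat_mult)
          also have "\<dots> \<le> exp (- y / 16)"
          proof -
            \<comment> \<open>The 16 collects four halves: \<open>n - 1\<close> against
              \<open>n\<close>, \<open>D u\<close> against \<open>D (al n)\<close>, the 2 in
              \<open>2 * u\<close>, and \<open>B n\<close> against \<open>be n\<close>.\<close>
            have n2: "real n / 2 \<le> real (n - 1)" using elim by (simp add: of_nat_diff)
            have Du: "D (al n) / 2 \<le> D u" using D_antimono[OF u(2)] elim by simp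
            have "y / 16 \<le> B n / (8 * real u)"
              using elim u(3) unfolding y_def by (simp add: field_simps)
            also have "\<dots> = real n / 2 * ((D (al n) / 2) / (2 * real u))" by (simp add: B_def)
            also have "\<dots> \<le> real (n - 1) * (D u / (2 * real u))"
              using n2 Du u(3) D_nonneg by (intro mult_mono divide_right_mono) auto
            finally show ?thesis by simp
          qed
          finally show "(1 - D u / (2 * real u)) ^ (n - 1) \<le> exp (- y / 16)" .
        qed (use z(3)[OF u(1)] u(3) in \<open>auto simp: divide_le_eq\<close>)
        finally show "measure_pmf.prob ?R {ys \<in> ?G. - 1 - sum_list ys \<in> ?Y} \<le> 9 * exp (- y / 16)" .
      qed (use p0 y in auto)
      also have "\<dots> = 4 * 9 * 8 * (y ^ 3 * exp (- y / 16)) * p" by (simp add: power_mult_distrib)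
      also have "\<dots> \<le> 4 * 9 * 8 * (64 ^ 4 / y) * p"
        using pow3_exp_le[of y] y p0 by (intro mult_right_mono mult_left_mono) auto
      also have "\<dots> = (4 * 9 * 64 ^ 4 * 8) * (real (2 * v) / real (be n)) * pmf q (int (be n))"
        by (simp add: y_def p_def u_def)
      finally show "measure_pmf.prob (replicate_pmf n q)
         {xs \<in> excursions n. (\<exists>x\<in>set xs. int v \<le> x) \<and> set xs \<subseteq> {..<int (2 * v)}}
       \<le> (4 * 9 * 64 ^ 4 * 8) * (real (2 * v) / real (be n)) * pmf q (int (be n))"
        unfolding u_def .
    qed
  qed
  then show ?thesis by blast
qed

text \<open>With probability at least 1/2 the other steps stay below \<open>be n div 4\<close> and
  near the line. The head they prescribe then lies between \<open>be n div 4\<close> and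
  \<open>2 * be n\<close>, where every value has at least a sixteenth of the mass at
  \<open>be n\<close>.\<close>

lemma prob_excursions_lower:
  "\<forall>\<^sub>F n in sequentially. pmf q (int (be n)) / 32 \<le> measure_pmf.prob (replicate_pmf n q) (excursions n)
     \<and> 0 < pmf q (int (be n))"
proof -
  obtain z where z: "\<And>x. z \<le> x \<Longrightarrow> 1 \<le> x \<and> 0 < pmf q (int x) \<and> (\<forall>y\<ge>x. pmf q (int y) \<le> 2 * pmf q (int x)
      \<and> pmf q (int x) \<le> 2 * (real y / real x) ^ 3 * pmf q (int y))"
    using pmf_potter unfolding eventually_sequentially by blast
  have q4: "0 < (1/4 :: real)" by simp
  show ?thesis
    using prob_not_near_line[OF q4 q4] n_T_be[OF q4] be_bounds eventually_be[OF eventually_ge_at_top[of "4 * z + 4"]]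
      eventually_ge_at_top[of 8]
  proof eventually_elim
    case (elim n)
    define x where "x = be n div 4"
    have x: "z \<le> x" "4 * x \<le> be n" "1 \<le> x" "z \<le> be n" using elim by (auto simp: x_def)
    define p where "p = pmf q (int (be n))"
    have p: "0 < p" using z[OF x(4)] by (simp add: p_def)
    define G where "G = {ys. length ys = n - 1 \<and> set ys \<subseteq> {..<int x} \<and> ys \<in> near_line n (B n) (1/4)}"
    let ?P = "measure_pmf.prob (replicate_pmf (n - 1) q)"
    have "p / 16 * ?P G \<le> measure_pmf.prob (replicate_pmf n q) (excursions n)"
    proof (rule prob_excursions_ge[where h = "int x" and Y = "{int x..int (2 * be n)}"])
      fix ys assume ys: "ys \<in> G"
      have "\<bar>real_of_int (sum_list ys) + real (n - 1) * B n / real n\<bar> \<le> 1/4 * B n"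
        using ys by (auto simp: G_def near_line_def)
      moreover have "real (n - 1) * B n / real n = B n - B n / real n"
        using elim by (simp add: of_nat_diff field_simps)
      moreover have "B n / real n \<le> B n / 8" by (rule divide_left_mono) (use elim in auto)
      moreover have "0 \<le> B n / real n" using elim by simp
      moreover have "8 \<le> B n" using elim by simp
      moreover have "b / 2 \<le> - 1 - s \<and> - 1 - s \<le> 2 * b"
        if "\<bar>s + y\<bar> \<le> 1/4 * b" "y = b - w" "w \<le> b / 8" "0 \<le> w" "8 \<le> b" for s y b w :: real
        using that by linarith
      ultimately have "B n / 2 \<le> - 1 - real_of_int (sum_list ys) \<and> - 1 - real_of_int (sum_list ys) \<le> 2 * B n"
        by blast
      then have "B n / 2 \<le> real_of_int (- 1 - sum_list ys)" "real_of_int (- 1 - sum_list ys) \<le> 2 * B n"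
        by simp_all
      moreover have "real (4 * x) \<le> real (be n)" using x(2) by (rule of_nat_mono)
      then have "4 * real x \<le> real (be n)" by simp
      ultimately have "real x \<le> real_of_int (- 1 - sum_list ys)" "real_of_int (- 1 - sum_list ys) \<le> 2 * real (be n)"
        using elim by linarith+
      then have "int x \<le> - 1 - sum_list ys" "- 1 - sum_list ys \<le> int (2 * be n)" by linarith+
      then show "length ys = n - 1 \<and> set ys \<subseteq> {..<int x} \<and> - 1 - sum_list ys \<in> {int x..int (2 * be n)}"
        using ys by (simp add: G_def)
    next
      fix k assume k: "k \<in> {int x..int (2 * be n)}"
      define m where "m = nat k"
      have m: "k = int m" "x \<le> m" "m \<le> 2 * be n" using k by (auto simp: m_def)
      have "p \<le> 16 * pmf q (int m)"
      proof (cases "m \<le> be n")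
        case True
        then have "p \<le> 2 * pmf q (int m)" using z[of m] x m by (simp add: p_def)
        then show ?thesis using pmf_nonneg[of q "int m"] by linarith
      next
        case False
        then have "p \<le> 2 * (real m / real (be n)) ^ 3 * pmf q (int m)" using z[OF x(4)] by (simp add: p_def)
        also have "\<dots> \<le> 2 * 2 ^ 3 * pmf q (int m)"
        proof (intro mult_right_mono mult_left_mono power_mono)
          have "real m \<le> 2 * real (be n)" using m by linarith
          then show "real m / real (be n) \<le> 2" using elim x by (simp add: divide_le_eq)
        qed auto
        finally show ?thesis by simp
      qed
      then show "p / 16 \<le> pmf q k" by (simp add: m(1))
    qed (use p elim in auto)
    moreover have "1/2 \<le> ?P G"
    proof -
      have "?P (- G) = ?P {ys. length ys = n - 1 \<and> ys \<in> - G}"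
        by (rule prob_replicate_pmf_length[symmetric])
      also have "\<dots> \<le> ?P (- near_line n (B n) (1/4) \<union> {ys. \<not> set ys \<subseteq> {..<int x}})"
        by (rule measure_pmf.finite_measure_mono) (auto simp: G_def)
      also have "\<dots> \<le> ?P (- near_line n (B n) (1/4)) + ?P {ys. \<not> set ys \<subseteq> {..<int x}}"
        by (intro measure_Un_le) auto
      also have "?P {ys. \<not> set ys \<subseteq> {..<int x}} \<le> real (n - 1) * measure_pmf.prob q (- {..<int x})"
        by (rule prob_not_all_le)
      also have "real (n - 1) * measure_pmf.prob q (- {..<int x}) \<le> real n * T x"
        unfolding T_def by (intro mult_mono measure_pmf.finite_measure_mono) auto
      also have "?P (- near_line n (B n) (1/4)) + real n * T x \<le> 1/4 + 1/4"
        using elim by (intro add_mono) (auto simp: x_def)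
      finally have "?P (- G) \<le> 1/2" by simp
      moreover have "?P (- G) = 1 - ?P G"
        using measure_pmf.prob_compl[of G "replicate_pmf (n - 1) q"] by (simp add: Compl_eq_Diff_UNIV)
      ultimately show ?thesis by simp
    qed
    then have "p / 16 * (1/2) \<le> p / 16 * ?P G" using p by (intro mult_left_mono) auto
    ultimately have "p / 32 \<le> measure_pmf.prob (replicate_pmf n q) (excursions n)" by linarith
    then show ?case using p by (simp add: p_def)
  qed
qed

end

lemma power_times_pow3_tendsto_0:
  fixes x :: real
  assumes x: "0 \<le> x" "x < 1"
  shows "(\<lambda>n. real n ^ 3 * x ^ n) \<longlonglongrightarrow> 0"
proof -
  define y where "y = root 3 x"
  have y: "0 \<le> y" "y < 1" "x = y ^ 3" using x by (auto simp: y_def real_root_pos_pos_le)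
  have "(\<lambda>n. real n * y ^ n) \<longlonglongrightarrow> 0" using y by (intro powser_times_n_limit_0) auto
  then have "(\<lambda>n. (real n * y ^ n) ^ 3) \<longlonglongrightarrow> 0 ^ 3" by (intro tendsto_power)
  then show ?thesis by (simp add: y(3) power_mult_distrib power_mult[symmetric] mult.commute)
qed

lemma sum_powers_of_2_le:
  fixes R :: real
  assumes S: "finite S" "\<And>k. k \<in> S \<Longrightarrow> 2 ^ Suc k \<le> R" and R: "0 \<le> R"
  shows "(\<Sum>k\<in>S. 2 ^ Suc k) \<le> 2 * R"
proof (cases "S = {}")
  case False
  define m where "m = Max S"
  have m: "m \<in> S" "S \<subseteq> {..m}" using S False by (auto simp: m_def)
  have "(\<Sum>k\<in>S. (2::real) ^ Suc k) \<le> (\<Sum>k\<le>m. 2 ^ Suc k)"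
    using m by (intro sum_mono2) auto
  also have "(\<Sum>k\<le>m. (2::real) ^ Suc k) \<le> 2 * 2 ^ Suc m" by (induction m) auto
  also have "\<dots> \<le> 2 * R" using S(2)[OF m(1)] by simp
  finally show ?thesis .
qed (use R in simp)

context cauchy_scale begin

lemma power_le_pmf_be:
  assumes x: "0 \<le> x" "x < 1" and h: "0 < h"
  shows "\<forall>\<^sub>F n in sequentially. x ^ n \<le> h * pmf q (int (be n))"
proof -
  obtain z where z: "1 \<le> z" "0 < pmf q (int z)" "\<And>y. y \<ge> z \<Longrightarrow> pmf q (int z) \<le> 2 * (real y / real z) ^ 3 * pmf q (int y)"
    using pmf_potter unfolding eventually_sequentially by blast
  define c where "c = 2 * (2 * D 0 / real z) ^ 3"
  have c: "0 < c" using D_pos[of 0] z by (simp add: c_def)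
  have "\<forall>\<^sub>F n in sequentially. real n ^ 3 * x ^ n < h * pmf q (int z) / c"
    using power_times_pow3_tendsto_0[OF x] by (rule order_tendstoD(2)) (use h z c in simp)
  then show ?thesis
    using be_bounds eventually_be[OF eventually_ge_at_top[of z]] eventually_gt_at_top[of 0]
  proof eventually_elim
    case (elim n)
    have "real (be n) \<le> 2 * (real n * D (al n))" using elim by (simp add: B_def)
    also have "\<dots> \<le> 2 * (real n * D 0)" by (intro mult_left_mono D_antimono) auto
    finally have "real (be n) / real z \<le> 2 * D 0 / real z * real n"
      using z(1) by (simp add: divide_right_mono mult_ac)
    then have "(real (be n) / real z) ^ 3 \<le> (2 * D 0 / real z * real n) ^ 3" by (rule power_mono) simp
    then have "2 * (real (be n) / real z) ^ 3 * pmf q (int (be n)) \<le> 2 * (2 * D 0 / real z * real n) ^ 3 * pmf q (int (be n))"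
      by (intro mult_right_mono mult_left_mono) auto
    with z(3)[of "be n"] elim have "pmf q (int z) \<le> 2 * (2 * D 0 / real z * real n) ^ 3 * pmf q (int (be n))"
      by linarith
    also have "\<dots> = c * (real n ^ 3 * pmf q (int (be n)))" unfolding c_def power_mult_distrib by (simp only: mult_ac)
    finally have "h * pmf q (int z) / c \<le> h * (c * (real n ^ 3 * pmf q (int (be n)))) / c"
      using h c by (intro divide_right_mono mult_left_mono) auto
    also have "\<dots> = real n ^ 3 * (h * pmf q (int (be n)))" using c by simp
    finally have "real n ^ 3 * x ^ n \<le> real n ^ 3 * (h * pmf q (int (be n)))" using elim by linarith
    then show ?case using elim by simp
  qed
qed

lemma prob_bad_le:
  assumes e: "0 < e" and h: "0 < h"
  shows "\<forall>\<^sub>F n in sequentially. measure_pmf.prob (replicate_pmf n q)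
      {xs \<in> excursions n. \<forall>j<n. tl (rotate j xs) \<notin> near_line n (B n) e} \<le> h * pmf q (int (be n))"
proof -
  define K where "K = (4 * 9 * 64 ^ 4 * 8 :: real)"
  have K: "0 < K" by (simp add: K_def)
  obtain z1 where z1: "\<forall>\<^sub>F n in sequentially. \<forall>v. z1 \<le> v \<and> 2 * v \<le> be n \<longrightarrow>
     measure_pmf.prob (replicate_pmf n q)
       {xs \<in> excursions n. (\<exists>x\<in>set xs. int v \<le> x) \<and> set xs \<subseteq> {..<int (2 * v)}}
     \<le> K * (real (2 * v) / real (be n)) * pmf q (int (be n))"
    using prob_excursion_level unfolding K_def by blast
  obtain z2 where z2: "\<And>x. z2 \<le> x \<Longrightarrow> 1 \<le> x \<and> 0 < pmf q (int x) \<and> (\<forall>y\<ge>x. pmf q (int y) \<le> 2 * pmf q (int x)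
      \<and> pmf q (int x) \<le> 2 * (real y / real x) ^ 3 * pmf q (int y))"
    using pmf_potter unfolding eventually_sequentially by blast
  define z where "z = max (max z1 z2) 1"
  define d where "d = min (1/2) (h / (6 * K))"
  have d: "0 < d" "d \<le> 1/2" "d \<le> h / (6 * K)" using h K by (auto simp: d_def)
  define t where "t = (\<lambda>n. nat \<lceil>d * real (be n) / 2\<rceil>)"
  define eta where "eta = h * d ^ 3 / 96"
  have eta: "0 < eta" using h d by (simp add: eta_def)
  define th where "th = measure_pmf.prob q {..<int (2 * z)}"
  have "th = 1 - T (2 * z)"
  proof -
    have "{..<int (2 * z)} = UNIV - {int (2 * z)..}" by auto
    then show ?thesis using measure_pmf.prob_compl[of "{int (2 * z)..}" q] by (simp add: th_def T_def)
  qed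
  then have "th < 1" using T_pos[of "2 * z"] by simp
  moreover have "0 \<le> th" by (simp add: th_def)
  ultimately have th: "0 \<le> th" "th < 1" by simp_all
  have h3: "0 < h / 3" using h by simp
  have big: "\<forall>\<^sub>F n in sequentially. 2 * real z / d \<le> real (be n)"
    using eventually_be[OF eventually_ge_at_top[of "nat \<lceil>2 * real z / d\<rceil>"]]
    by eventually_elim linarith
  show ?thesis
    using z1 power_le_pmf_be[OF th h3] prob_not_near_line[OF e eta] big be_bounds eventually_gt_at_top[of 0]
  proof eventually_elim
    case (elim n)
    let ?P = "measure_pmf.prob (replicate_pmf n q)"
    define b where "b = be n"
    define p where "p = pmf q (int b)"
    have p0: "0 \<le> p" by (simp add: p_def)
    have b: "0 < real b" using elim by (simp add: b_def)
    define bad where "bad = {xs \<in> excursions n. \<forall>j<n. tl (rotate j xs) \<notin> near_line n (B n) e}"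
    define E where "E = (\<lambda>k. {xs \<in> excursions n. (\<exists>x\<in>set xs. int (2 ^ k) \<le> x) \<and> set xs \<subseteq> {..<int (2 * 2 ^ k)}})"
    define S where "S = {k. z \<le> 2 ^ k \<and> (2::real) ^ Suc k \<le> d * real b}"
    define F where "F = {xs \<in> bad. \<exists>x\<in>set xs. int (t n) \<le> x}"
    have db: "d * real b \<le> real b" using d b by (intro mult_left_le_one_le) auto
    have finS: "finite S"
    proof (rule finite_subset[of _ "{..b}"])
      show "S \<subseteq> {..b}"
      proof
        fix k assume "k \<in> S"
        then have "(2::real) ^ Suc k \<le> real b" using db by (simp add: S_def)
        then have "real (2 ^ Suc k) \<le> real b" by simp
        then have "2 ^ Suc k \<le> b" by (simp only: of_nat_le_iff)
        moreover have "k < 2 ^ Suc k" by (rule order.strict_trans2[OF less_exp]) simp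
        ultimately show "k \<in> {..b}" by simp
      qed
    qed simp
    have cover: "bad \<subseteq> {xs. set xs \<subseteq> {..<int (2 * z)}} \<union> (\<Union>k\<in>S. E k) \<union> F"
    proof
      fix xs assume xs: "xs \<in> bad"
      show "xs \<in> {xs. set xs \<subseteq> {..<int (2 * z)}} \<union> (\<Union>k\<in>S. E k) \<union> F"
      proof (cases "set xs \<subseteq> {..<int (2 * z)} \<or> xs \<in> F")
        case False
        define M where "M = Max (set xs)"
        have "set xs \<noteq> {}" using False by auto
        then have M: "M \<in> set xs" "\<And>x. x \<in> set xs \<Longrightarrow> x \<le> M" by (auto simp: M_def)
        from False obtain x where x: "x \<in> set xs" "x \<notin> {..<int (2 * z)}" by blast
        then have Mz: "int (2 * z) \<le> M" using M(2)[OF x(1)] by simp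
        have "M < int (t n)" using False xs M(1) by (auto simp: F_def not_le)
        moreover have "0 \<le> d * real (be n) / 2" using d by simp
        then have "int (t n) = \<lceil>d * real (be n) / 2\<rceil>" by (simp add: t_def)
        ultimately have "real_of_int M < d * real (be n) / 2" by (simp add: less_ceiling_iff)
        then have Md: "2 * real_of_int M < d * real b" by (simp add: b_def)
        define m where "m = nat M"
        have m: "M = int m" "2 * z \<le> m" using Mz by (auto simp: m_def)
        have "1 \<le> m" using m(2) by (simp add: z_def)
        then obtain k where k: "2 ^ k \<le> m" "m < 2 ^ (k + 1)"
          using ex_power_ivl1[of 2 m] by auto
        have "2 * z < 2 * 2 ^ k" using k(2) m(2) by simp
        then have zk: "z \<le> 2 ^ k" by simp
        have "real (2 ^ k) \<le> real m" using k(1) by (simp only: of_nat_le_iff)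
        then have "(2::real) ^ Suc k \<le> 2 * real_of_int M" by (simp add: m(1))
        then have "(2::real) ^ Suc k \<le> d * real b" using Md by linarith
        then have kS: "k \<in> S" using zk unfolding S_def by blast
        have "int (2 ^ k) \<le> M" using k(1) unfolding m(1) by (simp only: of_nat_le_iff)
        moreover have "M < int (2 * 2 ^ k)" using k(2) unfolding m(1) by (simp only: of_nat_less_iff) simp
        ultimately have "xs \<in> E k" using M xs by (force simp: E_def bad_def)
        then show ?thesis using kS by blast
      qed auto
    qed
    have P1: "?P {xs. set xs \<subseteq> {..<int (2 * z)}} \<le> h / 3 * p"
      using prob_all_le[of n q "{..<int (2 * z)}"] elim by (simp add: th_def p_def b_def)
    have P2: "?P (\<Union>k\<in>S. E k) \<le> h / 3 * p"
    proof -
      have "?P (\<Union>k\<in>S. E k) \<le> (\<Sum>k\<in>S. ?P (E k))"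
        using finS by (intro measure_pmf.finite_measure_subadditive_finite) auto
      also have "\<dots> \<le> (\<Sum>k\<in>S. K * p / real b * 2 ^ Suc k)"
      proof (rule sum_mono)
        fix k assume k: "k \<in> S"
        then have "(2::real) ^ Suc k \<le> real b" using db by (simp add: S_def)
        then have "real (2 * 2 ^ k) \<le> real b" by simp
        then have "2 * 2 ^ k \<le> be n" unfolding b_def by (simp only: of_nat_le_iff)
        moreover have "z1 \<le> 2 ^ k" using k by (simp add: S_def z_def)
        ultimately have "?P (E k) \<le> K * (real (2 * 2 ^ k) / real (be n)) * pmf q (int (be n))"
          using elim unfolding E_def by blast
        then show "?P (E k) \<le> K * p / real b * 2 ^ Suc k" by (simp add: p_def b_def mult_ac)
      qed
      also have "\<dots> = K * p / real b * (\<Sum>k\<in>S. 2 ^ Suc k)" by (simp only: sum_distrib_left)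
      also have "\<dots> \<le> K * p / real b * (2 * (d * real b))"
        using finS d b K p0 by (intro mult_left_mono sum_powers_of_2_le) (auto simp: S_def)
      also have "\<dots> = 2 * K * d * p" using b by simp
      also have "\<dots> \<le> 2 * K * (h / (6 * K)) * p" using d K p0 by (intro mult_right_mono mult_left_mono) auto
      also have "\<dots> = h / 3 * p" using K by simp
      finally show ?thesis .
    qed
    have P3: "?P F \<le> h / 3 * p"
    proof -
      define y where "y = t n"
      have y1: "d * real b / 2 \<le> real y" "real y < d * real b / 2 + 1"
      proof -
        have "0 \<le> d * real b / 2" using d by simp
        then have "real y = of_int \<lceil>d * real b / 2\<rceil>" by (simp add: y_def t_def b_def)
        then show "d * real b / 2 \<le> real y" "real y < d * real b / 2 + 1" by linarith+
      qed
      have "2 * real z \<le> d * real b" using elim d by (simp add: b_def field_simps)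
      then have "real z \<le> real y" using y1 by linarith
      then have zy: "z2 \<le> y" "1 \<le> y" by (auto simp: z_def)
      have "d * real b \<le> 1/2 * real b" using d b by (intro mult_right_mono) auto
      moreover have "8 \<le> real b" using elim by (simp add: b_def)
      ultimately have yb: "y \<le> b" using y1 by linarith
      have "?P F \<le> 2 * pmf q (int y) * measure_pmf.prob (replicate_pmf (n - 1) q)
           {ys \<in> - near_line n (B n) e. - 1 - sum_list ys \<in> {int y..}}"
      proof (rule prob_excursion_jump_le)
        fix xs assume xs: "xs \<in> F"
        then obtain x where x: "x \<in> set xs" "int y \<le> x" by (auto simp: F_def y_def)
        obtain j where j: "j < length xs" "hd (rotate j xs) = x" using x(1) by (rule rotate_hd)
        have "length xs = n" using xs by (simp add: F_def bad_def excursions_def)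
        then show "xs \<in> excursions n \<and> (\<exists>j<n. hd (rotate j xs) \<in> {int y..} \<and> tl (rotate j xs) \<in> - near_line n (B n) e)"
          using xs x j by (auto simp: F_def bad_def intro!: exI[of _ j])
      next
        fix k assume k: "k \<in> {int y..}"
        then have "int (nat k) = k" "y \<le> nat k" by auto
        then show "pmf q k \<le> 2 * pmf q (int y)" using z2[OF zy(1)] by metis
      qed (use elim in auto)
      also have "\<dots> \<le> 2 * pmf q (int y) * measure_pmf.prob (replicate_pmf (n - 1) q) (- near_line n (B n) e)"
        by (intro mult_left_mono measure_pmf.finite_measure_mono) auto
      also have "\<dots> \<le> 2 * (2 * (2 / d) ^ 3 * p) * eta"
      proof (intro mult_mono)
        have "pmf q (int y) \<le> 2 * (real b / real y) ^ 3 * p" using z2[OF zy(1)] yb by (simp add: p_def)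
        also have "\<dots> \<le> 2 * (2 / d) ^ 3 * p"
        proof (intro mult_right_mono mult_left_mono power_mono)
          have "0 < real y" using zy by simp
          then show "real b / real y \<le> 2 / d" using y1(1) d by (simp add: field_simps)
        qed (use p0 in auto)
        finally show "pmf q (int y) \<le> 2 * (2 / d) ^ 3 * p" .
      qed (use elim p0 d in auto)
      also have "\<dots> = h / 3 * p" using d by (simp add: eta_def power_divide)
      finally show ?thesis .
    qed
    have "?P bad \<le> ?P ({xs. set xs \<subseteq> {..<int (2 * z)}} \<union> (\<Union>k\<in>S. E k) \<union> F)"
      using cover by (rule measure_pmf.finite_measure_mono) simp
    also have "\<dots> \<le> ?P ({xs. set xs \<subseteq> {..<int (2 * z)}} \<union> (\<Union>k\<in>S. E k)) + ?P F"
      by (intro measure_Un_le) auto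
    also have "\<dots> \<le> ?P {xs. set xs \<subseteq> {..<int (2 * z)}} + ?P (\<Union>k\<in>S. E k) + ?P F"
      by (intro add_right_mono measure_Un_le) auto
    also have "\<dots> \<le> h / 3 * p + h / 3 * p + h / 3 * p" using P1 P2 P3 by (intro add_mono)
    finally show ?case by (simp add: bad_def p_def b_def)
  qed
qed

theorem conditioned_bad_tendsto_0:
  assumes e: "0 < e"
  shows "(\<lambda>n. measure_pmf.prob (replicate_pmf n q)
      {xs \<in> excursions n. \<forall>j<n. tl (rotate j xs) \<notin> near_line n (B n) e}
      / measure_pmf.prob (replicate_pmf n q) (excursions n)) \<longlonglongrightarrow> 0"
proof (rule order_tendstoI)
  fix h :: real assume "0 < h"
  then have "0 < h / 64" by simp
  from prob_bad_le[OF e this] prob_excursions_lower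
  show "\<forall>\<^sub>F n in sequentially. measure_pmf.prob (replicate_pmf n q)
      {xs \<in> excursions n. \<forall>j<n. tl (rotate j xs) \<notin> near_line n (B n) e}
      / measure_pmf.prob (replicate_pmf n q) (excursions n) < h"
  proof eventually_elim
    case (elim n)
    define p r where "p = pmf q (int (be n))" and "r = measure_pmf.prob (replicate_pmf n q) (excursions n)"
    have pr: "0 < p" "p / 32 \<le> r" "0 < r" using elim by (auto simp: p_def r_def)
    have "h / 64 * p < h * (p / 32)" using \<open>0 < h\<close> pr by simp
    also have "\<dots> \<le> h * r" using \<open>0 < h\<close> pr by (intro mult_left_mono) auto
    finally have "h / 64 * p < h * r" .
    then have "measure_pmf.prob (replicate_pmf n q)
      {xs \<in> excursions n. \<forall>j<n. tl (rotate j xs) \<notin> near_line n (B n) e} < h * r"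
      using elim unfolding p_def by linarith
    then show ?case using pr unfolding r_def[symmetric] by (simp add: divide_less_eq)
  qed
next
  fix h :: real assume h: "h < 0"
  show "\<forall>\<^sub>F n in sequentially. h < measure_pmf.prob (replicate_pmf n q)
      {xs \<in> excursions n. \<forall>j<n. tl (rotate j xs) \<notin> near_line n (B n) e}
      / measure_pmf.prob (replicate_pmf n q) (excursions n)"
    by (intro always_eventually allI) (rule less_le_trans[OF h], simp)
qed

end

section \<open>Transfer to the random walk\<close>

lemma (in cauchy_scale) Suc_al: "(\<lambda>n. real n * T (Suc (al n))) \<longlonglongrightarrow> 1"
proof -
  have "(\<lambda>n. real n * pmf q (int (al n))) \<longlonglongrightarrow> 0"
  proof (rule tendsto_sandwich[of "\<lambda>_. 0"])
    show "\<forall>\<^sub>F n in sequentially. real n * pmf q (int (al n)) \<le> 24 * inverse (real (al n))"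
      using eventually_al[OF T_ge] eventually_nT eventually_al[OF eventually_ge_at_top[of 1]]
    proof eventually_elim
      case (elim n)
      define x where "x = real (al n)"
      have x: "0 < x" using elim by (simp add: x_def)
      have "real n * (rho (al n) / (12 * x)) \<le> real n * T (al n)"
        using elim by (intro mult_left_mono) (auto simp: x_def)
      also have "\<dots> \<le> 2" using elim by simp
      finally have "real n * rho (al n) \<le> 24 * x" using x by (simp add: field_simps)
      then have "real n * rho (al n) / x\<^sup>2 \<le> 24 * x / x\<^sup>2" by (rule divide_right_mono) simp
      moreover have "real n * rho (al n) / x\<^sup>2 = real n * pmf q (int (al n))"
        using pmf_eq_rho[of "al n"] elim by (simp add: x_def)
      moreover have "24 * x / x\<^sup>2 = 24 * inverse x" using x by (simp add: power2_eq_square inverse_eq_divide)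
      ultimately show ?case by (simp only: x_def)
    qed
    have "(\<lambda>n. 24 * inverse (real (al n))) \<longlonglongrightarrow> 24 * 0"
      using filterlim_compose[OF filterlim_real_sequentially al_at_top]
      by (intro tendsto_mult tendsto_const tendsto_inverse_0_at_top)
    then show "(\<lambda>n. 24 * inverse (real (al n))) \<longlonglongrightarrow> 0" by simp
  qed auto
  then have "(\<lambda>n. real n * T (al n) - real n * pmf q (int (al n))) \<longlonglongrightarrow> 1 - 0"
    by (intro tendsto_diff nT)
  moreover have "real n * T (al n) - real n * pmf q (int (al n)) = real n * T (Suc (al n))" for n
    using T_diff[of "al n" "Suc (al n)"] by (simp add: algebra_simps)
  ultimately show ?thesis by simp
qed

definition list_path :: "real \<Rightarrow> nat \<Rightarrow> int list \<Rightarrow> real \<Rightarrow> real" where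
  "list_path B n xs = (\<lambda>t\<in>{-1..1}.
     (if \<lfloor>real n * t\<rfloor> < 0 then 0 else real_of_int (sum_list (take (nat \<lfloor>real n * t\<rfloor>) xs))) / B)"

lemma list_path_in_skorokhod_space: "list_path B n xs \<in> skorokhod_space (-1) 1"
  using step_path_in_skorokhod_space[where g = "\<lambda>k. (if k < 0 then 0 else real_of_int (sum_list (take (nat k) xs))) / B"
      and a = "-1" and b = 1 and n = n]
  unfolding list_path_def .

lemma list_path_close:
  assumes xs: "xs \<in> excursions n" and j: "j < n" "tl (rotate j xs) \<in> near_line n B e"
    and B: "0 < B" and e: "0 < e" "e \<le> 1/8" and n: "4 \<le> n"
  shows "skorokhod_dist (-1) 1 limit_path (list_path B n xs) \<le> 4 * e + 1 / B + 2 / real n"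
proof (rule skorokhod_dist_le)
  show "0 < 4 * e + 1 / B + 2 / real n" using B e n by (intro add_pos_pos) auto
  note E = excursion_of_near_line[OF xs j(1) B j(2)]
  have "real j \<le> 2 * (1/8) * real n"
    using E(1) mult_right_mono[of "2 * e" "2 * (1/8)" "real n"] e by simp
  then have jn: "Suc j < n" using n by linarith
  define w where "w = (\<lambda>k. if k < 0 then 0 else real_of_int (sum_list (take (nat k) xs)))"
  have "skorokhod_close (-1) 1 (\<lambda>t\<in>{-1..1}. w \<lfloor>real n * t\<rfloor> / B) limit_path (4 * e + 1 / B + 2 / real n)"
  proof (rule skorokhod_close_limit_path[OF jn B _ E(1)])
    show "0 \<le> w (int k) \<and> w (int k) \<le> 2 * e * B" if "k \<le> j" for k
      using E(2)[OF that] by (simp add: w_def)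
    show "\<bar>w (int k) - (1 - real k / real n) * B\<bar> \<le> 2 * e * B + 1" if "j < k" "k \<le> n" for k
      using E(3)[OF that] by (simp only: w_def of_nat_less_0_iff if_False nat_int)
  qed (use e in \<open>auto simp: w_def\<close>)
  then show "skorokhod_close (-1) 1 limit_path (list_path B n xs) (4 * e + 1 / B + 2 / real n)"
    unfolding list_path_def w_def by (rule skorokhod_close_sym)
qed

lemma pmf_of_random_variable:
  fixes X :: "'a \<Rightarrow> 'b :: countable"
  assumes "prob_space M" and X: "X \<in> measurable M (count_space UNIV)"
  obtains q where "measure_pmf q = distr M (count_space UNIV) X"
    "\<And>x. pmf q x = \<P>(\<omega> in M. X \<omega> = x)"
proof -
  interpret prob_space M by fact
  let ?N = "distr M (count_space UNIV) X"
  interpret N: prob_space ?N using X by (rule prob_space_distr)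
  have "(\<Union>x\<in>{x. measure ?N {x} = 0}. {x}) \<in> null_sets ?N"
    by (rule null_sets_UN') (auto simp: null_sets_def N.emeasure_eq_measure)
  then have "{x. measure ?N {x} = 0} \<in> null_sets ?N" by simp
  then have "AE x in ?N. measure ?N {x} \<noteq> 0" by (rule AE_I') auto
  then have eq: "measure_pmf (Abs_pmf ?N) = ?N"
    by (intro Abs_pmf_inverse) (auto intro: N.prob_space_axioms)
  have "pmf (Abs_pmf ?N) x = \<P>(\<omega> in M. X \<omega> = x)" for x
  proof -
    have "pmf (Abs_pmf ?N) x = measure ?N {x}" by (simp add: pmf.rep_eq eq)
    also have "\<dots> = measure M (X -` {x} \<inter> space M)" using X by (rule measure_distr) simp
    also have "X -` {x} \<inter> space M = {\<omega> \<in> space M. X \<omega> = x}" by auto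
    finally show ?thesis .
  qed
  then show thesis using that eq by blast
qed

lemma pmf_replicate_pmf: "length xs = n \<Longrightarrow> pmf (replicate_pmf n q) xs = (\<Prod>i<n. pmf q (xs ! i))"
proof (induction n arbitrary: xs)
  case (Suc n)
  then obtain y ys where xs: "xs = y # ys" "length ys = n" by (cases xs) auto
  have "replicate_pmf (Suc n) q = map_pmf (\<lambda>(x, xs). x # xs) (pair_pmf q (replicate_pmf n q))"
    by (simp add: pair_pmf_def map_bind_pmf)
  then have "pmf (replicate_pmf (Suc n) q) xs
      = pmf (map_pmf (\<lambda>(x, xs). x # xs) (pair_pmf q (replicate_pmf n q))) ((\<lambda>(x, xs). x # xs) (y, ys))"
    by (simp add: xs)
  also have "\<dots> = pmf (pair_pmf q (replicate_pmf n q)) (y, ys)"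
    by (rule pmf_map_inj') (auto simp: inj_def)
  also have "\<dots> = pmf q y * (\<Prod>i<n. pmf q (ys ! i))" by (simp add: pmf_pair Suc.IH[OF xs(2)])
  also have "\<dots> = (\<Prod>i<Suc n. pmf q (xs ! i))"
    by (simp add: xs(1) prod.lessThan_Suc_shift del: prod.lessThan_Suc)
  finally show ?case .
qed simp

lemma measurable_map_list:
  fixes Xs :: "'i \<Rightarrow> 'a \<Rightarrow> 'b :: countable"
  shows "(\<And>i. i \<in> set is \<Longrightarrow> Xs i \<in> measurable M (count_space UNIV)) \<Longrightarrow>
    (\<lambda>\<omega>. map (\<lambda>i. Xs i \<omega>) is) \<in> measurable M (count_space UNIV)"
proof (induction "is")
  case (Cons i "is")
  have Xi: "Xs i \<in> measurable M (count_space UNIV)" using Cons by simp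
  have ys: "(\<lambda>\<omega>. map (\<lambda>i. Xs i \<omega>) is) \<in> measurable M (count_space UNIV)" using Cons by simp
  have "(\<lambda>\<omega>. Xs i \<omega> # map (\<lambda>i. Xs i \<omega>) is) \<in> measurable M (count_space UNIV)"
  proof (rule measurable_compose_countable[OF _ Xi])
    show "(\<lambda>\<omega>. x # map (\<lambda>i. Xs i \<omega>) is) \<in> measurable M (count_space UNIV)" for x
      by (rule measurable_compose[OF ys]) simp
  qed
  then show ?case by simp
qed simp

lemma (in prob_space) distr_iid_list:
  fixes Xs :: "nat \<Rightarrow> 'a \<Rightarrow> 'b :: countable"
  assumes indep: "indep_vars (\<lambda>_. count_space UNIV) Xs {1..}"
    and id: "\<And>i. i \<ge> 1 \<Longrightarrow> distr M (count_space UNIV) (Xs i) = measure_pmf q"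
  shows "distr M (count_space UNIV) (\<lambda>\<omega>. map (\<lambda>i. Xs i \<omega>) [1..<Suc n]) = measure_pmf (replicate_pmf n q)"
proof -
  define Y where "Y = (\<lambda>\<omega>. map (\<lambda>i. Xs i \<omega>) [1..<Suc n])"
  have meas: "Xs i \<in> measurable M (count_space UNIV)" if "i \<ge> 1" for i
    using indep that by (auto simp: indep_vars_def)
  have Y: "Y \<in> measurable M (count_space UNIV)"
    unfolding Y_def by (rule measurable_map_list) (auto intro: meas)
  have len: "length (Y \<omega>) = n" for \<omega> by (simp add: Y_def del: upt_Suc)
  have nth: "Y \<omega> ! k = Xs (Suc k) \<omega>" if "k < n" for \<omega> k
    using that by (simp add: Y_def del: upt_Suc)
  have "distr M (count_space UNIV) Y = measure_pmf (replicate_pmf n q)"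
  proof (rule measure_eqI_countable)
    fix xs :: "'b list"
    have eY: "emeasure (distr M (count_space UNIV) Y) {xs} = prob (Y -` {xs} \<inter> space M)"
      using Y by (simp add: emeasure_distr emeasure_eq_measure)
    show "emeasure (distr M (count_space UNIV) Y) {xs} = emeasure (measure_pmf (replicate_pmf n q)) {xs}"
    proof (cases "length xs = n")
      case False
      then have "Y -` {xs} \<inter> space M = {}" using len by auto
      moreover have "xs \<notin> set_pmf (replicate_pmf n q)" using False by (simp add: set_replicate_pmf)
      then have "pmf (replicate_pmf n q) xs = 0" by (simp add: set_pmf_iff)
      ultimately show ?thesis unfolding eY by (simp add: emeasure_pmf_single)
    next
      case True
      have Yeq: "Y \<omega> = xs \<longleftrightarrow> (\<forall>i\<in>{1..n}. Xs i \<omega> = xs ! (i - 1))" for \<omega>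
      proof -
        have "Y \<omega> = xs \<longleftrightarrow> (\<forall>k<n. Xs (Suc k) \<omega> = xs ! k)"
          using True by (auto simp: list_eq_iff_nth_eq len nth)
        also have "\<dots> \<longleftrightarrow> (\<forall>i\<in>{1..n}. Xs i \<omega> = xs ! (i - 1))"
        proof
          assume *: "\<forall>k<n. Xs (Suc k) \<omega> = xs ! k"
          show "\<forall>i\<in>{1..n}. Xs i \<omega> = xs ! (i - 1)"
          proof
            fix i assume "i \<in> {1..n}"
            then have "i - 1 < n" "Suc (i - 1) = i" by auto
            then show "Xs i \<omega> = xs ! (i - 1)" using * by metis
          qed
        next
          assume *: "\<forall>i\<in>{1..n}. Xs i \<omega> = xs ! (i - 1)"
          show "\<forall>k<n. Xs (Suc k) \<omega> = xs ! k"
          proof (intro allI impI)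
            fix k assume "k < n"
            then have "Suc k \<in> {1..n}" by simp
            from bspec[OF * this] show "Xs (Suc k) \<omega> = xs ! k" by simp
          qed
        qed
        finally show ?thesis .
      qed
      have "prob (Y -` {xs} \<inter> space M) = (\<Prod>i\<in>{1..n}. prob (Xs i -` {xs ! (i - 1)} \<inter> space M))"
      proof (cases "n = 0")
        case True
        have "Y -` {xs} \<inter> space M = space M" using True Yeq by auto
        then show ?thesis using True by (simp add: prob_space)
      next
        case False
        then have "Y -` {xs} \<inter> space M = (\<Inter>i\<in>{1..n}. Xs i -` {xs ! (i - 1)} \<inter> space M)"
          using Yeq by auto
        also have "prob \<dots> = (\<Prod>i\<in>{1..n}. prob (Xs i -` {xs ! (i - 1)} \<inter> space M))"
          using False by (intro indep_varsD[OF indep]) auto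
        finally show ?thesis .
      qed
      also have "\<dots> = (\<Prod>i\<in>{1..n}. pmf q (xs ! (i - 1)))"
      proof (rule prod.cong)
        fix i assume "i \<in> {1..n}"
        then have i: "i \<ge> 1" by simp
        have "pmf q x = prob (Xs i -` {x} \<inter> space M)" for x
          using measure_distr[OF meas[OF i], of "{x}"] by (simp add: id[OF i] pmf.rep_eq)
        then show "prob (Xs i -` {xs ! (i - 1)} \<inter> space M) = pmf q (xs ! (i - 1))" by simp
      qed simp
      also have "\<dots> = (\<Prod>i<n. pmf q (xs ! i))"
        by (rule prod.reindex_bij_witness[of _ Suc "\<lambda>i. i - 1"]) auto
      finally show ?thesis unfolding eY by (simp add: emeasure_pmf_single pmf_replicate_pmf[OF True])
    qed
  qed auto
  then show ?thesis unfolding Y_def .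
qed

lemma space_borel_of: "space (borel_of T) = topspace T"
  unfolding borel_of_def by (rule space_measure_of) (auto dest: openin_subset)

lemma openin_imp_sets_borel_of: "openin T U \<Longrightarrow> U \<in> sets (borel_of T)"
  unfolding borel_of_def by (subst sets_measure_of) (auto dest: openin_subset)

lemma continuous_map_borel_of:
  assumes "continuous_map T euclideanreal \<phi>"
  shows "\<phi> \<in> borel_measurable (borel_of T)"
proof (rule borel_measurableI)
  fix S :: "real set" assume "open S"
  then have "openin T {x \<in> topspace T. \<phi> x \<in> S}"
    using assms by (auto simp: continuous_map_def)
  then show "\<phi> -` S \<inter> space (borel_of T) \<in> sets (borel_of T)"
    by (auto simp: space_borel_of Int_def vimage_def conj_commute dest: openin_imp_sets_borel_of)
qed

lemma hitting_time_eq_iff: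
  assumes n: "0 < n"
  shows "hitting_time Xs \<omega> = enat n \<longleftrightarrow> walk Xs n \<omega> < 0 \<and> (\<forall>k<n. 0 \<le> walk Xs k \<omega>)"
proof -
  define S where "S = {enat i |i. i \<ge> 1 \<and> walk Xs i \<omega> < 0}"
  have S: "enat i \<in> S \<longleftrightarrow> i \<ge> 1 \<and> walk Xs i \<omega> < 0" for i by (auto simp: S_def)
  have hS: "hitting_time Xs \<omega> = Inf S" unfolding hitting_time_def S_def ..
  show ?thesis
  proof
    assume h: "hitting_time Xs \<omega> = enat n"
    have ne: "S \<noteq> {}" using h hS by (auto simp: top_enat_def)
    then obtain x where "x \<in> S" by blast
    then have "(LEAST x. x \<in> S) \<in> S" by (rule LeastI)
    then have "Inf S \<in> S" using ne by (simp add: Inf_enat_def)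
    then have "enat n \<in> S" using h hS by simp
    then have "walk Xs n \<omega> < 0" unfolding S by simp
    moreover have "0 \<le> walk Xs k \<omega>" if "k < n" for k
    proof (rule ccontr)
      assume neg: "\<not> 0 \<le> walk Xs k \<omega>"
      then have "k \<noteq> 0" by (intro notI) (simp add: walk_def)
      then have "enat k \<in> S" using neg by (simp add: S)
      then have "Inf S \<le> enat k" by (rule Inf_lower)
      then show False using h hS that by simp
    qed
    ultimately show "walk Xs n \<omega> < 0 \<and> (\<forall>k<n. 0 \<le> walk Xs k \<omega>)" by blast
  next
    assume w: "walk Xs n \<omega> < 0 \<and> (\<forall>k<n. 0 \<le> walk Xs k \<omega>)"
    have "Inf S \<le> enat n" using w n by (intro Inf_lower) (simp add: S)
    moreover have "enat n \<le> Inf S"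
    proof (rule Inf_greatest)
      fix x assume "x \<in> S"
      then obtain i where i: "x = enat i" "walk Xs i \<omega> < 0" by (auto simp: S_def)
      then have "\<not> i < n" using w by (meson not_le)
      then show "enat n \<le> x" using i by simp
    qed
    ultimately show "hitting_time Xs \<omega> = enat n" using hS by simp
  qed
qed

lemma (in Metric_space) weak_conv_in_return:
  assumes l: "l \<in> M"
    and prob: "\<forall>\<^sub>F n in sequentially. prob_space (\<mu> n) \<and> sets (\<mu> n) = sets (borel_of mtopology)"
    and conv: "\<And>r. 0 < r \<Longrightarrow> (\<lambda>n. measure (\<mu> n) (M - mball l r)) \<longlonglongrightarrow> 0"
  shows "weak_conv_in mtopology \<mu> (return (borel_of mtopology) l)"
  unfolding weak_conv_in_def
proof (intro conjI allI impI prob)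
  have l': "l \<in> space (borel_of mtopology)" using l by (simp add: space_borel_of)
  then show "prob_space (return (borel_of mtopology) l)" by (rule prob_space_return)
  show "sets (return (borel_of mtopology) l) = sets (borel_of mtopology)" by simp
  fix \<phi> assume "continuous_map mtopology euclideanreal \<phi> \<and> bounded (\<phi> ` topspace mtopology)"
  then have cont: "continuous_map mtopology euclideanreal \<phi>" and "bounded (\<phi> ` M)" by auto
  then obtain C where C: "\<And>f. f \<in> M \<Longrightarrow> \<bar>\<phi> f\<bar> \<le> C" by (auto simp: bounded_iff)
  have C0: "0 \<le> C" using C[OF l] by linarith
  have \<phi>: "\<phi> \<in> borel_measurable (borel_of mtopology)" using cont by (rule continuous_map_borel_of)
  have "(\<lambda>n. \<integral>f. \<phi> f \<partial>\<mu> n) \<longlonglongrightarrow> \<phi> l"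
  proof (rule tendstoI)
    fix e :: real assume e: "0 < e"
    have "openin mtopology {f \<in> topspace mtopology. \<phi> f \<in> ball (\<phi> l) (e / 2)}"
      using cont by (rule openin_continuous_map_preimage) simp
    moreover have "l \<in> {f \<in> topspace mtopology. \<phi> f \<in> ball (\<phi> l) (e / 2)}" using l e by simp
    ultimately obtain r where r: "0 < r" "mball l r \<subseteq> {f \<in> topspace mtopology. \<phi> f \<in> ball (\<phi> l) (e / 2)}"
      unfolding openin_mtopology by blast
    have "0 < e / (4 * C + 4)" using e C0 by simp
    then have "\<forall>\<^sub>F n in sequentially. measure (\<mu> n) (M - mball l r) < e / (4 * C + 4)"
      by (rule order_tendstoD(2)[OF conv[OF r(1)]])
    with prob show "\<forall>\<^sub>F n in sequentially. dist (\<integral>f. \<phi> f \<partial>\<mu> n) (\<phi> l) < e"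
    proof eventually_elim
      case (elim n)
      interpret m: prob_space "\<mu> n" using elim by simp
      have sets: "sets (\<mu> n) = sets (borel_of mtopology)" using elim by simp
      then have space: "space (\<mu> n) = M" by (simp add: sets_eq_imp_space_eq[OF sets] space_borel_of)
      have "space (borel_of mtopology) - mball l r \<in> sets (borel_of mtopology)"
        by (intro sets.compl_sets openin_imp_sets_borel_of) simp
      then have A: "M - mball l r \<in> sets (\<mu> n)" by (simp add: sets space_borel_of)
      have \<phi>m: "\<phi> \<in> borel_measurable (\<mu> n)"
        unfolding measurable_cong_sets[OF sets refl] by (rule \<phi>)
      have int: "integrable (\<mu> n) \<phi>"
        by (rule m.integrable_const_bound[where B = C]) (auto simp: space C \<phi>m)
      have "(\<integral>f. \<phi> f \<partial>\<mu> n) - \<phi> l = (\<integral>f. \<phi> f - \<phi> l \<partial>\<mu> n)"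
        using int by (simp add: m.prob_space)
      also have "\<bar>\<dots>\<bar> \<le> (\<integral>f. e / 2 + 2 * C * indicator (M - mball l r) f \<partial>\<mu> n)"
      proof (rule order_trans[OF integral_abs_bound])
        show "(\<integral>f. \<bar>\<phi> f - \<phi> l\<bar> \<partial>\<mu> n) \<le> (\<integral>f. e / 2 + 2 * C * indicator (M - mball l r) f \<partial>\<mu> n)"
        proof (rule integral_mono)
          show "integrable (\<mu> n) (\<lambda>f. \<bar>\<phi> f - \<phi> l\<bar>)" using int by simp
          show "integrable (\<mu> n) (\<lambda>f. e / 2 + 2 * C * indicator (M - mball l r) f)"
            using A by (simp add: less_top[symmetric])
          fix f assume f: "f \<in> space (\<mu> n)"
          show "\<bar>\<phi> f - \<phi> l\<bar> \<le> e / 2 + 2 * C * indicator (M - mball l r) f"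
          proof (cases "f \<in> mball l r")
            case True
            then have "dist (\<phi> l) (\<phi> f) < e / 2" using r(2) by auto
            then show ?thesis using True by (simp add: dist_real_def abs_minus_commute)
          next
            case False
            have fM: "f \<in> M" using f space by simp
            with False have ind: "indicator (M - mball l r) f = (1::real)" by simp
            show ?thesis unfolding ind using C[OF fM] C[OF l] e by linarith
          qed
        qed
      qed
      also have "\<dots> = e / 2 + 2 * C * measure (\<mu> n) (M - mball l r)"
        using A by (simp add: m.prob_space less_top[symmetric])
      also have "\<dots> \<le> e / 2 + 2 * C * (e / (4 * C + 4))"
        using elim C0 by (intro add_left_mono mult_left_mono) auto
      also have "\<dots> < e / 2 + e / 2"
      proof -
        have "2 * C * e < e / 2 * (4 * C + 4)" using e by (simp add: algebra_simps)
        then have "2 * C * e / (4 * C + 4) < e / 2" using C0 by (subst pos_divide_less_eq) auto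
        then show ?thesis by simp
      qed
      finally show ?case by (simp add: dist_real_def)
    qed
  qed
  then show "(\<lambda>n. \<integral>f. \<phi> f \<partial>\<mu> n) \<longlonglongrightarrow> (\<integral>f. \<phi> f \<partial>return (borel_of mtopology) l)"
    using integral_return[OF l' \<phi>] by simp
qed

definition step_list :: "(nat \<Rightarrow> 'a \<Rightarrow> int) \<Rightarrow> nat \<Rightarrow> 'a \<Rightarrow> int list" where
  "step_list Xs n \<omega> = map (\<lambda>i. Xs i \<omega>) [1..<Suc n]"

lemma walk_eq_sum_list:
  assumes "k \<le> n"
  shows "walk Xs k \<omega> = sum_list (take k (step_list Xs n \<omega>))"
proof -
  have "take k [1..<Suc n] = [1..<1 + k]" by (rule take_upt) (use assms in simp)
  then have "sum_list (take k (step_list Xs n \<omega>)) = sum_list (map (\<lambda>i. Xs i \<omega>) [1..<Suc k])"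
    unfolding step_list_def take_map by (simp only: plus_1_eq_Suc)
  also have "\<dots> = (\<Sum>i\<in>{1..<Suc k}. Xs i \<omega>)" by (simp only: interv_sum_list_conv_sum_set_nat set_upt)
  also have "\<dots> = walk Xs k \<omega>" by (simp only: walk_def atLeastLessThanSuc_atLeastAtMost)
  finally show ?thesis ..
qed

lemma scaled_path_eq_list_path: "scaled_path Xs b n \<omega> = list_path \<bar>b n\<bar> n (step_list Xs n \<omega>)"
  unfolding scaled_path_def list_path_def
proof (rule restrict_ext)
  fix t :: real assume t: "t \<in> {-1..1}"
  have "real n * t \<le> real n * 1" using t by (intro mult_left_mono) auto
  then have "\<lfloor>real n * t\<rfloor> \<le> int n" by (simp add: floor_le_iff)
  then have "nat \<lfloor>real n * t\<rfloor> \<le> n" by simp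
  from walk_eq_sum_list[OF this, of Xs \<omega>]
  show "real_of_int (extended_walk Xs \<lfloor>real n * t\<rfloor> \<omega>) / \<bar>b n\<bar> =
      (if \<lfloor>real n * t\<rfloor> < 0 then 0 else real_of_int (sum_list (take (nat \<lfloor>real n * t\<rfloor>) (step_list Xs n \<omega>)))) / \<bar>b n\<bar>"
    by (simp add: extended_walk_def)
qed

definition hitting_lists :: "nat \<Rightarrow> int list set" where
  "hitting_lists n = {xs. length xs = n \<and> sum_list xs < 0 \<and> (\<forall>k<n. 0 \<le> sum_list (take k xs))}"

lemma hitting_time_iff_step_list:
  assumes "0 < n"
  shows "hitting_time Xs \<omega> = enat n \<longleftrightarrow> step_list Xs n \<omega> \<in> hitting_lists n"
proof -
  have len: "length (step_list Xs n \<omega>) = n" by (simp add: step_list_def del: upt_Suc)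
  have "walk Xs n \<omega> = sum_list (step_list Xs n \<omega>)" using walk_eq_sum_list[of n n Xs \<omega>] len by simp
  moreover have "walk Xs k \<omega> = sum_list (take k (step_list Xs n \<omega>))" if "k < n" for k
    using that by (intro walk_eq_sum_list) simp
  ultimately show ?thesis unfolding hitting_time_eq_iff[OF assms] hitting_lists_def using len by auto
qed

lemma (in cauchy_step) prob_hitting_lists:
  assumes n: "0 < n"
  shows "measure_pmf.prob (replicate_pmf n q) (hitting_lists n \<inter> A)
    = measure_pmf.prob (replicate_pmf n q) (excursions n \<inter> A)"
proof -
  let ?R = "replicate_pmf n q"
  have "sum_list xs = -1" if xs: "xs \<in> hitting_lists n" "xs \<in> set_pmf ?R" for xs
  proof -
    have len: "length xs = n" "set xs \<subseteq> set_pmf q" using xs(2) by (auto simp: set_replicate_pmf)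
    have "xs = take (n - 1) xs @ [xs ! (n - 1)]"
      using take_Suc_conv_app_nth[of "n - 1" xs] len n by simp
    then have "sum_list xs = sum_list (take (n - 1) xs @ [xs ! (n - 1)])" by (rule arg_cong)
    then have "sum_list xs = sum_list (take (n - 1) xs) + xs ! (n - 1)" by simp
    moreover have "0 \<le> sum_list (take (n - 1) xs)" "sum_list xs < 0"
      using xs(1) n by (auto simp: hitting_lists_def)
    moreover have "xs ! (n - 1) \<in> set_pmf q" using len n nth_mem[of "n - 1" xs] by auto
    then have "-1 \<le> xs ! (n - 1)" using skip_free[of "xs ! (n - 1)"] by (force simp: set_pmf_iff)
    ultimately show ?thesis by linarith
  qed
  then have "hitting_lists n \<inter> A \<inter> set_pmf ?R = excursions n \<inter> A \<inter> set_pmf ?R"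
    by (auto simp: hitting_lists_def excursions_def)
  then show ?thesis by (metis measure_Int_set_pmf)
qed

theorem theorem23:
  fixes M :: "'a measure" and X :: "'a \<Rightarrow> int" and Xs :: "nat \<Rightarrow> 'a \<Rightarrow> int"
    and L :: "real \<Rightarrow> real" and a b :: "nat \<Rightarrow> real"
  assumes "prob_space M"
    and "X \<in> measurable M (count_space UNIV)"
    and "integrable M (\<lambda>\<omega>. real_of_int (X \<omega>))"
    and "(\<integral>\<omega>. real_of_int (X \<omega>) \<partial>M) = 0"
    and "\<P>(\<omega> in M. X \<omega> < -1) = 0"
    and "slowly_varying L"
    and "(\<lambda>x::nat. \<P>(\<omega> in M. X \<omega> = int x)) \<sim>[sequentially] (\<lambda>x. L (real x) / (real x)\<^sup>2)"
    and "prob_space.indep_vars M (\<lambda>_. count_space UNIV) Xs {1..}"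
    and "\<And>i. i \<ge> 1 \<Longrightarrow> distr M (count_space UNIV) (Xs i) = distr M (count_space UNIV) X"
    and "(\<lambda>n. real n * \<P>(\<omega> in M. real_of_int (X \<omega>) \<ge> a n)) \<longlonglongrightarrow> 1"
    and "\<And>n. n \<ge> 1 \<Longrightarrow>
      b n = real n * (\<integral>\<omega>. real_of_int (X \<omega>) * indicator {\<omega>. \<bar>real_of_int (X \<omega>)\<bar> \<le> a n} \<omega> \<partial>M)"
  shows "weak_conv_in (J1_topology (-1) 1) (conditioned_path_law M Xs b)
           (return (borel_of (J1_topology (-1) 1)) limit_path)"
proof -
  interpret prob_space M by fact
  note X = assms(2)
  obtain q where q: "measure_pmf q = distr M (count_space UNIV) X" "\<And>x. pmf q x = \<P>(\<omega> in M. X \<omega> = x)"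
    using pmf_of_random_variable[OF assms(1) X] by blast
  have expq: "measure_pmf.expectation q f = (\<integral>\<omega>. f (X \<omega>) \<partial>M)" for f :: "int \<Rightarrow> real"
    unfolding q(1) using X by (intro integral_distr) auto
  have probq: "measure_pmf.prob q A = prob (X -` A \<inter> space M)" for A
    unfolding q(1) using X by (intro measure_distr) auto
  interpret S: cauchy_step q
  proof
    show "pmf q x = 0" if "x < -1" for x
    proof -
      have "pmf q x \<le> \<P>(\<omega> in M. X \<omega> < -1)"
        unfolding q(2) using that X by (intro finite_measure_mono) auto
      then show ?thesis using assms(5) pmf_nonneg[of q x] by simp
    qed
    show "integrable (measure_pmf q) real_of_int"
      unfolding q(1) using assms(3) X by (subst integrable_distr_eq) auto
    show "measure_pmf.expectation q real_of_int = 0" unfolding expq by (rule assms(4))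
    show "\<exists>x0. \<forall>x\<ge>x0. 0 < (real x)\<^sup>2 * pmf q (int x) \<and> (\<forall>y. x \<le> y \<and> real y \<le> m * real x \<longrightarrow>
        \<bar>(real y)\<^sup>2 * pmf q (int y) - (real x)\<^sup>2 * pmf q (int x)\<bar> \<le> e * ((real x)\<^sup>2 * pmf q (int x)))"
      if "0 < e" "1 < m" for e m :: real
      using square_mult_uniformly_slowly_varying[OF assms(6,7) that] by (simp add: q(2))
  qed
  have tail: "S.T x = \<P>(\<omega> in M. int x \<le> X \<omega>)" for x
    unfolding S.T_def probq by (rule arg_cong[where f = prob]) auto
  define al where "al = (\<lambda>n. nat \<lceil>a n\<rceil>)"
  define al' where "al' = (\<lambda>n. Suc (nat \<lfloor>a n\<rfloor>))"
  have a1: "\<forall>\<^sub>F n in sequentially. 1 < a n"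
  proof -
    have "(\<lambda>n. real n * \<P>(\<omega> in M. a n \<le> real_of_int (X \<omega>)) * (1 / real n)) \<longlonglongrightarrow> 1 * 0"
      by (intro tendsto_mult assms(10) lim_1_over_n)
    then have "\<forall>\<^sub>F n in sequentially. real n * \<P>(\<omega> in M. a n \<le> real_of_int (X \<omega>)) * (1 / real n) < S.T 1"
      using S.T_pos by (intro order_tendstoD(2)) auto
    then show ?thesis
      using eventually_gt_at_top[of 0]
    proof eventually_elim
      case (elim n)
      then have lt: "\<P>(\<omega> in M. a n \<le> real_of_int (X \<omega>)) < S.T 1" by simp
      show ?case
      proof (rule ccontr)
        assume "\<not> 1 < a n"
        then have "S.T 1 \<le> \<P>(\<omega> in M. a n \<le> real_of_int (X \<omega>))"
          unfolding tail using X by (intro finite_measure_mono) auto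
        then show False using lt by simp
      qed
    qed
  qed
  have "\<forall>\<^sub>F n in sequentially. real n * \<P>(\<omega> in M. a n \<le> real_of_int (X \<omega>)) = real n * S.T (al n)"
    using a1
  proof eventually_elim
    case (elim n)
    then have "int (al n) = \<lceil>a n\<rceil>" by (simp add: al_def)
    then show ?case unfolding tail by (simp add: ceiling_le_iff)
  qed
  then have nT: "(\<lambda>n. real n * S.T (al n)) \<longlonglongrightarrow> 1"
    using assms(10) by (rule Lim_transform_eventually[rotated])
  interpret C: cauchy_scale q al by standard (rule nT)
  have nT': "(\<lambda>n. real n * S.T (al' n)) \<longlonglongrightarrow> 1"
  proof (rule tendsto_sandwich[OF _ _ C.Suc_al nT])
    have al: "al n \<le> al' n \<and> al' n \<le> Suc (al n)" for n
      unfolding al_def al'_def by linarith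
    show "\<forall>\<^sub>F n in sequentially. real n * S.T (Suc (al n)) \<le> real n * S.T (al' n)"
      using al by (intro always_eventually allI mult_left_mono S.T_antimono) auto
    show "\<forall>\<^sub>F n in sequentially. real n * S.T (al' n) \<le> real n * S.T (al n)"
      using al by (intro always_eventually allI mult_left_mono S.T_antimono) auto
  qed
  interpret C': cauchy_scale q al' by standard (rule nT')
  have bB: "\<forall>\<^sub>F n in sequentially. \<bar>b n\<bar> = C'.B n"
    using a1 eventually_ge_at_top[of 1]
  proof eventually_elim
    case (elim n)
    have "(\<integral>\<omega>. real_of_int (X \<omega>) * indicator {\<omega>. \<bar>real_of_int (X \<omega>)\<bar> \<le> a n} \<omega> \<partial>M)
       = measure_pmf.expectation q (\<lambda>k. real_of_int k * indicator {k. \<bar>real_of_int k\<bar> \<le> a n} k)"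
      unfolding expq by (simp add: indicator_def)
    also have "\<dots> = measure_pmf.expectation q (\<lambda>k. real_of_int k * indicator {..<int (al' n)} k)"
    proof (rule integral_cong_AE)
      show "AE k in measure_pmf q. real_of_int k * indicator {k. \<bar>real_of_int k\<bar> \<le> a n} k
          = real_of_int k * indicator {..<int (al' n)} k"
        using S.AE_ge
      proof eventually_elim
        case (elim k)
        have al: "int (al' n) = \<lfloor>a n\<rfloor> + 1" using \<open>1 < a n\<close> by (simp add: al'_def)
        have "\<bar>real_of_int k\<bar> \<le> a n \<longleftrightarrow> real_of_int k \<le> a n" using elim \<open>1 < a n\<close> by linarith
        also have "\<dots> \<longleftrightarrow> k < int (al' n)" unfolding al by linarith
        finally show ?case by (simp add: indicator_def)
      qed
    qed auto
    also have "\<dots> = - S.D (al' n)" by (rule S.expectation_below)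
    finally have "b n = - C'.B n" using assms(11)[OF elim(2)] by (simp add: C'.B_def)
    moreover have "0 \<le> C'.B n" using S.D_nonneg by (simp add: C'.B_def)
    ultimately show ?case by simp
  qed
  define Y where "Y = step_list Xs"
  have Xs: "Xs i \<in> measurable M (count_space UNIV)" if "i \<ge> 1" for i
    using assms(8) that by (auto simp: indep_vars_def)
  have Y: "Y n \<in> measurable M (count_space UNIV)" for n
    unfolding Y_def step_list_def by (rule measurable_map_list) (auto intro: Xs)
  have "distr M (count_space UNIV) (\<lambda>\<omega>. map (\<lambda>i. Xs i \<omega>) [1..<Suc n]) = measure_pmf (replicate_pmf n q)" for n
    using assms(9) q(1) by (intro distr_iid_list[OF assms(8)]) simp
  then have dY: "distr M (count_space UNIV) (Y n) = measure_pmf (replicate_pmf n q)" for n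
    unfolding Y_def step_list_def .
  define H where "H = (\<lambda>n. {\<omega> \<in> space M. hitting_time Xs \<omega> = enat n})"
  have H: "H n = Y n -` hitting_lists n \<inter> space M" if "0 < n" for n
    unfolding H_def Y_def using hitting_time_iff_step_list[OF that, of Xs] by auto
  have HA: "prob (H n \<inter> (Y n -` A \<inter> space M)) = measure_pmf.prob (replicate_pmf n q) (excursions n \<inter> A)"
    if "0 < n" for n A
  proof -
    have "H n \<inter> (Y n -` A \<inter> space M) = Y n -` (hitting_lists n \<inter> A) \<inter> space M"
      using H[OF that] by auto
    then have "prob (H n \<inter> (Y n -` A \<inter> space M)) = measure_pmf.prob (replicate_pmf n q) (hitting_lists n \<inter> A)"
      unfolding dY[symmetric] using measure_distr[OF Y, of "hitting_lists n \<inter> A" n] by simp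
    then show ?thesis using S.prob_hitting_lists[OF that] by simp
  qed
  define T where "T = J1_topology (-1) 1"
  define U where "U = (\<lambda>n. uniform_measure M (H n))"
  have path: "scaled_path Xs b n = (\<lambda>\<omega>. list_path \<bar>b n\<bar> n (Y n \<omega>))" for n
    by (rule ext) (simp add: scaled_path_eq_list_path Y_def)
  have meas: "scaled_path Xs b n \<in> measurable (U n) (borel_of T)" for n
  proof -
    have "list_path \<bar>b n\<bar> n \<in> measurable (count_space UNIV) (borel_of T)"
      by (simp add: measurable_count_space_eq1 space_borel_of T_def topspace_J1_topology list_path_in_skorokhod_space)
    then have "scaled_path Xs b n \<in> measurable M (borel_of T)"
      unfolding path using Y by (rule measurable_compose[rotated])
    moreover have "sets (U n) = sets M" by (simp add: U_def)
    ultimately show ?thesis by (simp only: measurable_cong_sets[of "U n" M "borel_of T" "borel_of T"])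
  qed
  have law: "conditioned_path_law M Xs b n = distr (U n) (borel_of T) (scaled_path Xs b n)" for n
    by (simp add: conditioned_path_law_def U_def H_def T_def)
  have pos: "\<forall>\<^sub>F n in sequentially. 0 < n \<and> 0 < measure_pmf.prob (replicate_pmf n q) (excursions n)"
    using C'.prob_excursions_lower eventually_gt_at_top[of 0]
    by eventually_elim auto
  have Hpos: "emeasure M (H n) \<noteq> 0" "prob (H n) = measure_pmf.prob (replicate_pmf n q) (excursions n)"
    if "0 < n \<and> 0 < measure_pmf.prob (replicate_pmf n q) (excursions n)" for n
  proof -
    show "prob (H n) = measure_pmf.prob (replicate_pmf n q) (excursions n)"
      using HA[of n UNIV] that H[of n] by (simp add: Int_absorb2)
    then show "emeasure M (H n) \<noteq> 0" using that by (simp add: emeasure_eq_measure)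
  qed
  interpret Sk: Metric_space "skorokhod_space (-1) 1" "skorokhod_dist (-1) 1"
    by (rule Metric_space_skorokhod)
  have T: "T = Sk.mtopology" by (simp add: T_def J1_topology_def)
  have "weak_conv_in Sk.mtopology (conditioned_path_law M Xs b) (return (borel_of Sk.mtopology) limit_path)"
  proof (rule Sk.weak_conv_in_return[OF limit_path_in_skorokhod_space])
    show "\<forall>\<^sub>F n in sequentially. prob_space (conditioned_path_law M Xs b n) \<and>
        sets (conditioned_path_law M Xs b n) = sets (borel_of Sk.mtopology)"
      using pos
    proof eventually_elim
      case (elim n)
      have "prob_space (U n)" unfolding U_def using Hpos(1)[OF elim] by (intro prob_space_uniform_measure) auto
      then show ?case unfolding law using meas by (auto simp: T intro: prob_space.prob_space_distr)
    qed
    fix r :: real assume r: "0 < r"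
    define e where "e = min (1/8) (r / 16)"
    have e: "0 < e" "e \<le> 1/8" "e \<le> r / 16" using r by (auto simp: e_def)
    let ?bad = "\<lambda>n. {xs \<in> excursions n. \<forall>j<n. tl (rotate j xs) \<notin> near_line n (C'.B n) e}"
    show "(\<lambda>n. measure (conditioned_path_law M Xs b n) (skorokhod_space (-1) 1 - Sk.mball limit_path r)) \<longlonglongrightarrow> 0"
    proof (rule tendsto_sandwich[OF _ _ tendsto_const C'.conditioned_bad_tendsto_0[OF e(1)]])
      show "\<forall>\<^sub>F n in sequentially. 0 \<le> measure (conditioned_path_law M Xs b n) (skorokhod_space (-1) 1 - Sk.mball limit_path r)"
        by simp
      have "\<forall>\<^sub>F n in sequentially. 4 / r < C'.B n"
        using C'.B_at_top by (auto simp: filterlim_at_top_dense)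
      moreover have "\<forall>\<^sub>F n in sequentially. 8 / r < real n"
        using filterlim_real_sequentially unfolding filterlim_at_top_dense by blast
      ultimately show "\<forall>\<^sub>F n in sequentially.
          measure (conditioned_path_law M Xs b n) (skorokhod_space (-1) 1 - Sk.mball limit_path r)
          \<le> measure_pmf.prob (replicate_pmf n q) (?bad n) / measure_pmf.prob (replicate_pmf n q) (excursions n)"
        using pos bB eventually_ge_at_top[of 4]
      proof eventually_elim
        case (elim n)
        define F where "F = skorokhod_space (-1) 1 - Sk.mball limit_path r"
        define A where "A = {xs. list_path \<bar>b n\<bar> n xs \<in> F}"
        have "0 < 4 / r" using r by simp
        then have B: "0 < C'.B n" using elim(1) by linarith
        have FT: "F \<in> sets (borel_of T)"
        proof -
          have "space (borel_of T) - Sk.mball limit_path r \<in> sets (borel_of T)"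
            by (intro sets.compl_sets openin_imp_sets_borel_of) (simp add: T)
          then show ?thesis by (simp add: F_def space_borel_of T)
        qed
        have "measure (conditioned_path_law M Xs b n) F
            = measure (U n) (scaled_path Xs b n -` F \<inter> space (U n))"
          unfolding law by (rule measure_distr[OF meas FT])
        also have "scaled_path Xs b n -` F \<inter> space (U n) = Y n -` A \<inter> space M"
          unfolding path A_def U_def by auto
        also have "measure (U n) (Y n -` A \<inter> space M)
            = prob (H n \<inter> (Y n -` A \<inter> space M)) / prob (H n)"
          unfolding U_def using Hpos(1)[OF elim(3)] measurable_sets[OF Y, of A]
          by (intro measure_uniform_measure) simp_all
        also have "\<dots> = measure_pmf.prob (replicate_pmf n q) (excursions n \<inter> A)
            / measure_pmf.prob (replicate_pmf n q) (excursions n)"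
          using HA Hpos(2) elim(3) by simp
        also have "\<dots> \<le> measure_pmf.prob (replicate_pmf n q) (?bad n) / measure_pmf.prob (replicate_pmf n q) (excursions n)"
        proof (intro divide_right_mono measure_pmf.finite_measure_mono)
          show "excursions n \<inter> A \<subseteq> ?bad n"
          proof
            fix xs assume xs: "xs \<in> excursions n \<inter> A"
            have "tl (rotate j xs) \<notin> near_line n (C'.B n) e" if j: "j < n" for j
            proof
              assume near: "tl (rotate j xs) \<in> near_line n (C'.B n) e"
              have "skorokhod_dist (-1) 1 limit_path (list_path (C'.B n) n xs) \<le> 4 * e + 1 / C'.B n + 2 / real n"
                using xs by (intro list_path_close[OF _ j near B e(1,2) elim(5)]) simp
              also have "\<dots> < 4 * (r / 16) + r / 4 + r / 4"
              proof -
                have "1 / C'.B n < r / 4" using elim(1) B r by (simp add: field_simps)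
                moreover have "2 / real n < r / 4" using elim(2) elim(5) r by (simp add: field_simps)
                ultimately show ?thesis using e(3) by linarith
              qed
              also have "\<dots> \<le> r" using r by simp
              finally have "list_path \<bar>b n\<bar> n xs \<in> Sk.mball limit_path r"
                using elim(4) limit_path_in_skorokhod_space list_path_in_skorokhod_space by (simp add: Sk.in_mball)
              then show False using xs by (simp add: A_def F_def)
            qed
            then show "xs \<in> ?bad n" using xs by simp
          qed
        qed simp_all
        finally show ?case unfolding F_def .
      qed
    qed
  qed
  then show ?thesis unfolding T[unfolded T_def, symmetric] .
qed

end
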